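(* Let $P$ be a CP-ideal of a Lie algebra $L$ and take any $f\in L^*_{\mathrm{reg}}$. Then: 1. If $k$ is algebraically closed, then $\mathrm{ind}(f|_P,L)$ is simple. 2. If $L$ is completely solvable, then $P$ is a Vergne polarization with respect to $f$ and any flag of ideals containing $P$. In particular, $\mathrm{ind}(f|_P,L)$ is absolutely simple. 3. (a) $Sz(U(L))\subset U(P)$ and $Sz(D(L))\subset D(P)$. (b) Put $\wedge(L)=\{\lambda\in L^*\mid U(L)_\lambda\neq 0\}$ and $L_\wedge=\bigcap_{\lambda\in\wedge(L)}\ker\lambda$. Then $P\subset L_\wedge$.
   Context: All Lie algebras are finite-dimensional over a field $k$ of characteristic zero. For a Lie algebra $L$ and $f\in L^*$, put $L(f)=\{x\in L\mid f([x,y])=0 \text{ for all } y\in L\}$. The index of $L$ is $i(L)=\min_{f\in L^*}\dim L(f)$, and $f$ is regular if $\dim L(f)=i(L)$; $L^*_{\mathrm{reg}}$ is the set of regular $f\in L^*$. A CP (commutative polarization) of $L$ is a commutative Lie subalgebra $P$ which is a polarization with respect to some $f\in L^*$, i.e. $f([P,P])=0$ and $\dim P=\frac12(\dim L+\dim L(f))$; equivalently, a commutative Lie subalgebra $P$ with $\dim P=\frac12(\dim L+i(L))$ (it is then a polarization with respect to every regular $f$). A CP-ideal is a CP which is an ideal of $L$. $U(L)$ is the enveloping algebra of $L$ and $D(L)$ its quotient division ring; $U(P)\subset U(L)$ and $D(P)\subset D(L)$ are those of $P$. For $f\in L^*$ with $f([P,P])=0$, $f|_P$ is regarded as a one-dimensional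 representation $k_f$ of $P$ and $\mathrm{ind}(f|_P,L)$ is the induced $U(L)$-module $U(L)\otimes_{U(P)}k_f$. A module is absolutely simple if it remains simple after every extension of the base field. $L$ is completely solvable if it has a flag of ideals $0=L_0\subset L_1\subset\cdots\subset L_n=L$, $\dim L_j=j$. Given such a flag and $f\in L^*$, the Vergne polarization with respect to $f$ and this flag is $\sum_{i=1}^n L_i(f_i)$, where $f_i=f|_{L_i}$ and $L_i(f_i)=\{x\in L_i\mid f([x,L_i])=0\}$. A flag of ideals contains $P$ if $L_p=P$ for $p=\dim P$. For $\lambda\in L^*$, $U(L)_\lambda=\{u\in U(L)\mid [x,u]=\lambda(x)u \text{ for all } x\in L\}$ and similarly $D(L)_\lambda=\{u\in D(L)\mid [x,u]=\lambda(x)u\text{ for all }x\in L\}$; the semi-centers are $Sz(U(L))=\bigoplus_\lambda U(L)_\lambda$ and $Sz(D(L))=\bigoplus_\lambda D(L)_\lambda$. *)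

theory Defs
  imports
    "HOL-Algebra.Algebraic_Closure_Type"
    "HOL-Algebra.QuotRing"
    "HOL-Algebra.Free_Abelian_Groups"
begin

section \<open>Lie algebras\<close>

locale lie_algebra = vector_space scale
  for scale :: "'k::field_char_0 \<Rightarrow> 'a::ab_group_add \<Rightarrow> 'a" +
  fixes bracket :: "'a \<Rightarrow> 'a \<Rightarrow> 'a"
  assumes finite_dimensional: "\<exists>B. finite B \<and> span B = UNIV"
    and bracket_add_left: "bracket (x + y) z = bracket x z + bracket y z"
    and bracket_add_right: "bracket x (y + z) = bracket x y + bracket x z"
    and bracket_scale_left: "bracket (scale c x) y = scale c (bracket x y)"
    and bracket_scale_right: "bracket x (scale c y) = scale c (bracket x y)"
    and bracket_self: "bracket x x = 0"
    and jacobi: "bracket x (bracket y z) + bracket y (bracket z x) + bracket z (bracket x y) = 0"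

text \<open>
  The Lie algebra \<open>L\<close> is a whole type \<open>'a\<close>; it enters the definitions below through its scalar
  multiplication \<open>s\<close> and its bracket \<open>b\<close>. Subalgebras, ideals and members of flags are subsets.
\<close>

definition dual :: "('k::field_char_0 \<Rightarrow> 'a::ab_group_add \<Rightarrow> 'a) \<Rightarrow> ('a \<Rightarrow> 'k) set" where
  "dual s = {f. Vector_Spaces.linear s (*) f}"

definition lie_subalgebra ::
  "('k::field_char_0 \<Rightarrow> 'a::ab_group_add \<Rightarrow> 'a) \<Rightarrow> ('a \<Rightarrow> 'a \<Rightarrow> 'a) \<Rightarrow> 'a set \<Rightarrow> bool" where
  "lie_subalgebra s b P \<longleftrightarrow> Modules.module.subspace s P \<and> (\<forall>x\<in>P. \<forall>y\<in>P. b x y \<in> P)"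

definition lie_ideal ::
  "('k::field_char_0 \<Rightarrow> 'a::ab_group_add \<Rightarrow> 'a) \<Rightarrow> ('a \<Rightarrow> 'a \<Rightarrow> 'a) \<Rightarrow> 'a set \<Rightarrow> bool" where
  "lie_ideal s b P \<longleftrightarrow> Modules.module.subspace s P \<and> (\<forall>x. \<forall>y\<in>P. b x y \<in> P)"

text \<open>For a subspace \<open>M\<close> this is \<open>M(f|\<^sub>M)\<close>; in particular \<open>radical b f UNIV\<close> is \<open>L(f)\<close>.\<close>
definition radical :: "('a \<Rightarrow> 'a \<Rightarrow> 'a) \<Rightarrow> ('a \<Rightarrow> 'k::field_char_0) \<Rightarrow> 'a set \<Rightarrow> 'a set" where
  "radical b f M = {x \<in> M. \<forall>y\<in>M. f (b x y) = 0}"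

definition index ::
  "('k::field_char_0 \<Rightarrow> 'a::ab_group_add \<Rightarrow> 'a) \<Rightarrow> ('a \<Rightarrow> 'a \<Rightarrow> 'a) \<Rightarrow> nat" where
  "index s b = (LEAST n. \<exists>f\<in>dual s. vector_space.dim s (radical b f UNIV) = n)"

definition regular ::
  "('k::field_char_0 \<Rightarrow> 'a::ab_group_add \<Rightarrow> 'a) \<Rightarrow> ('a \<Rightarrow> 'a \<Rightarrow> 'a) \<Rightarrow> ('a \<Rightarrow> 'k) set" where
  "regular s b = {f \<in> dual s. vector_space.dim s (radical b f UNIV) = index s b}"

text \<open>The dimension condition is \<open>dim P = (dim L + dim L(f)) / 2\<close>, cleared of the denominator.\<close>
definition polarization ::
  "('k::field_char_0 \<Rightarrow> 'a::ab_group_add \<Rightarrow> 'a) \<Rightarrow> ('a \<Rightarrow> 'a \<Rightarrow> 'a) \<Rightarrow> ('a \<Rightarrow> 'k) \<Rightarrow> 'a set \<Rightarrow> bool" where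
  "polarization s b f P \<longleftrightarrow> lie_subalgebra s b P \<and> (\<forall>x\<in>P. \<forall>y\<in>P. f (b x y) = 0) \<and>
     2 * vector_space.dim s P = vector_space.dim s (UNIV :: 'a set) + vector_space.dim s (radical b f UNIV)"

definition CP ::
  "('k::field_char_0 \<Rightarrow> 'a::ab_group_add \<Rightarrow> 'a) \<Rightarrow> ('a \<Rightarrow> 'a \<Rightarrow> 'a) \<Rightarrow> 'a set \<Rightarrow> bool" where
  "CP s b P \<longleftrightarrow> lie_subalgebra s b P \<and> (\<forall>x\<in>P. \<forall>y\<in>P. b x y = 0) \<and>
     (\<exists>f\<in>dual s. polarization s b f P)"

definition CP_ideal ::
  "('k::field_char_0 \<Rightarrow> 'a::ab_group_add \<Rightarrow> 'a) \<Rightarrow> ('a \<Rightarrow> 'a \<Rightarrow> 'a) \<Rightarrow> 'a set \<Rightarrow> bool" where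
  "CP_ideal s b P \<longleftrightarrow> CP s b P \<and> lie_ideal s b P"

definition flag_of_ideals ::
  "('k::field_char_0 \<Rightarrow> 'a::ab_group_add \<Rightarrow> 'a) \<Rightarrow> ('a \<Rightarrow> 'a \<Rightarrow> 'a) \<Rightarrow> (nat \<Rightarrow> 'a set) \<Rightarrow> bool" where
  "flag_of_ideals s b F \<longleftrightarrow> (let n = vector_space.dim s (UNIV :: 'a set) in
     F 0 = {0} \<and> F n = UNIV \<and> (\<forall>j<n. F j \<subseteq> F (Suc j)) \<and>
     (\<forall>j\<le>n. lie_ideal s b (F j) \<and> vector_space.dim s (F j) = j))"

definition completely_solvable ::
  "('k::field_char_0 \<Rightarrow> 'a::ab_group_add \<Rightarrow> 'a) \<Rightarrow> ('a \<Rightarrow> 'a \<Rightarrow> 'a) \<Rightarrow> bool" where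
  "completely_solvable s b \<longleftrightarrow> (\<exists>F. flag_of_ideals s b F)"

definition vergne_polarization ::
  "('k::field_char_0 \<Rightarrow> 'a::ab_group_add \<Rightarrow> 'a) \<Rightarrow> ('a \<Rightarrow> 'a \<Rightarrow> 'a) \<Rightarrow> ('a \<Rightarrow> 'k) \<Rightarrow>
     (nat \<Rightarrow> 'a set) \<Rightarrow> 'a set" where
  "vergne_polarization s b f F =
     Modules.module.span s (\<Union>i\<in>{1..vector_space.dim s (UNIV :: 'a set)}. radical b f (F i))"

section \<open>Enveloping algebras\<close>

text \<open>
  The free associative unital algebra on the set \<open>S\<close>: finitely supported functions on words, with
  the product extending concatenation bilinearly.
\<close>
definition word_algebra :: "'a set \<Rightarrow> ('a list \<Rightarrow>\<^sub>0 'k::field_char_0) ring" where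
  "word_algebra S = \<lparr>
     carrier = {p. Poly_Mapping.keys p \<subseteq> lists S},
     monoid.mult = (\<lambda>p q. \<Sum>u\<in>Poly_Mapping.keys p. \<Sum>v\<in>Poly_Mapping.keys q.
       Poly_Mapping.single (u @ v) (Poly_Mapping.lookup p u * Poly_Mapping.lookup q v)),
     one = Poly_Mapping.single [] 1,
     ring.zero = 0,
     add = (+)\<rparr>"

text \<open>
  The first two families of relations turn the free algebra on the set \<open>S\<close> into the tensor algebra of
  the vector space \<open>S\<close>, the third one is \<open>x y - y x = [x, y]\<close>.
\<close>
definition env_relations ::
  "('k::field_char_0 \<Rightarrow> 'a::ab_group_add \<Rightarrow> 'a) \<Rightarrow> ('a \<Rightarrow> 'a \<Rightarrow> 'a) \<Rightarrow> 'a set \<Rightarrow>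
     ('a list \<Rightarrow>\<^sub>0 'k) set" where
  "env_relations s b S =
     {Poly_Mapping.single [x + y] 1 - Poly_Mapping.single [x] 1 - Poly_Mapping.single [y] 1
        | x y. x \<in> S \<and> y \<in> S} \<union>
     {Poly_Mapping.single [s c x] 1 - Poly_Mapping.single [x] c | c x. x \<in> S} \<union>
     {Poly_Mapping.single [x, y] 1 - Poly_Mapping.single [y, x] 1 - Poly_Mapping.single [b x y] 1
        | x y. x \<in> S \<and> y \<in> S}"

definition env_ideal ::
  "('k::field_char_0 \<Rightarrow> 'a::ab_group_add \<Rightarrow> 'a) \<Rightarrow> ('a \<Rightarrow> 'a \<Rightarrow> 'a) \<Rightarrow> 'a set \<Rightarrow>
     ('a list \<Rightarrow>\<^sub>0 'k) set" where
  "env_ideal s b S = Idl\<^bsub>word_algebra S\<^esub> (env_relations s b S)"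

text \<open>\<open>U(S)\<close> for a Lie subalgebra \<open>S\<close>; \<open>U(L)\<close> is the case \<open>S = UNIV\<close>.\<close>
definition env ::
  "('k::field_char_0 \<Rightarrow> 'a::ab_group_add \<Rightarrow> 'a) \<Rightarrow> ('a \<Rightarrow> 'a \<Rightarrow> 'a) \<Rightarrow> 'a set \<Rightarrow>
     ('a list \<Rightarrow>\<^sub>0 'k) set ring" where
  "env s b S = word_algebra S Quot env_ideal s b S"

definition env_gen ::
  "('k::field_char_0 \<Rightarrow> 'a::ab_group_add \<Rightarrow> 'a) \<Rightarrow> ('a \<Rightarrow> 'a \<Rightarrow> 'a) \<Rightarrow> 'a \<Rightarrow>
     ('a list \<Rightarrow>\<^sub>0 'k) set" where
  "env_gen s b x = env_ideal s b UNIV +>\<^bsub>word_algebra UNIV\<^esub> Poly_Mapping.single [x] 1"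

definition env_scalar ::
  "('k::field_char_0 \<Rightarrow> 'a::ab_group_add \<Rightarrow> 'a) \<Rightarrow> ('a \<Rightarrow> 'a \<Rightarrow> 'a) \<Rightarrow> 'k \<Rightarrow>
     ('a list \<Rightarrow>\<^sub>0 'k) set" where
  "env_scalar s b c = env_ideal s b UNIV +>\<^bsub>word_algebra UNIV\<^esub> Poly_Mapping.single [] c"

text \<open>
  The canonical map from \<open>U(P)\<close> to \<open>U(L)\<close>: a coset of the ideal for \<open>P\<close> is enlarged to the coset of
  the ideal for \<open>L\<close> containing it. Its image is \<open>U(P)\<close> seen inside \<open>U(L)\<close>.
\<close>
definition env_incl ::
  "('k::field_char_0 \<Rightarrow> 'a::ab_group_add \<Rightarrow> 'a) \<Rightarrow> ('a \<Rightarrow> 'a \<Rightarrow> 'a) \<Rightarrow>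
     ('a list \<Rightarrow>\<^sub>0 'k) set \<Rightarrow> ('a list \<Rightarrow>\<^sub>0 'k) set" where
  "env_incl s b Z = env_ideal s b UNIV <+>\<^bsub>word_algebra UNIV\<^esub> Z"

definition env_sub ::
  "('k::field_char_0 \<Rightarrow> 'a::ab_group_add \<Rightarrow> 'a) \<Rightarrow> ('a \<Rightarrow> 'a \<Rightarrow> 'a) \<Rightarrow> 'a set \<Rightarrow>
     ('a list \<Rightarrow>\<^sub>0 'k) set set" where
  "env_sub s b P = env_incl s b ` carrier (env s b P)"

definition word_eval :: "('a \<Rightarrow> 'k::field_char_0) \<Rightarrow> ('a list \<Rightarrow>\<^sub>0 'k) \<Rightarrow> 'k" where
  "word_eval f p = (\<Sum>w\<in>Poly_Mapping.keys p. Poly_Mapping.lookup p w * prod_list (map f w))"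

text \<open>
  The character of \<open>U(P)\<close> extending \<open>f|\<^sub>P\<close>; when \<open>f\<close> vanishes on \<open>[P, P]\<close>, \<open>word_eval f\<close> is
  constant on each coset \<open>Z\<close> in \<open>U(P)\<close>.
\<close>
definition env_character :: "('a \<Rightarrow> 'k::field_char_0) \<Rightarrow> ('a list \<Rightarrow>\<^sub>0 'k) set \<Rightarrow> 'k" where
  "env_character f Z = the_elem (word_eval f ` Z)"

section \<open>Quotient division rings and semi-centers\<close>

text \<open>
  \<open>D\<close>, with the embedding \<open>j\<close>, is a quotient division ring of \<open>R\<close>; these are determined by \<open>R\<close> up to a
  unique isomorphism compatible with the embeddings.
\<close>
definition quotient_division_ring ::
  "('u, 'm) ring_scheme \<Rightarrow> ('d, 'n) ring_scheme \<Rightarrow> ('u \<Rightarrow> 'd) \<Rightarrow> bool" where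
  "quotient_division_ring R D j \<longleftrightarrow>
     ring D \<and> Units D = carrier D - {\<zero>\<^bsub>D\<^esub>} \<and> j \<in> ring_hom R D \<and> inj_on j (carrier R) \<and>
     (\<forall>d\<in>carrier D. \<exists>u\<in>carrier R. \<exists>v\<in>carrier R - {\<zero>\<^bsub>R\<^esub>}. d = j u \<otimes>\<^bsub>D\<^esub> inv\<^bsub>D\<^esub> (j v))"

text \<open>
  \<open>D(P)\<close> inside \<open>D\<close>, for a subring \<open>A\<close> of \<open>R\<close> which is itself an Ore domain (here: \<open>U(P)\<close>).
\<close>
definition fractions_of ::
  "('u, 'm) ring_scheme \<Rightarrow> ('d, 'n) ring_scheme \<Rightarrow> ('u \<Rightarrow> 'd) \<Rightarrow> 'u set \<Rightarrow> 'd set" where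
  "fractions_of R D j A = {j u \<otimes>\<^bsub>D\<^esub> inv\<^bsub>D\<^esub> (j v) | u v. u \<in> A \<and> v \<in> A - {\<zero>\<^bsub>R\<^esub>}}"

text \<open>
  For a \<open>k\<close>-algebra \<open>R\<close> with structure map \<open>c\<close> from \<open>k\<close> and a map \<open>g\<close> from \<open>L\<close> to \<open>R\<close>, these are
  \<open>R\<^sub>\<lambda>\<close> and the sum of the \<open>R\<^sub>\<lambda>\<close>; they are used for both \<open>U(L)\<close> and \<open>D(L)\<close>.
\<close>
definition weight_space ::
  "('u, 'm) ring_scheme \<Rightarrow> ('a \<Rightarrow> 'u) \<Rightarrow> ('k \<Rightarrow> 'u) \<Rightarrow> ('a \<Rightarrow> 'k) \<Rightarrow> 'u set" where
  "weight_space R g c \<mu> = {u \<in> carrier R. \<forall>x. g x \<otimes>\<^bsub>R\<^esub> u \<ominus>\<^bsub>R\<^esub> u \<otimes>\<^bsub>R\<^esub> g x = c (\<mu> x) \<otimes>\<^bsub>R\<^esub> u}"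

definition semicenter ::
  "('k::field_char_0 \<Rightarrow> 'a::ab_group_add \<Rightarrow> 'a) \<Rightarrow> ('u, 'm) ring_scheme \<Rightarrow> ('a \<Rightarrow> 'u) \<Rightarrow>
     ('k \<Rightarrow> 'u) \<Rightarrow> 'u set" where
  "semicenter s R g c = generate (add_monoid R) (\<Union>\<mu>\<in>dual s. weight_space R g c \<mu>)"

definition env_weights ::
  "('k::field_char_0 \<Rightarrow> 'a::ab_group_add \<Rightarrow> 'a) \<Rightarrow> ('a \<Rightarrow> 'a \<Rightarrow> 'a) \<Rightarrow> ('a \<Rightarrow> 'k) set" where
  "env_weights s b = {\<mu> \<in> dual s.
     weight_space (env s b UNIV) (env_gen s b) (env_scalar s b) \<mu> \<noteq> {\<zero>\<^bsub>env s b UNIV\<^esub>}}"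

definition weights_kernel ::
  "('k::field_char_0 \<Rightarrow> 'a::ab_group_add \<Rightarrow> 'a) \<Rightarrow> ('a \<Rightarrow> 'a \<Rightarrow> 'a) \<Rightarrow> 'a set" where
  "weights_kernel s b = (\<Inter>\<mu>\<in>env_weights s b. {x. \<mu> x = 0})"

section \<open>Modules over noncommutative rings\<close>

text \<open>
  HOL-Algebra has modules over commutative rings only. A left \<open>R\<close>-module is given here by its
  abelian group \<open>M\<close>, which is a multiplicatively written HOL-Algebra group, and by its action.
\<close>
definition simple_module ::
  "('r, 'm) ring_scheme \<Rightarrow> ('v, 'n) monoid_scheme \<Rightarrow> ('r \<Rightarrow> 'v \<Rightarrow> 'v) \<Rightarrow> bool" where
  "simple_module R M act \<longleftrightarrow> carrier M \<noteq> {\<one>\<^bsub>M\<^esub>} \<and>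
     (\<forall>N. subgroup N M \<and> (\<forall>r\<in>carrier R. \<forall>x\<in>N. act r x \<in> N) \<longrightarrow> N = {\<one>\<^bsub>M\<^esub>} \<or> N = carrier M)"

text \<open>
  The tensor product over \<open>R\<close> of a right module \<open>A\<close> (action \<open>ra\<close>) and a left module \<open>B\<close>
  (action \<open>lb\<close>): the free abelian group on pairs modulo \<open>tensor_null\<close>.
\<close>
definition tensor_null ::
  "('r, 'm) ring_scheme \<Rightarrow> ('a, 'n) monoid_scheme \<Rightarrow> ('a \<Rightarrow> 'r \<Rightarrow> 'a) \<Rightarrow>
     ('b, 'l) monoid_scheme \<Rightarrow> ('r \<Rightarrow> 'b \<Rightarrow> 'b) \<Rightarrow> ('a \<times> 'b \<Rightarrow>\<^sub>0 int) set" where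
  "tensor_null R A ra B lb = generate (free_Abelian_group (carrier A \<times> carrier B))
    ({frag_of (x \<otimes>\<^bsub>A\<^esub> x', y) - frag_of (x, y) - frag_of (x', y)
        | x x' y. x \<in> carrier A \<and> x' \<in> carrier A \<and> y \<in> carrier B} \<union>
     {frag_of (x, y \<otimes>\<^bsub>B\<^esub> y') - frag_of (x, y) - frag_of (x, y')
        | x y y'. x \<in> carrier A \<and> y \<in> carrier B \<and> y' \<in> carrier B} \<union>
     {frag_of (ra x r, y) - frag_of (x, lb r y)
        | x r y. x \<in> carrier A \<and> r \<in> carrier R \<and> y \<in> carrier B})"

definition tensor_group ::
  "('r, 'm) ring_scheme \<Rightarrow> ('a, 'n) monoid_scheme \<Rightarrow> ('a \<Rightarrow> 'r \<Rightarrow> 'a) \<Rightarrow>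
     ('b, 'l) monoid_scheme \<Rightarrow> ('r \<Rightarrow> 'b \<Rightarrow> 'b) \<Rightarrow> ('a \<times> 'b \<Rightarrow>\<^sub>0 int) set monoid" where
  "tensor_group R A ra B lb =
     free_Abelian_group (carrier A \<times> carrier B) Mod tensor_null R A ra B lb"

text \<open>
  The coset of \<open>x\<close> modulo \<open>N\<close>, and the maps on cosets induced by extending a map \<open>g\<close> on pairs
  additively (resp. biadditively). If \<open>g\<close> is compatible with the relations, all cosets in the unions
  below coincide; the group in \<open>tensor_coset\<close> only supplies the addition.
\<close>
definition tensor_coset :: "('p \<Rightarrow>\<^sub>0 int) set \<Rightarrow> ('p \<Rightarrow>\<^sub>0 int) \<Rightarrow> ('p \<Rightarrow>\<^sub>0 int) set" where
  "tensor_coset N x = N #>\<^bsub>free_Abelian_group UNIV\<^esub> x"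

definition tensor_map ::
  "('q \<Rightarrow>\<^sub>0 int) set \<Rightarrow> ('p \<Rightarrow> 'q) \<Rightarrow> ('p \<Rightarrow>\<^sub>0 int) set \<Rightarrow> ('q \<Rightarrow>\<^sub>0 int) set" where
  "tensor_map N g Z = (\<Union>x\<in>Z. tensor_coset N (frag_extend (\<lambda>p. frag_of (g p)) x))"

definition tensor_map2 ::
  "('q \<Rightarrow>\<^sub>0 int) set \<Rightarrow> ('p \<Rightarrow> 'r \<Rightarrow> 'q) \<Rightarrow> ('p \<Rightarrow>\<^sub>0 int) set \<Rightarrow> ('r \<Rightarrow>\<^sub>0 int) set \<Rightarrow>
     ('q \<Rightarrow>\<^sub>0 int) set" where
  "tensor_map2 N g Z Y = (\<Union>x\<in>Z. \<Union>y\<in>Y. tensor_coset N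
     (frag_extend (\<lambda>p. frag_extend (\<lambda>r. frag_of (g p r)) y) x))"

text \<open>The induced module \<open>ind(f|\<^sub>P, L)\<close>: relations, underlying group, action of \<open>U(L)\<close>.\<close>
definition ind_null ::
  "('k::field_char_0 \<Rightarrow> 'a::ab_group_add \<Rightarrow> 'a) \<Rightarrow> ('a \<Rightarrow> 'a \<Rightarrow> 'a) \<Rightarrow> ('a \<Rightarrow> 'k) \<Rightarrow> 'a set \<Rightarrow>
     (('a list \<Rightarrow>\<^sub>0 'k) set \<times> 'k \<Rightarrow>\<^sub>0 int) set" where
  "ind_null s b f P = tensor_null (env s b P)
     (add_monoid (env s b UNIV)) (\<lambda>u Z. u \<otimes>\<^bsub>env s b UNIV\<^esub> env_incl s b Z)
     (add_monoid (ring_of_type_algebra :: 'k ring)) (\<lambda>Z c. env_character f Z * c)"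

definition ind_module ::
  "('k::field_char_0 \<Rightarrow> 'a::ab_group_add \<Rightarrow> 'a) \<Rightarrow> ('a \<Rightarrow> 'a \<Rightarrow> 'a) \<Rightarrow> ('a \<Rightarrow> 'k) \<Rightarrow> 'a set \<Rightarrow>
     (('a list \<Rightarrow>\<^sub>0 'k) set \<times> 'k \<Rightarrow>\<^sub>0 int) set monoid" where
  "ind_module s b f P = tensor_group (env s b P)
     (add_monoid (env s b UNIV)) (\<lambda>u Z. u \<otimes>\<^bsub>env s b UNIV\<^esub> env_incl s b Z)
     (add_monoid (ring_of_type_algebra :: 'k ring)) (\<lambda>Z c. env_character f Z * c)"

definition ind_action ::
  "('k::field_char_0 \<Rightarrow> 'a::ab_group_add \<Rightarrow> 'a) \<Rightarrow> ('a \<Rightarrow> 'a \<Rightarrow> 'a) \<Rightarrow> ('a \<Rightarrow> 'k) \<Rightarrow> 'a set \<Rightarrow>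
     ('a list \<Rightarrow>\<^sub>0 'k) set \<Rightarrow> (('a list \<Rightarrow>\<^sub>0 'k) set \<times> 'k \<Rightarrow>\<^sub>0 int) set \<Rightarrow>
     (('a list \<Rightarrow>\<^sub>0 'k) set \<times> 'k \<Rightarrow>\<^sub>0 int) set" where
  "ind_action s b f P u = tensor_map (ind_null s b f P) (\<lambda>(v, c). (u \<otimes>\<^bsub>env s b UNIV\<^esub> v, c))"

text \<open>
  Base change along a field homomorphism \<open>h\<close> from \<open>k\<close> to \<open>K\<close>: for a \<open>k\<close>-vector space with additive
  group \<open>G\<close> and scalar multiplication \<open>sm\<close>, the group \<open>K \<otimes> G\<close> over \<open>k\<close>.
\<close>
definition base_change_null ::
  "('c, 'm) ring_scheme \<Rightarrow> ('k::field_char_0 \<Rightarrow> 'c) \<Rightarrow> ('v, 'n) monoid_scheme \<Rightarrow>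
     ('k \<Rightarrow> 'v \<Rightarrow> 'v) \<Rightarrow> ('c \<times> 'v \<Rightarrow>\<^sub>0 int) set" where
  "base_change_null K h G sm = tensor_null (ring_of_type_algebra :: 'k ring)
     (add_monoid K) (\<lambda>d c. d \<otimes>\<^bsub>K\<^esub> h c) G sm"

definition base_change ::
  "('c, 'm) ring_scheme \<Rightarrow> ('k::field_char_0 \<Rightarrow> 'c) \<Rightarrow> ('v, 'n) monoid_scheme \<Rightarrow>
     ('k \<Rightarrow> 'v \<Rightarrow> 'v) \<Rightarrow> ('c \<times> 'v \<Rightarrow>\<^sub>0 int) set monoid" where
  "base_change K h G sm = tensor_group (ring_of_type_algebra :: 'k ring)
     (add_monoid K) (\<lambda>d c. d \<otimes>\<^bsub>K\<^esub> h c) G sm"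

text \<open>The ring \<open>K \<otimes> A\<close> for a \<open>k\<close>-algebra \<open>A\<close> with structure map \<open>sc\<close> from \<open>k\<close>.\<close>
definition base_change_ring ::
  "('c, 'm) ring_scheme \<Rightarrow> ('k::field_char_0 \<Rightarrow> 'c) \<Rightarrow> ('u, 'n) ring_scheme \<Rightarrow> ('k \<Rightarrow> 'u) \<Rightarrow>
     ('c \<times> 'u \<Rightarrow>\<^sub>0 int) set ring" where
  "base_change_ring K h A sc =
    (let sm = (\<lambda>c a. sc c \<otimes>\<^bsub>A\<^esub> a);
         N = base_change_null K h (add_monoid A) sm;
         G = base_change K h (add_monoid A) sm
     in \<lparr>carrier = carrier G,
         monoid.mult = tensor_map2 N (\<lambda>(d, a) (d', a'). (d \<otimes>\<^bsub>K\<^esub> d', a \<otimes>\<^bsub>A\<^esub> a')),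
         one = tensor_coset N (frag_of (\<one>\<^bsub>K\<^esub>, \<one>\<^bsub>A\<^esub>)),
         ring.zero = \<one>\<^bsub>G\<^esub>,
         add = monoid.mult G\<rparr>)"

definition absolutely_simple ::
  "'c itself \<Rightarrow> ('u, 'm) ring_scheme \<Rightarrow> ('k::field_char_0 \<Rightarrow> 'u) \<Rightarrow> ('v, 'n) monoid_scheme \<Rightarrow>
     ('u \<Rightarrow> 'v \<Rightarrow> 'v) \<Rightarrow> bool" where
  "absolutely_simple (_ :: 'c itself) A sc M act \<longleftrightarrow>
    (\<forall>(K :: 'c ring) h. field K \<and> h \<in> ring_hom (ring_of_type_algebra :: 'k ring) K \<longrightarrow>
      (let sm = (\<lambda>c. act (sc c)) in
       simple_module (base_change_ring K h A sc) (base_change K h M sm)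
         (tensor_map2 (base_change_null K h M sm) (\<lambda>(d, a) (d', m). (d \<otimes>\<^bsub>K\<^esub> d', act a m)))))"

end

theory Submission
  imports Defs
begin

text \<open>
  As \<open>f\<close> is regular, \<open>P\<close> is its own orthogonal for the form \<open>f [x, y]\<close>, so there are \<open>p\<^sub>j \<in> P\<close> and
  \<open>x\<^sub>j \<in> L\<close> with \<open>y - \<Sum>\<^sub>j f [p\<^sub>j, y] x\<^sub>j \<in> P\<close> for all \<open>y\<close>. On a module generated by vectors on which
  \<open>P\<close> acts through \<open>f\<close>, filtered by the degree in \<open>L/P\<close>, the operators \<open>p\<^sub>j - f(p\<^sub>j)\<close> lower the
  degree like partial derivatives, and Euler's identity says that \<open>\<Sum>\<^sub>j x\<^sub>j (p\<^sub>j - f(p\<^sub>j))\<close> is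
  multiplication by \<open>n\<close> in degree \<open>n\<close> modulo lower degree. Hence a vector killed by all
  \<open>p - f(p)\<close> has degree 0, and every nonzero submodule contains one. This makes the induced module
  simple over any field of characteristic zero, also after base change; it is nonzero by the
  Poincare-Birkhoff-Witt theorem.

  An element of \<open>U(L)\<close> that commutes with \<open>P\<close> sends the generator of the module induced from \<open>g\<close> to
  a multiple of itself for all \<open>g\<close> in general position, so its PBW components outside \<open>U(P)\<close> are
  polynomials in \<open>g\<close> that vanish generically; it therefore lies in \<open>U(P)\<close>. Since \<open>ad p\<close> lowers the
  degree for \<open>p \<in> P\<close>, semi-invariants of \<open>U(L)\<close> have weights vanishing on \<open>P\<close> and commute with \<open>P\<close>.
  For a semi-invariant \<open>d\<close> of \<open>D(L)\<close> the right ideal of all \<open>v\<close> with \<open>d v \<in> U(L)\<close> is stable under \<open>ad P\<close>;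
  its nonzero elements of least degree commute with \<open>P\<close>, so \<open>d\<close> has a denominator in \<open>U(P)\<close>.
\<close>

text \<open>The obstacle is that none of the modules is given as a concrete vector space. U(L) is a
  quotient of the free algebra, the induced module a quotient of a free abelian group, and its base
  change a further such quotient, so that linearity in letters or scalars holds only up to
  relations. All computation is done with representatives, and \<open>character_module\<close>
  states the module axioms modulo a set \<open>N\<close> of null elements; one descent argument then
  serves words modulo a left ideal and formal sums over K alike. Degree 0 is a set \<open>V\<close>,
  not a line over k, because base change turns it into a copy of K.

  The degree argument rests on P being an ideal: moving p past a letter y leaves [p, y], which is
  again in P and hence acts by a scalar plus terms of lower degree. The letters from P are placed
  last in sorted words because the induced module imposes its relations on the right; the
  coefficient functionals are then compatible with them. Characteristic zero enters by dividing by n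
  in Euler's identity, by the infinitely many points of a line through f, and by the distinct powers
  of 2 that separate monomials.\<close>

section \<open>The free algebra\<close>

text \<open>With concatenation as addition of words, \<open>'a list \<Rightarrow>\<^sub>0 'k\<close> is an instance of class \<open>ring_1\<close>
  whose product is that of \<open>word_algebra\<close>.\<close>

instantiation list :: (type) monoid_add
begin
definition zero_list :: "'a list" where "zero_list = []"
definition plus_list :: "'a list \<Rightarrow> 'a list \<Rightarrow> 'a list" where "plus_list u v = u @ v"
instance by standard (simp_all add: zero_list_def plus_list_def)
end

lemma poly_mapping_sum_single: "p = (\<Sum>u\<in>Poly_Mapping.keys p. Poly_Mapping.single u (Poly_Mapping.lookup p u))"
proof (rule poly_mapping_eqI)
  fix k
  have "Poly_Mapping.lookup (\<Sum>u\<in>Poly_Mapping.keys p. Poly_Mapping.single u (Poly_Mapping.lookup p u)) k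
     = (\<Sum>u\<in>Poly_Mapping.keys p. if u = k then Poly_Mapping.lookup p u else 0)"
    by (simp add: lookup_sum lookup_single when_def)
  then show "Poly_Mapping.lookup p k = Poly_Mapping.lookup (\<Sum>u\<in>Poly_Mapping.keys p. Poly_Mapping.single u (Poly_Mapping.lookup p u)) k"
    by (simp add: in_keys_iff)
qed

lemma poly_mapping_single_induct [case_names zero single add]:
  fixes p :: "'w \<Rightarrow>\<^sub>0 'k::comm_monoid_add"
  assumes "Q 0" "\<And>w c. Q (Poly_Mapping.single w c)" "\<And>p q. Q p \<Longrightarrow> Q q \<Longrightarrow> Q (p + q)"
  shows "Q p"
proof -
  have "Q (\<Sum>u\<in>A. Poly_Mapping.single u (Poly_Mapping.lookup p u))" if "finite A" for A
    using that by (induction A) (auto intro: assms)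
  then show ?thesis by (subst poly_mapping_sum_single) auto
qed

lemma keys_subset_single_induct [consumes 1, case_names zero single add]:
  fixes p :: "'w \<Rightarrow>\<^sub>0 'k::comm_monoid_add"
  assumes "Poly_Mapping.keys p \<subseteq> S"
    and "Q 0" "\<And>w c. w \<in> S \<Longrightarrow> Q (Poly_Mapping.single w c)" "\<And>p q. Q p \<Longrightarrow> Q q \<Longrightarrow> Q (p + q)"
  shows "Q p"
proof -
  have "Q (\<Sum>u\<in>A. Poly_Mapping.single u (Poly_Mapping.lookup p u))" if "finite A" "A \<subseteq> S" for A
    using that by (induction A) (auto intro: assms)
  then show ?thesis using assms(1) by (subst poly_mapping_sum_single) auto
qed

lemma single_word_mult:
  "Poly_Mapping.single u a * Poly_Mapping.single v c = Poly_Mapping.single (u @ v) (a * c)"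
  by (simp add: mult_single plus_list_def)

lemma single_Nil_one: "Poly_Mapping.single [] 1 = 1"
  by (metis single_one zero_list_def)

lemma word_algebra_mult:
  "(\<Sum>u\<in>Poly_Mapping.keys p. \<Sum>v\<in>Poly_Mapping.keys q.
       Poly_Mapping.single (u @ v) (Poly_Mapping.lookup p u * Poly_Mapping.lookup q v))
   = p * (q :: 'a list \<Rightarrow>\<^sub>0 'k::comm_ring_1)"
  apply (subst (3) poly_mapping_sum_single[of p])
  apply (subst (3) poly_mapping_sum_single[of q])
  by (simp add: sum_product single_word_mult)

lemma word_algebra_simps:
  "carrier (word_algebra S) = {p. Poly_Mapping.keys p \<subseteq> lists S}"
  "p \<otimes>\<^bsub>word_algebra S\<^esub> q = p * q"
  "\<one>\<^bsub>word_algebra S\<^esub> = 1"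
  "\<zero>\<^bsub>word_algebra S\<^esub> = 0"
  "p \<oplus>\<^bsub>word_algebra S\<^esub> q = p + q"
  by (simp_all add: word_algebra_def word_algebra_mult single_Nil_one)

lemma keys_mult_lists:
  fixes p q :: "'a list \<Rightarrow>\<^sub>0 'k::comm_ring_1"
  assumes "Poly_Mapping.keys p \<subseteq> lists S" "Poly_Mapping.keys q \<subseteq> lists S"
  shows "Poly_Mapping.keys (p * q) \<subseteq> lists S"
  using keys_mult[of p q] assms by (force simp: plus_list_def)

lemma ring_word_algebra: "ring (word_algebra S :: ('a list \<Rightarrow>\<^sub>0 'k::field_char_0) ring)"
proof (rule ringI)
  show "abelian_group (word_algebra S :: ('a list \<Rightarrow>\<^sub>0 'k) ring)"
  proof (rule abelian_groupI)
    fix x :: "'a list \<Rightarrow>\<^sub>0 'k" assume "x \<in> carrier (word_algebra S)"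
    then show "\<exists>y\<in>carrier (word_algebra S). y \<oplus>\<^bsub>word_algebra S\<^esub> x = \<zero>\<^bsub>word_algebra S\<^esub>"
      by (intro bexI[of _ "- x"]) (auto simp: word_algebra_simps)
  qed (auto simp: word_algebra_simps algebra_simps dest: subsetD[OF keys_add])
  show "monoid (word_algebra S :: ('a list \<Rightarrow>\<^sub>0 'k) ring)"
    by (rule monoidI) (auto simp: word_algebra_simps algebra_simps keys_mult_lists zero_list_def
        simp del: in_lists_conv_set dest: subsetD[OF keys_mult_lists])
qed (auto simp: word_algebra_simps algebra_simps)

lemma a_inv_word_algebra:
  assumes "p \<in> carrier (word_algebra S)"
  shows "\<ominus>\<^bsub>word_algebra S\<^esub> (p :: 'a list \<Rightarrow>\<^sub>0 'k::field_char_0) = - p"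
proof -
  interpret ring "word_algebra S :: ('a list \<Rightarrow>\<^sub>0 'k) ring" by (rule ring_word_algebra)
  show ?thesis
    using assms by (intro minus_equality) (auto simp: word_algebra_simps)
qed

text \<open>The weights on words are left arbitrary because \<open>word_eval\<close> and the
  Poincare-Birkhoff-Witt functionals are both linear extensions of this kind.\<close>

definition lin_ext :: "('w \<Rightarrow> 'k::comm_ring_1) \<Rightarrow> ('w \<Rightarrow>\<^sub>0 'k) \<Rightarrow> 'k" where
  "lin_ext F p = (\<Sum>w\<in>Poly_Mapping.keys p. Poly_Mapping.lookup p w * F w)"

lemma lin_ext_superset:
  assumes "finite A" "Poly_Mapping.keys p \<subseteq> A"
  shows "lin_ext F p = (\<Sum>w\<in>A. Poly_Mapping.lookup p w * F w)"
  unfolding lin_ext_def using assms by (intro sum.mono_neutral_left) (auto simp: in_keys_iff)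

lemma lin_ext_zero [simp]: "lin_ext F 0 = 0"
  by (simp add: lin_ext_def)

lemma lin_ext_single [simp]: "lin_ext F (Poly_Mapping.single w c) = c * F w"
  by (cases "c = 0") (auto simp: lin_ext_def)

lemma lin_ext_add: "lin_ext F (p + q) = lin_ext F p + lin_ext F q"
proof -
  let ?A = "Poly_Mapping.keys p \<union> Poly_Mapping.keys q"
  have "lin_ext F (p + q) = (\<Sum>w\<in>?A. Poly_Mapping.lookup (p + q) w * F w)"
    using keys_add[of p q] by (intro lin_ext_superset) auto
  also have "\<dots> = lin_ext F p + lin_ext F q"
    by (subst (1 2) lin_ext_superset[of ?A]) (auto simp: lookup_add algebra_simps sum.distrib)
  finally show ?thesis .
qed

lemma lin_ext_uminus: "lin_ext F (- p) = - lin_ext F p"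
  by (simp add: lin_ext_def sum_negf)

lemma lin_ext_diff: "lin_ext F (p - q) = lin_ext F p - lin_ext F q"
  using lin_ext_add[of F p "- q"] by (simp add: lin_ext_uminus)

lemma word_eval_eq_lin_ext: "word_eval f = lin_ext (\<lambda>w. prod_list (map f w))"
  by (simp add: fun_eq_iff word_eval_def lin_ext_def)

lemma word_eval_add: "word_eval f (p + q) = word_eval f p + word_eval f q"
  by (simp add: word_eval_eq_lin_ext lin_ext_add)

lemma word_eval_diff: "word_eval f (p - q) = word_eval f p - word_eval f q"
  by (simp add: word_eval_eq_lin_ext lin_ext_diff)

lemma word_eval_mult: "word_eval f (p * q) = word_eval f p * word_eval f q"
proof (induction p rule: poly_mapping_single_induct)
  case (single u a)
  show ?case
  proof (induction q rule: poly_mapping_single_induct)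
    case (single v c)
    show ?case by (simp add: single_word_mult word_eval_eq_lin_ext)
  qed (auto simp: word_eval_eq_lin_ext lin_ext_add algebra_simps)
qed (auto simp: word_eval_eq_lin_ext lin_ext_add algebra_simps)

context
  fixes s :: "'k::field_char_0 \<Rightarrow> 'a::ab_group_add \<Rightarrow> 'a" and b :: "'a \<Rightarrow> 'a \<Rightarrow> 'a"
begin

lemma env_relations_carrier:
  assumes "\<And>x y. x \<in> S \<Longrightarrow> y \<in> S \<Longrightarrow> x + y \<in> S" "\<And>c x. x \<in> S \<Longrightarrow> s c x \<in> S"
    "\<And>x y. x \<in> S \<Longrightarrow> y \<in> S \<Longrightarrow> b x y \<in> S"
  shows "env_relations s b S \<subseteq> carrier (word_algebra S)"
  using assms by (auto simp: env_relations_def word_algebra_simps dest!: subsetD[OF keys_diff] split: if_splits)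

text \<open>Serves as an induction principle: to see that a map kills the relation ideal, it is
  enough that its kernel, cut down to the word algebra of \<open>S\<close>, contains a two-sided
  ideal with the relations in it.\<close>

lemma env_ideal_least:
  assumes K: "env_relations s b S \<subseteq> K" "K \<subseteq> carrier (word_algebra S)"
    and zero: "0 \<in> K" and add: "\<And>p q. p \<in> K \<Longrightarrow> q \<in> K \<Longrightarrow> p + q \<in> K"
    and neg: "\<And>p. p \<in> K \<Longrightarrow> - p \<in> K"
    and mult: "\<And>p q. p \<in> K \<Longrightarrow> q \<in> carrier (word_algebra S) \<Longrightarrow> q * p \<in> K \<and> p * q \<in> K"
  shows "env_ideal s b S \<subseteq> K"
proof -
  interpret W: ring "word_algebra S :: ('a list \<Rightarrow>\<^sub>0 'k) ring" by (rule ring_word_algebra)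
  have "ideal K (word_algebra S)"
  proof (rule idealI[OF ring_word_algebra])
    show "subgroup K (add_monoid (word_algebra S))"
    proof (rule W.add.subgroupI)
      show "\<ominus>\<^bsub>word_algebra S\<^esub> p \<in> K" if "p \<in> K" for p
        using that K(2) neg a_inv_word_algebra[of p S] by auto
    qed (use K zero add in \<open>auto simp: word_algebra_simps\<close>)
  qed (use mult in \<open>auto simp: word_algebra_simps\<close>)
  then show ?thesis
    unfolding env_ideal_def by (intro W.genideal_minimal K(1))
qed

lemma env_ideal_ideal:
  assumes "env_relations s b S \<subseteq> carrier (word_algebra S)"
  shows "ideal (env_ideal s b S) (word_algebra S)"
  unfolding env_ideal_def by (intro ring.genideal_ideal ring_word_algebra assms)

lemma env_relations_ideal:
  assumes "env_relations s b S \<subseteq> carrier (word_algebra S)"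
  shows "env_relations s b S \<subseteq> env_ideal s b S"
  unfolding env_ideal_def by (intro ring.genideal_self ring_word_algebra assms)

end

section \<open>The Poincare-Birkhoff-Witt theorem\<close>

fun inversions :: "nat list \<Rightarrow> nat" where
  "inversions [] = 0"
| "inversions (x # xs) = length (filter (\<lambda>y. y < x) xs) + inversions xs"

lemma inversions_swap:
  "j < i \<Longrightarrow> inversions (u @ i # j # v) = Suc (inversions (u @ j # i # v))"
  by (induction u) auto

lemma not_sorted_descent:
  "\<not> sorted (w :: nat list) \<Longrightarrow> \<exists>u i j v. w = u @ i # j # v \<and> j < i"
proof (induction w)
  case (Cons x xs)
  show ?case
  proof (cases "sorted xs")
    case True
    with Cons.prems obtain y ys where "xs = y # ys" "y < x"
      by (cases xs) (auto simp: sorted2 not_le)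
    then show ?thesis by (metis append_Nil)
  next
    case False
    then show ?thesis using Cons.IH by (metis append_Cons)
  qed
qed simp

text \<open>Straightening replaces a descent by the swapped word, which has one inversion less, and
  by words in which the two letters are merged into a bracket, which are shorter. The lexicographic
  order decreases in both cases.\<close>

definition word_less :: "(nat list \<times> nat list) set" where
  "word_less = measures [length, inversions]"

lemma wf_word_less: "wf word_less"
  by (simp add: word_less_def)

lemma word_less_shorter: "length u < length v \<Longrightarrow> (u, v) \<in> word_less"
  by (simp add: word_less_def)

lemma word_less_swap: "j < i \<Longrightarrow> (u @ j # i # v, u @ i # j # v) \<in> word_less"
  by (simp add: word_less_def inversions_swap)

lemma word_less_trans: "(u, v) \<in> word_less \<Longrightarrow> (v, w) \<in> word_less \<Longrightarrow> (u, w) \<in> word_less"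
  by (auto simp: word_less_def)

lemma word_less_induct [case_names less]:
  assumes "\<And>w. (\<And>w'. (w', w) \<in> word_less \<Longrightarrow> Q w') \<Longrightarrow> Q w"
  shows "Q w"
  by (rule wf_induct_rule[OF wf_word_less]) (rule assms)

context lie_algebra
begin

lemma bracket_zero_left [simp]: "bracket 0 x = 0"
  using bracket_scale_left[of 0 0 x] by simp

lemma bracket_zero_right [simp]: "bracket x 0 = 0"
  using bracket_scale_right[of x 0 0] by simp

lemma bracket_skew: "bracket x y = - bracket y x"
proof -
  have "bracket x y + bracket y x = bracket (x + y) (x + y)"
    unfolding bracket_add_left bracket_add_right by (simp add: bracket_self)
  then show ?thesis
    by (simp add: bracket_self eq_neg_iff_add_eq_0)
qed

lemma bracket_sum_left: "bracket (sum h A) y = (\<Sum>a\<in>A. bracket (h a) y)"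
  by (induction A rule: infinite_finite_induct) (auto simp: bracket_add_left)

lemma bracket_diff_left: "bracket (x - y) z = bracket x z - bracket y z"
  using bracket_add_left[of "x - y" y z] by simp

end

text \<open>A basis \<open>e\<close> with coordinates \<open>co\<close> whose members from index
  \<open>m\<close> on commute. These are going to span P; they come last so that a sorted word is a
  monomial outside P followed by an element of U(P), on which a character can be evaluated from the
  right.\<close>

locale lie_frame = lie_algebra scale bracket
  for scale :: "'k::field_char_0 \<Rightarrow> 'a::ab_group_add \<Rightarrow> 'a" and bracket :: "'a \<Rightarrow> 'a \<Rightarrow> 'a" +
  fixes e :: "nat \<Rightarrow> 'a" and co :: "'a \<Rightarrow> nat \<Rightarrow> 'k" and n m :: nat
  assumes co_add: "co (x + y) i = co x i + co y i"
    and co_scale: "co (scale c x) i = c * co x i"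
    and co_sum: "(\<Sum>i<n. scale (co x i) (e i)) = x"
    and co_e: "i < n \<Longrightarrow> j < n \<Longrightarrow> co (e i) j = (if i = j then 1 else 0)"
    and tail_commutes: "m \<le> i \<Longrightarrow> i < n \<Longrightarrow> m \<le> j \<Longrightarrow> j < n \<Longrightarrow> bracket (e i) (e j) = 0"
begin

lemma co_zero [simp]: "co 0 i = 0"
  using co_scale[of 0 0 i] by simp

lemma co_uminus: "co (- x) i = - co x i"
  using co_add[of x "- x" i] by (simp add: eq_neg_iff_add_eq_0 add.commute)

lemma co_sum_dist: "co (sum h A) i = (\<Sum>a\<in>A. co (h a) i)"
  by (induction A rule: infinite_finite_induct) (auto simp: co_add)

lemma co_bracket_left: "co (bracket x y) q = (\<Sum>k<n. co x k * co (bracket (e k) y) q)"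
proof -
  have "co (bracket x y) q = co (bracket (\<Sum>k<n. scale (co x k) (e k)) y) q"
    by (simp add: co_sum)
  also have "\<dots> = (\<Sum>k<n. co x k * co (bracket (e k) y) q)"
    by (simp add: bracket_sum_left co_sum_dist bracket_scale_left co_scale)
  finally show ?thesis .
qed

text \<open>The value of \<open>\<sigma>\<close> on the word with the vector \<open>x\<close>
  between \<open>u\<close> and \<open>v\<close>, by linearity in that letter; a bracket of basis
  vectors enters a word in this way.\<close>

definition insert_vec :: "(nat list \<Rightarrow> 'k) \<Rightarrow> nat list \<Rightarrow> 'a \<Rightarrow> nat list \<Rightarrow> 'k" where
  "insert_vec \<sigma> u x v = (\<Sum>k<n. co x k * \<sigma> (u @ k # v))"

lemma insert_vec_add: "insert_vec \<sigma> u (x + y) v = insert_vec \<sigma> u x v + insert_vec \<sigma> u y v"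
  by (simp add: insert_vec_def co_add algebra_simps sum.distrib)

lemma insert_vec_uminus: "insert_vec \<sigma> u (- x) v = - insert_vec \<sigma> u x v"
  by (simp add: insert_vec_def co_uminus sum_negf)

lemma insert_vec_zero [simp]: "insert_vec \<sigma> u 0 v = 0"
  by (simp add: insert_vec_def)

text \<open>
  Jacobson's straightening: a function on sorted words extends to a function on all words in the
  basis \<open>e\<close> that respects the commutation relations. The value does not depend on the descent which
  is resolved first; when two descents overlap, this is the Jacobi identity.
\<close>

definition descent_split :: "nat list \<Rightarrow> nat list \<times> nat \<times> nat \<times> nat list" where
  "descent_split w = (SOME (u, i, j, v). w = u @ i # j # v \<and> j < i)"

lemma descent_split:
  assumes "\<not> sorted w" "descent_split w = (u, i, j, v)"
  shows "w = u @ i # j # v" "j < i"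
proof -
  have "\<exists>t. case t of (u, i, j, v) \<Rightarrow> w = u @ i # j # v \<and> j < i"
    using not_sorted_descent[OF assms(1)] by auto
  from someI_ex[OF this] show "w = u @ i # j # v" "j < i"
    using assms(2) by (auto simp: descent_split_def)
qed

function straighten :: "(nat list \<Rightarrow> 'k) \<Rightarrow> nat list \<Rightarrow> 'k" where
  "straighten \<phi> w = (if sorted w then \<phi> w else
     (case descent_split w of (u, i, j, v) \<Rightarrow>
        straighten \<phi> (u @ j # i # v) + (\<Sum>k<n. co (bracket (e i) (e j)) k * straighten \<phi> (u @ k # v))))"
  by pat_completeness auto
termination
proof (relation "inv_image word_less snd", goal_cases)
  case 1
  show ?case by (simp add: wf_word_less)
next
  case (2 \<phi> w u y i z j v)
  then have "descent_split w = (u, i, j, v)" by simp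
  from descent_split[OF 2(1) this] show ?case by (simp add: word_less_swap)
next
  case (3 \<phi> w u y i z j v k)
  then have "descent_split w = (u, i, j, v)" by simp
  from descent_split[OF 3(1) this] show ?case by (simp add: word_less_shorter)
qed

declare straighten.simps [simp del]

lemma straighten_sorted: "sorted w \<Longrightarrow> straighten \<phi> w = \<phi> w"
  by (simp add: straighten.simps)

definition commutation :: "(nat list \<Rightarrow> 'k) \<Rightarrow> bool" where
  "commutation \<sigma> \<longleftrightarrow> (\<forall>u i j v. \<sigma> (u @ i # j # v) = \<sigma> (u @ j # i # v) + insert_vec \<sigma> u (bracket (e i) (e j)) v)"

lemma straighten_descent:
  "j < i \<Longrightarrow> straighten \<phi> (u @ i # j # v)
     = straighten \<phi> (u @ j # i # v) + insert_vec (straighten \<phi>) u (bracket (e i) (e j)) v"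
proof (induction "u @ i # j # v" arbitrary: u i j v rule: word_less_induct)
  case less
  let ?\<sigma> = "straighten \<phi>"
  let ?w = "u @ i # j # v"
  let ?V = "insert_vec ?\<sigma>"
  \<comment> \<open>Below \<open>?w\<close> the relation holds for letters in any order: for an
    ascent it is the descent relation read backwards, by antisymmetry, and for equal letters the
    bracket vanishes.\<close>
  have rel: "?\<sigma> (u' @ a # c # v') = ?\<sigma> (u' @ c # a # v') + ?V u' (bracket (e a) (e c)) v'"
    if "(u' @ a # c # v', ?w) \<in> word_less" "(u' @ c # a # v', ?w) \<in> word_less" for u' a c v'
  proof (cases a c rule: linorder_cases)
    case less
    from less.hyps[OF that(2) less] show ?thesis
      by (simp add: bracket_skew[of "e a"] insert_vec_uminus)
  next
    case equal
    then show ?thesis by (simp add: bracket_self)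
  next
    case greater
    from less.hyps[OF that(1) greater] show ?thesis .
  qed
  have relS: "?\<sigma> (u' @ a # c # v') = ?\<sigma> (u' @ c # a # v') + ?V u' (bracket (e a) (e c)) v'"
    if "length (u' @ a # c # v') < length ?w" for u' a c v'
    using that by (intro rel word_less_shorter) auto
  \<comment> \<open>Moving a vector past a letter costs their bracket: the relation for shorter
    words is linear in the letter that is moved.\<close>
  have vecL: "?V u' x (c # v') = ?V (u' @ [c]) x v' + ?V u' (bracket x (e c)) v'"
    if l: "length (u' @ v') + 2 < length ?w" for u' x c v'
  proof -
    have "?V u' x (c # v') = (\<Sum>k<n. co x k * (?\<sigma> (u' @ c # k # v') + ?V u' (bracket (e k) (e c)) v'))"
    proof -
      have "?\<sigma> (u' @ k # c # v') = ?\<sigma> (u' @ c # k # v') + ?V u' (bracket (e k) (e c)) v'" for k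
        using l by (intro relS) simp
      then show ?thesis by (simp add: insert_vec_def[of _ _ x])
    qed
    also have "\<dots> = ?V (u' @ [c]) x v' + (\<Sum>k<n. co x k * ?V u' (bracket (e k) (e c)) v')"
      by (simp add: algebra_simps sum.distrib insert_vec_def)
    also have "(\<Sum>k<n. co x k * ?V u' (bracket (e k) (e c)) v') = ?V u' (bracket x (e c)) v'"
      unfolding insert_vec_def co_bracket_left[of x]
      by (simp add: sum_distrib_left sum_distrib_right algebra_simps) (rule sum.swap)
    finally show ?thesis .
  qed
  have swapV: "?V u1 x (v1 @ a # c # v2) = ?V u1 x (v1 @ c # a # v2)
      + (\<Sum>k<n. co x k * ?V (u1 @ k # v1) (bracket (e a) (e c)) v2)"
    if l: "length (u1 @ v1 @ v2) + 3 < length ?w" for u1 x v1 a c v2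
  proof -
    have "?\<sigma> (u1 @ k # v1 @ a # c # v2) = ?\<sigma> (u1 @ k # v1 @ c # a # v2) + ?V (u1 @ k # v1) (bracket (e a) (e c)) v2" for k
      using relS[of "u1 @ k # v1" a c v2] l by simp
    then show ?thesis
      by (simp add: insert_vec_def[of _ u1] algebra_simps sum.distrib)
  qed
  have swapV': "?V (v1 @ a # c # v2) x u1 = ?V (v1 @ c # a # v2) x u1
      + (\<Sum>k<n. co x k * ?V v1 (bracket (e a) (e c)) (v2 @ k # u1))"
    if l: "length (u1 @ v1 @ v2) + 3 < length ?w" for u1 x v1 a c v2
  proof -
    have "?\<sigma> (v1 @ a # c # v2 @ k # u1) = ?\<sigma> (v1 @ c # a # v2 @ k # u1) + ?V v1 (bracket (e a) (e c)) (v2 @ k # u1)" for k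
      using relS[of v1 a c "v2 @ k # u1"] l by simp
    then show ?thesis
      by (simp add: insert_vec_def[of _ "v1 @ a # c # v2"] insert_vec_def[of _ "v1 @ c # a # v2"] algebra_simps sum.distrib)
  qed
  define val where "val u i j v = ?\<sigma> (u @ j # i # v) + ?V u (bracket (e i) (e j)) v" for u i j v
  \<comment> \<open>Both values are carried down to the word with \<open>d # c # a\<close>. By
    \<open>vecL\<close>, the bracket terms then differ only by double brackets, and these cancel by
    the Jacobi identity \<open>J\<close>.\<close>
  have overlap: "val u' a c (d # v') = val (u' @ [a]) c d v'"
    if w: "?w = u' @ a # c # d # v'" and ord: "d < c" "c < a" for u' a c d v'
  proof -
    have l1: "(u' @ c # a # d # v', ?w) \<in> word_less" "(u' @ a # d # c # v', ?w) \<in> word_less"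
      using word_less_swap[of c a u' "d # v'"] word_less_swap[of d c "u' @ [a]" v'] ord w by auto
    have l2: "(u' @ c # d # a # v', ?w) \<in> word_less" "(u' @ d # a # c # v', ?w) \<in> word_less"
      using word_less_swap[of d a "u' @ [c]" v'] word_less_swap[of d a u' "c # v'"] ord
      by (auto intro: word_less_trans l1)
    have l3: "(u' @ d # c # a # v', ?w) \<in> word_less"
      using word_less_swap[of d c u' "a # v'"] ord by (auto intro: word_less_trans l2)
    have L: "length (u' @ v') + 2 < length ?w" unfolding w by simp
    have 1: "?\<sigma> (u' @ c # a # d # v') = ?\<sigma> (u' @ c # d # a # v') + ?V (u' @ [c]) (bracket (e a) (e d)) v'"
      using rel[of "u' @ [c]" a d v'] l1 l2 by simp
    have 2: "?\<sigma> (u' @ c # d # a # v') = ?\<sigma> (u' @ d # c # a # v') + ?V u' (bracket (e c) (e d)) (a # v')"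
      using rel[of u' c d "a # v'"] l2 l3 by simp
    have 3: "?\<sigma> (u' @ a # d # c # v') = ?\<sigma> (u' @ d # a # c # v') + ?V u' (bracket (e a) (e d)) (c # v')"
      using rel[of u' a d "c # v'"] l1 l2 by simp
    have 4: "?\<sigma> (u' @ d # a # c # v') = ?\<sigma> (u' @ d # c # a # v') + ?V (u' @ [d]) (bracket (e a) (e c)) v'"
      using rel[of "u' @ [d]" a c v'] l2 l3 by simp
    have "bracket (bracket (e c) (e d)) (e a) = - bracket (e a) (bracket (e c) (e d))"
      "bracket (bracket (e a) (e c)) (e d) = - bracket (e d) (bracket (e a) (e c))"
      by (rule bracket_skew)+
    moreover have "bracket (bracket (e a) (e d)) (e c) = bracket (e c) (bracket (e d) (e a))"
      using bracket_skew[of "bracket (e a) (e d)" "e c"] bracket_skew[of "e a" "e d"]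
        bracket_scale_right[of "e c" "- 1" "bracket (e d) (e a)"] by simp
    ultimately have "bracket (bracket (e c) (e d)) (e a) + bracket (bracket (e a) (e c)) (e d)
        = bracket (bracket (e a) (e d)) (e c)"
      using jacobi[of "e a" "e c" "e d"] by (simp add: algebra_simps add_eq_0_iff)
    then have J: "?V u' (bracket (bracket (e c) (e d)) (e a)) v' + ?V u' (bracket (bracket (e a) (e c)) (e d)) v'
        = ?V u' (bracket (bracket (e a) (e d)) (e c)) v'"
      by (simp flip: insert_vec_add)
    show ?thesis
      unfolding val_def using 1 2 3 4 J
      by (simp add: vecL[OF L])
  qed
  \<comment> \<open>Carrying out both swaps in either order leads to the same word. What remains on
    each side is the sum with both brackets inserted, and the two double sums differ only in the
    order of summation.\<close>
  have disjoint: "val u1 a c (v1 @ d # f # v2) = val (u1 @ a # c # v1) d f v2"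
    if w: "?w = u1 @ a # c # v1 @ d # f # v2" and ord: "c < a" "f < d" for u1 a c v1 d f v2
  proof -
    have l1: "(u1 @ c # a # v1 @ d # f # v2, ?w) \<in> word_less" "(u1 @ a # c # v1 @ f # d # v2, ?w) \<in> word_less"
      using word_less_swap[of c a u1 "v1 @ d # f # v2"] word_less_swap[of f d "u1 @ a # c # v1" v2] ord w by auto
    have l2: "(u1 @ c # a # v1 @ f # d # v2, ?w) \<in> word_less"
      using word_less_swap[of f d "u1 @ c # a # v1" v2] ord by (auto intro: word_less_trans l1)
    have 1: "?\<sigma> (u1 @ c # a # v1 @ d # f # v2) = ?\<sigma> (u1 @ c # a # v1 @ f # d # v2)
        + ?V (u1 @ c # a # v1) (bracket (e d) (e f)) v2"
      using rel[of "u1 @ c # a # v1" d f v2] l1 l2 by simp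
    have 2: "?\<sigma> (u1 @ a # c # v1 @ f # d # v2) = ?\<sigma> (u1 @ c # a # v1 @ f # d # v2)
        + ?V u1 (bracket (e a) (e c)) (v1 @ f # d # v2)"
      using rel[of u1 a c "v1 @ f # d # v2"] l1 l2 by simp
    have L: "length (u1 @ v1 @ v2) + 3 < length ?w" unfolding w by simp
    have 3: "?V u1 (bracket (e a) (e c)) (v1 @ d # f # v2) = ?V u1 (bracket (e a) (e c)) (v1 @ f # d # v2)
      + (\<Sum>k<n. co (bracket (e a) (e c)) k * ?V (u1 @ k # v1) (bracket (e d) (e f)) v2)"
      using L by (intro swapV)
    have 4: "?V (u1 @ a # c # v1) (bracket (e d) (e f)) v2 = ?V (u1 @ c # a # v1) (bracket (e d) (e f)) v2
      + (\<Sum>k<n. co (bracket (e d) (e f)) k * ?V u1 (bracket (e a) (e c)) (v1 @ k # v2))"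
      using L by (intro swapV') simp
    have 5: "(\<Sum>k<n. co (bracket (e a) (e c)) k * ?V (u1 @ k # v1) (bracket (e d) (e f)) v2)
      = (\<Sum>k<n. co (bracket (e d) (e f)) k * ?V u1 (bracket (e a) (e c)) (v1 @ k # v2))"
      unfolding insert_vec_def
      by (simp add: sum_distrib_left algebra_simps) (rule sum.swap)
    show ?thesis unfolding val_def using 1 2 3 4 5 by simp
  qed
  have ordered: "val u1 a c v1 = val u2 d f v2"
    if w1: "?w = u1 @ a # c # v1" and w2: "?w = u2 @ d # f # v2" and ord: "c < a" "f < d"
      and le: "length u1 \<le> length u2" for u1 a c v1 u2 d f v2
  proof -
    from w1 w2 have eq: "u1 @ a # c # v1 = u2 @ d # f # v2" by simp
    with le obtain z where z: "u2 = u1 @ z" "a # c # v1 = z @ d # f # v2"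
      by (auto simp: append_eq_append_conv2)
    show ?thesis
    proof (cases z)
      case Nil
      with z show ?thesis by simp
    next
      case (Cons z0 zs)
      show ?thesis
      proof (cases zs)
        case Nil
        with Cons z show ?thesis using overlap[of u1 a c f v2] w1 ord by simp
      next
        case Cons2: (Cons z1 zs')
        with Cons z show ?thesis using disjoint[of u1 a c zs' d f v2] w1 ord by simp
      qed
    qed
  qed
  \<comment> \<open>The recursion resolves the descent selected by \<open>descent_split\<close>,
    whereas the claim concerns the given one; \<open>ordered\<close> compares them, the leftmost
    first.\<close>
  have ns: "\<not> sorted ?w" using less.prems by (auto simp: sorted_append)
  obtain u0 i0 j0 v0 where d: "descent_split ?w = (u0, i0, j0, v0)" by (metis prod_cases4)
  note d' = descent_split[OF ns d]
  have "?\<sigma> ?w = val u0 i0 j0 v0"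
    by (subst straighten.simps) (use ns in \<open>simp add: d val_def insert_vec_def\<close>)
  also have "\<dots> = val u i j v"
  proof (cases "length u0 \<le> length u")
    case True
    then show ?thesis using ordered[OF d'(1) refl d'(2) less.prems] by simp
  next
    case False
    then show ?thesis using ordered[OF refl d'(1) less.prems d'(2)] by simp
  qed
  finally show ?case by (simp add: val_def)
qed

lemma commutation_straighten: "commutation (straighten \<phi>)"
  unfolding commutation_def
proof (intro allI)
  fix u i j v
  let ?\<sigma> = "straighten \<phi>"
  show "?\<sigma> (u @ i # j # v) = ?\<sigma> (u @ j # i # v) + insert_vec ?\<sigma> u (bracket (e i) (e j)) v"
  proof (cases i j rule: linorder_cases)
    case less
    from straighten_descent[OF this, of \<phi> u v] show ?thesis
      by (simp add: bracket_skew[of "e i"] insert_vec_uminus)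
  next
    case equal
    then show ?thesis by (simp add: bracket_self)
  next
    case greater
    from straighten_descent[OF this] show ?thesis .
  qed
qed

end

section \<open>Computing in the free algebra modulo the relations of U(L)\<close>

abbreviation letter :: "'a \<Rightarrow> 'a list \<Rightarrow>\<^sub>0 'k::comm_ring_1" where
  "letter x \<equiv> Poly_Mapping.single [x] 1"

abbreviation scalar :: "'k \<Rightarrow> 'a list \<Rightarrow>\<^sub>0 'k::comm_ring_1" where
  "scalar c \<equiv> Poly_Mapping.single [] c"

lemma scalar_commute: "scalar c * p = p * scalar c"
  by (induction p rule: poly_mapping_single_induct)
    (simp_all add: single_word_mult algebra_simps)

lemma scalar_mult: "scalar c * scalar d = scalar (c * d)"
  by (simp add: single_word_mult)

lemma scalar_add: "scalar (c + d) = scalar c + scalar d"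
  by (simp add: single_add)

lemma scalar_one [simp]: "scalar 1 = 1"
  by (rule single_Nil_one)

lemma single_Cons: "Poly_Mapping.single (x # w) c = letter x * Poly_Mapping.single w c"
  by (simp add: single_word_mult)

lemma carrier_word_algebra_UNIV [simp]: "carrier (word_algebra UNIV) = UNIV"
  by (simp add: word_algebra_simps)

lemma word_ideal_closed:
  assumes "ideal J (word_algebra UNIV :: ('a list \<Rightarrow>\<^sub>0 'k::field_char_0) ring)"
  shows "0 \<in> J" and "p \<in> J \<Longrightarrow> q \<in> J \<Longrightarrow> p + q \<in> J"
    and "p \<in> J \<Longrightarrow> r * p \<in> J" and "p \<in> J \<Longrightarrow> p * r \<in> J"
proof -
  interpret ideal J "word_algebra UNIV :: ('a list \<Rightarrow>\<^sub>0 'k) ring" by fact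
  show "0 \<in> J" using additive_subgroup.zero_closed[OF is_additive_subgroup] by (simp add: word_algebra_simps)
  show "p + q \<in> J" if "p \<in> J" "q \<in> J" using additive_subgroup.a_closed[OF is_additive_subgroup that] by (simp add: word_algebra_simps)
  show "r * p \<in> J" if "p \<in> J" using I_l_closed[OF that, of r] by (simp add: word_algebra_simps)
  show "p * r \<in> J" if "p \<in> J" using I_r_closed[OF that, of r] by (simp add: word_algebra_simps)
qed

context lie_algebra
begin

abbreviation I where "I \<equiv> env_ideal scale bracket UNIV"

lemma ideal_I: "ideal I (word_algebra UNIV)"
  by (rule env_ideal_ideal) (simp add: word_algebra_simps)

lemmas I_zero [simp] = word_ideal_closed(1)[OF ideal_I]
  and I_add = word_ideal_closed(2)[OF ideal_I]
  and I_mult_left = word_ideal_closed(3)[OF ideal_I]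
  and I_mult_right = word_ideal_closed(4)[OF ideal_I]

lemma I_uminus: "p \<in> I \<Longrightarrow> - p \<in> I"
  using I_mult_left[of p "- 1"] by simp

lemma I_diff: "p \<in> I \<Longrightarrow> q \<in> I \<Longrightarrow> p - q \<in> I"
  using I_add[of p "- q"] I_uminus[of q] by simp

lemma I_relations: "env_relations scale bracket UNIV \<subseteq> I"
  by (rule env_relations_ideal) (simp add: word_algebra_simps)

lemma letter_add: "letter (x + y) - letter x - letter y \<in> I"
  using I_relations by (auto simp: env_relations_def)

lemma letter_scale: "letter (scale c x) - scalar c * letter x \<in> I"
  using I_relations by (auto simp: env_relations_def single_word_mult)

lemma letter_bracket: "letter x * letter y - letter y * letter x - letter (bracket x y) \<in> I"
proof -
  have "letter x * letter y - letter y * letter x - letter (bracket x y) \<in> env_relations scale bracket UNIV"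
    unfolding env_relations_def by (auto simp: single_word_mult)
  then show ?thesis using I_relations by blast
qed

lemma letter_zero: "letter 0 \<in> I"
  using I_uminus[OF letter_add[of 0 0]] by simp

lemma letter_sum: "letter (sum h A) - (\<Sum>a\<in>A. letter (h a)) \<in> I"
proof (induction A rule: infinite_finite_induct)
  case (insert a A)
  have "(letter (sum h (insert a A)) :: 'a list \<Rightarrow>\<^sub>0 'k) - (\<Sum>a\<in>insert a A. letter (h a)) =
    (letter (h a + sum h A) - letter (h a) - letter (sum h A)) + (letter (sum h A) - (\<Sum>a\<in>A. letter (h a)))"
    using insert by simp
  then show ?case by (simp only: I_add[OF letter_add insert.IH])
qed (simp_all add: letter_zero)

end

section \<open>Functionals on the free algebra that vanish on the relations\<close>

context lie_frame
begin

text \<open>The multilinear extension of \<open>\<sigma>\<close> from words of indices to words of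
  vectors. Each index is absorbed into \<open>\<sigma>\<close>, which makes the compatibility with
  concatenation a plain induction.\<close>

fun ext :: "'a list \<Rightarrow> (nat list \<Rightarrow> 'k) \<Rightarrow> 'k" where
  "ext [] \<sigma> = \<sigma> []"
| "ext (x # xs) \<sigma> = (\<Sum>i<n. co x i * ext xs (\<lambda>w. \<sigma> (i # w)))"

lemma ext_append: "ext (u @ v) \<sigma> = ext u (\<lambda>a. ext v (\<lambda>c. \<sigma> (a @ c)))"
  by (induction u arbitrary: \<sigma>) auto

lemma ext_add: "ext u (\<lambda>w. \<sigma> w + \<tau> w) = ext u \<sigma> + ext u \<tau>"
  by (induction u arbitrary: \<sigma> \<tau>) (auto simp: algebra_simps sum.distrib)

lemma ext_scale: "ext u (\<lambda>w. c * \<sigma> w) = c * ext u \<sigma>"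
  by (induction u arbitrary: \<sigma>) (auto simp: algebra_simps sum_distrib_left)

lemma ext_zero: "ext u (\<lambda>w. 0) = 0"
  by (induction u) auto

lemma ext_sum: "ext u (\<lambda>w. \<Sum>a\<in>A. \<sigma> a w) = (\<Sum>a\<in>A. ext u (\<sigma> a))"
  by (induction A rule: infinite_finite_induct) (auto simp: ext_zero ext_add)

lemma ext_map_e: "set w \<subseteq> {..<n} \<Longrightarrow> ext (map e w) \<sigma> = \<sigma> w"
  by (induction w arbitrary: \<sigma>) (auto simp: co_e if_distrib[of "\<lambda>c. c * _"] cong: if_cong)

lemma ext_letter_add: "ext (u @ (x + y) # v) \<sigma> = ext (u @ x # v) \<sigma> + ext (u @ y # v) \<sigma>"
proof -
  have "ext ((x + y) # v) \<tau> = ext (x # v) \<tau> + ext (y # v) \<tau>" for \<tau>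
    by (simp add: co_add distrib_right sum.distrib)
  then show ?thesis unfolding ext_append[of u] by (simp only: ext_add)
qed

lemma ext_letter_scale: "ext (u @ scale c x # v) \<sigma> = c * ext (u @ x # v) \<sigma>"
proof -
  have "ext (scale c x # v) \<tau> = c * ext (x # v) \<tau>" for \<tau>
    by (simp add: co_scale sum_distrib_left mult.assoc)
  then show ?thesis unfolding ext_append[of u] by (simp only: ext_scale)
qed

text \<open>\<open>commutation\<close> speaks of basis letters only; both sides are bilinear in
  \<open>x\<close> and \<open>y\<close>, so expanding these two letters in the basis is
  enough.\<close>

lemma ext_bracket:
  assumes "commutation \<sigma>"
  shows "ext (u @ x # y # v) \<sigma> = ext (u @ y # x # v) \<sigma> + ext (u @ bracket x y # v) \<sigma>"
proof -
  have "ext (x # y # v) (\<lambda>c. \<sigma> (a @ c)) = ext (y # x # v) (\<lambda>c. \<sigma> (a @ c)) + ext (bracket x y # v) (\<lambda>c. \<sigma> (a @ c))" for a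
  proof -
    define E where "E i j = ext v (\<lambda>w. \<sigma> (a @ i # j # w))" for i j
    define D where "D k = ext v (\<lambda>w. \<sigma> (a @ k # w))" for k
    have E: "E i j = E j i + (\<Sum>k<n. co (bracket (e i) (e j)) k * D k)" for i j
    proof -
      have "(\<lambda>w. \<sigma> (a @ i # j # w)) = (\<lambda>w. \<sigma> (a @ j # i # w) + (\<Sum>k<n. co (bracket (e i) (e j)) k * \<sigma> (a @ k # w)))"
        using assms[unfolded commutation_def insert_vec_def, rule_format, of a i j] by (intro HOL.ext)
      then show ?thesis unfolding E_def D_def by (simp add: ext_add ext_sum ext_scale)
    qed
    have co2: "co (bracket x y) k = (\<Sum>i<n. \<Sum>j<n. co x i * (co y j * co (bracket (e i) (e j)) k))" for k
    proof -
      have "co (bracket (e i) y) k = (\<Sum>j<n. co y j * co (bracket (e i) (e j)) k)" for i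
        unfolding bracket_skew[of "e i"] co_uminus co_bracket_left[of y]
        by (simp add: sum_negf[symmetric])
      then show ?thesis
        by (simp add: co_bracket_left[of x] sum_distrib_left)
    qed
    have "ext (x # y # v) (\<lambda>c. \<sigma> (a @ c)) = (\<Sum>i<n. \<Sum>j<n. co x i * (co y j * E i j))"
      by (simp add: E_def sum_distrib_left)
    also have "\<dots> = (\<Sum>i<n. \<Sum>j<n. co x i * (co y j * E j i)) +
       (\<Sum>i<n. \<Sum>j<n. \<Sum>k<n. co x i * (co y j * co (bracket (e i) (e j)) k) * D k)"
      by (subst E) (simp add: algebra_simps sum.distrib sum_distrib_left)
    also have "(\<Sum>i<n. \<Sum>j<n. co x i * (co y j * E j i)) = (\<Sum>j<n. \<Sum>i<n. co x i * (co y j * E j i))"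
      by (rule sum.swap)
    also have "\<dots> = ext (y # x # v) (\<lambda>c. \<sigma> (a @ c))"
      by (simp add: E_def sum_distrib_left algebra_simps)
    also have "(\<Sum>i<n. \<Sum>j<n. \<Sum>k<n. co x i * (co y j * co (bracket (e i) (e j)) k) * D k)
        = (\<Sum>i<n. \<Sum>k<n. \<Sum>j<n. co x i * (co y j * co (bracket (e i) (e j)) k) * D k)"
      by (rule sum.cong[OF refl], rule sum.swap)
    also have "\<dots> = (\<Sum>k<n. \<Sum>i<n. \<Sum>j<n. co x i * (co y j * co (bracket (e i) (e j)) k) * D k)"
      by (rule sum.swap)
    also have "\<dots> = ext (bracket x y # v) (\<lambda>c. \<sigma> (a @ c))"
      by (simp add: D_def co2 sum_distrib_right)
    finally show ?thesis .
  qed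
  then show ?thesis
    unfolding ext_append[of u] by (simp only: ext_add)
qed

definition functional :: "(nat list \<Rightarrow> 'k) \<Rightarrow> ('a list \<Rightarrow>\<^sub>0 'k) \<Rightarrow> 'k" where
  "functional \<sigma> = lin_ext (\<lambda>w. ext w \<sigma>)"

lemma functional_add: "functional \<sigma> (p + q) = functional \<sigma> p + functional \<sigma> q"
  by (simp add: functional_def lin_ext_add)

lemma functional_diff: "functional \<sigma> (p - q) = functional \<sigma> p - functional \<sigma> q"
  by (simp add: functional_def lin_ext_diff)

lemma functional_single: "functional \<sigma> (Poly_Mapping.single w c) = c * ext w \<sigma>"
  by (simp add: functional_def)

lemma functional_zero [simp]: "functional \<sigma> 0 = 0"
  by (simp add: functional_def)

lemma functional_sandwich:
  assumes "\<And>u v. functional \<sigma> (Poly_Mapping.single u 1 * q * Poly_Mapping.single v 1) = 0"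
  shows "functional \<sigma> (a * q * c) = 0"
proof (induction a rule: poly_mapping_single_induct)
  case (single u d)
  show ?case
  proof (induction c rule: poly_mapping_single_induct)
    case (single v d')
    have "Poly_Mapping.single u d * q * Poly_Mapping.single v d' =
      scalar (d * d') * (Poly_Mapping.single u 1 * q * Poly_Mapping.single v 1)"
    proof -
      have "Poly_Mapping.single u d = scalar d * Poly_Mapping.single u 1"
        "Poly_Mapping.single v d' = Poly_Mapping.single v 1 * scalar d'"
        by (simp_all add: single_word_mult)
      then show ?thesis
        by (metis (no_types, opaque_lifting) mult.assoc scalar_commute scalar_mult)
    qed
    moreover have "functional \<sigma> (scalar c * p) = c * functional \<sigma> p" for c p
      by (induction p rule: poly_mapping_single_induct)
        (auto simp: functional_add functional_single single_word_mult algebra_simps)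
    ultimately show ?case by (simp add: assms)
  qed (auto simp: functional_add algebra_simps)
qed (auto simp: functional_add algebra_simps)

lemma functional_I:
  assumes "commutation \<sigma>" "p \<in> I"
  shows "functional \<sigma> p = 0"
proof -
  \<comment> \<open>Quantifying over both factors produces a two-sided ideal inside the kernel of
    the functional, as \<open>env_ideal_least\<close> demands.\<close>
  let ?K = "{q. \<forall>a c. functional \<sigma> (a * q * c) = 0}"
  have "I \<subseteq> ?K"
  proof (rule env_ideal_least)
    show "env_relations scale bracket UNIV \<subseteq> ?K"
    proof
      fix q assume q: "q \<in> env_relations scale bracket UNIV"
      consider x y where "q = letter (x + y) - letter x - letter y"
        | c x where "q = letter (scale c x) - Poly_Mapping.single [x] c"
        | x y where "q = Poly_Mapping.single [x, y] 1 - Poly_Mapping.single [y, x] 1 - letter (bracket x y)"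
        using q unfolding env_relations_def by blast
      then have "functional \<sigma> (Poly_Mapping.single u 1 * q * Poly_Mapping.single v 1) = 0" for u v
      proof cases
        case (3 x y)
        then show ?thesis
          by (simp add: left_diff_distrib right_diff_distrib single_word_mult functional_diff functional_single
              ext_bracket[OF assms(1), of u x y v])
      qed (simp_all add: left_diff_distrib right_diff_distrib single_word_mult functional_diff
            functional_single ext_letter_add ext_letter_scale)
      then show "q \<in> ?K" using functional_sandwich by blast
    qed
    show "q * p \<in> ?K \<and> p * q \<in> ?K" if "p \<in> ?K" for p q
      using that by (simp add: mult.assoc) (simp flip: mult.assoc)
  qed (auto simp: algebra_simps functional_add functional_def lin_ext_uminus lin_ext_add)
  with assms(2) have "functional \<sigma> (1 * p * 1) = 0" by blast
  then show ?thesis by simp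
qed

end

section \<open>The spanning half of Poincare-Birkhoff-Witt\<close>

context lie_frame
begin

abbreviation sorted_words :: "nat \<Rightarrow> 'a list set" where
  "sorted_words N \<equiv> map e ` {w. sorted w \<and> set w \<subseteq> {..<n} \<and> length w \<le> N}"

text \<open>The bound on the length records that corrections are of lower order; without it the
  induction in \<open>spanned_insort\<close> could not treat them.\<close>

definition spanned :: "nat \<Rightarrow> ('a list \<Rightarrow>\<^sub>0 'k) set" where
  "spanned N = {q. \<exists>r. Poly_Mapping.keys r \<subseteq> sorted_words N \<and> q - r \<in> I}"

lemma spanned_I: "q \<in> I \<Longrightarrow> q \<in> spanned N"
  unfolding spanned_def by (intro CollectI exI[of _ 0]) simp

lemma spanned_add: "p \<in> spanned N \<Longrightarrow> q \<in> spanned N \<Longrightarrow> p + q \<in> spanned N"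
proof -
  assume "p \<in> spanned N" "q \<in> spanned N"
  then obtain r r' where r: "Poly_Mapping.keys r \<subseteq> sorted_words N" "p - r \<in> I"
    "Poly_Mapping.keys r' \<subseteq> sorted_words N" "q - r' \<in> I"
    unfolding spanned_def by blast
  have "p + q - (r + r') \<in> I" using I_add[OF r(2,4)] by (simp add: algebra_simps)
  moreover have "Poly_Mapping.keys (r + r') \<subseteq> sorted_words N"
    using keys_add[of r r'] r by blast
  ultimately show ?thesis unfolding spanned_def by blast
qed

lemma spanned_scalar: "p \<in> spanned N \<Longrightarrow> scalar c * p \<in> spanned N"
proof -
  assume "p \<in> spanned N"
  then obtain r where r: "Poly_Mapping.keys r \<subseteq> sorted_words N" "p - r \<in> I"
    unfolding spanned_def by blast
  have "scalar c * p - scalar c * r \<in> I"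
    using I_mult_left[OF r(2)] by (simp add: right_diff_distrib)
  moreover have "Poly_Mapping.keys (scalar c * r) \<subseteq> sorted_words N"
    using keys_mult[of "scalar c" r] r(1) by (force simp: plus_list_def split: if_splits)
  ultimately show ?thesis unfolding spanned_def by blast
qed

lemma spanned_sum: "(\<And>a. a \<in> A \<Longrightarrow> h a \<in> spanned N) \<Longrightarrow> sum h A \<in> spanned N"
  by (induction A rule: infinite_finite_induct) (auto intro: spanned_add spanned_I)

lemma spanned_cong: "p \<in> spanned N \<Longrightarrow> q - p \<in> I \<Longrightarrow> q \<in> spanned N"
  using spanned_add[OF spanned_I[of "q - p" N], of p] by simp

lemma spanned_mono: "p \<in> spanned N \<Longrightarrow> N \<le> M \<Longrightarrow> p \<in> spanned M"
proof -
  assume "p \<in> spanned N" "N \<le> M"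
  have "sorted_words N \<subseteq> sorted_words M"
    using \<open>N \<le> M\<close> by (intro image_mono) auto
  with \<open>p \<in> spanned N\<close> show ?thesis
    unfolding spanned_def mem_Collect_eq by (meson order_trans)
qed

lemma spanned_word:
  "sorted w \<Longrightarrow> set w \<subseteq> {..<n} \<Longrightarrow> length w \<le> N \<Longrightarrow> Poly_Mapping.single (map e w) c \<in> spanned N"
  unfolding spanned_def by (intro CollectI exI[of _ "Poly_Mapping.single (map e w) c"]) auto

lemma letter_expand: "letter x - (\<Sum>i<n. scalar (co x i) * letter (e i)) \<in> I"
proof -
  have 1: "(letter x :: 'a list \<Rightarrow>\<^sub>0 'k) - (\<Sum>i<n. letter (scale (co x i) (e i))) \<in> I"
    using letter_sum[of "\<lambda>i. scale (co x i) (e i)" "{..<n}"] by (simp add: co_sum)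
  have "(\<Sum>i\<in>A. (letter (scale (co x i) (e i)) :: 'a list \<Rightarrow>\<^sub>0 'k) - scalar (co x i) * letter (e i)) \<in> I" if "finite A" for A
    using that by (induction A) (auto intro: I_add letter_scale simp del: mult_single)
  from I_add[OF 1 this[of "{..<n}"]] show ?thesis
    by (simp add: sum_subtractf)
qed

text \<open>The assumption \<open>ins\<close> is \<open>spanned_insort\<close> for words shorter
  than \<open>N\<close>. It is kept as an assumption so that the lemma can be applied inside the
  induction that proves \<open>spanned_insort\<close>, and once more afterwards.\<close>

lemma spanned_step:
  assumes ins: "\<And>w i. length w < N \<Longrightarrow> sorted w \<Longrightarrow> set w \<subseteq> {..<n} \<Longrightarrow> i < n \<Longrightarrow>
      letter (e i) * Poly_Mapping.single (map e w) 1 - Poly_Mapping.single (map e (insort i w)) 1 \<in> spanned (length w)"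
    and q: "q \<in> spanned M" and M: "M < N"
  shows "letter x * q \<in> spanned (Suc M)"
proof -
  obtain r where r: "Poly_Mapping.keys r \<subseteq> sorted_words M" "q - r \<in> I"
    using q unfolding spanned_def by blast
  have 1: "letter (e i) * Poly_Mapping.single (map e w) c \<in> spanned (Suc M)"
    if "i < n" "sorted w" "set w \<subseteq> {..<n}" "length w \<le> M" for i w c
  proof -
    have "letter (e i) * Poly_Mapping.single (map e w) 1 - Poly_Mapping.single (map e (insort i w)) 1 \<in> spanned (Suc M)"
      using ins[of w i] that M by (auto intro: spanned_mono)
    moreover have "Poly_Mapping.single (map e (insort i w)) 1 \<in> spanned (Suc M)"
      using that by (intro spanned_word) (auto simp: sorted_insort set_insort_key)
    ultimately have "letter (e i) * Poly_Mapping.single (map e w) 1 \<in> spanned (Suc M)"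
      using spanned_add by fastforce
    from spanned_scalar[OF this, of c] show ?thesis by (simp add: single_word_mult)
  qed
  have 2: "letter (e i) * r \<in> spanned (Suc M)" if "i < n" for i
    using r(1) by (induction rule: keys_subset_single_induct)
      (auto simp: distrib_left intro: spanned_I spanned_add 1 that simp del: mult_single)
  have "(\<Sum>i<n. scalar (co x i) * letter (e i)) * r \<in> spanned (Suc M)"
    unfolding sum_distrib_right mult.assoc by (intro spanned_sum spanned_scalar 2) simp
  moreover have "letter x * r - (\<Sum>i<n. scalar (co x i) * letter (e i)) * r \<in> I"
    using I_mult_right[OF letter_expand] by (simp add: left_diff_distrib)
  ultimately have "letter x * r \<in> spanned (Suc M)"
    by (rule spanned_cong)
  moreover have "letter x * q - letter x * r \<in> I"
    using I_mult_left[OF r(2)] by (simp add: right_diff_distrib)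
  ultimately show ?thesis by (rule spanned_cong)
qed

text \<open>The product has one letter more than \<open>w\<close>, so the statement says that
  letters commute modulo lower order: a letter is pushed to its place at the cost of brackets, which
  shorten the word.\<close>

lemma spanned_insort:
  "sorted w \<Longrightarrow> set w \<subseteq> {..<n} \<Longrightarrow> i < n \<Longrightarrow>
   letter (e i) * Poly_Mapping.single (map e w) 1 - Poly_Mapping.single (map e (insort i w)) 1 \<in> spanned (length w)"
proof (induction "length w" arbitrary: w i rule: less_induct)
  case less
  show ?case
  proof (cases w)
    case Nil
    then show ?thesis by (simp add: single_word_mult spanned_I)
  next
    case (Cons c w')
    have IH: "letter x * q \<in> spanned (Suc M)" if "q \<in> spanned M" "M < length w" for x q M
      by (rule spanned_step[OF less.hyps that]) auto
    have IHw: "letter (e i) * Poly_Mapping.single (map e w') 1 - Poly_Mapping.single (map e (insort i w')) 1 \<in> spanned (length w')"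
      using less Cons by auto
    have w': "sorted w'" "set w' \<subseteq> {..<n}" "c < n" using less.prems Cons by auto
    show ?thesis
    proof (cases "i \<le> c")
      case True
      then show ?thesis using Cons by (simp add: single_word_mult spanned_I)
    next
      case False
      let ?s = "Poly_Mapping.single (map e w') (1::'k)"
      have 1: "letter (bracket (e i) (e c)) * ?s \<in> spanned (length w)"
        using IH[OF spanned_word[OF w'(1,2) order_refl]] Cons by simp
      have 2: "letter (e c) * (letter (e i) * ?s - Poly_Mapping.single (map e (insort i w')) 1) \<in> spanned (length w)"
        using IH[OF IHw, of "e c"] Cons by simp
      have 3: "(letter (e i) * letter (e c) - letter (e c) * letter (e i) - letter (bracket (e i) (e c))) * ?s \<in> spanned (length w)"
        by (intro spanned_I I_mult_right letter_bracket)
      \<comment> \<open>Swap \<open>e i\<close> with the first letter \<open>e c\<close>, insert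
        \<open>e i\<close> into the rest by induction, and note that \<open>c\<close> stays in front
        because \<open>c < i\<close> and \<open>w\<close> is sorted.\<close>
      have "letter (e i) * Poly_Mapping.single (map e w) 1 - Poly_Mapping.single (map e (insort i w)) 1 =
         letter (bracket (e i) (e c)) * ?s + letter (e c) * (letter (e i) * ?s - Poly_Mapping.single (map e (insort i w')) 1)
         + (letter (e i) * letter (e c) - letter (e c) * letter (e i) - letter (bracket (e i) (e c))) * ?s"
        using False Cons by (simp add: left_diff_distrib right_diff_distrib single_word_mult)
      then show ?thesis using spanned_add[OF spanned_add[OF 1 2] 3] by simp
    qed
  qed
qed

lemma sorted_words_span:
  "\<exists>r. Poly_Mapping.keys r \<subseteq> map e ` {w. sorted w \<and> set w \<subseteq> {..<n}} \<and> q - r \<in> I"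
proof -
  have w: "Poly_Mapping.single u c \<in> spanned (length u)" for u c
  proof (induction u)
    case Nil
    show ?case using spanned_word[of "[]" 0 c] by simp
  next
    case (Cons x u)
    have "letter x * Poly_Mapping.single u c \<in> spanned (Suc (length u))"
      by (rule spanned_step[OF _ Cons.IH lessI]) (rule spanned_insort)
    then show ?case by (simp add: single_word_mult)
  qed
  have "\<exists>N. q \<in> spanned N"
  proof (induction q rule: poly_mapping_single_induct)
    case zero
    show ?case using spanned_I[of 0] by auto
  next
    case (single u c)
    then show ?case using w by blast
  next
    case (add p q)
    then obtain N M where "p \<in> spanned N" "q \<in> spanned M" by blast
    then have "p + q \<in> spanned (max N M)"
      by (intro spanned_add) (auto intro: spanned_mono)
    then show ?case by blast
  qed
  then show ?thesis unfolding spanned_def by blast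
qed

text \<open>
  The resulting functional reads off the coefficient of the monomial \<open>\<gamma>\<close> in the basis vectors outside
  \<open>P\<close>, an element of \<open>U(P)\<close>, and evaluates it at \<open>g\<close>.
\<close>

definition tail_character :: "nat list \<Rightarrow> ('a \<Rightarrow> 'k) \<Rightarrow> nat list \<Rightarrow> 'k" where
  "tail_character \<gamma> g w = (if filter (\<lambda>i. i < m) w = \<gamma> then prod_list (map (g \<circ> e) (filter (\<lambda>i. m \<le> i) w)) else 0)"

text \<open>Appending a letter of P on the right must multiply by \<open>g\<close>, also when the
  result is not sorted. Descents inside \<open>u\<close> are resolved on both sides at once; if
  \<open>u\<close> is sorted, the only descent involves two letters of the commuting tail.\<close>

lemma straighten_tail:
  assumes "m \<le> i" "i < n" "set u \<subseteq> {..<n}"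
  shows "straighten (tail_character \<gamma> g) (u @ [i]) = g (e i) * straighten (tail_character \<gamma> g) u"
  using assms
proof (induction "u @ [i]" arbitrary: u i rule: word_less_induct)
  case less
  let ?\<sigma> = "straighten (tail_character \<gamma> g)"
  show ?case
  proof (cases "sorted u")
    case False
    obtain u1 a c v where u: "u = u1 @ a # c # v" "c < a"
      using not_sorted_descent[OF False] by blast
    have 1: "?\<sigma> ((u1 @ c # a # v) @ [i]) = g (e i) * ?\<sigma> (u1 @ c # a # v)"
      using u less.prems word_less_swap[OF u(2), of u1 "v @ [i]"] by (intro less.hyps) auto
    have 2: "?\<sigma> ((u1 @ k # v) @ [i]) = g (e i) * ?\<sigma> (u1 @ k # v)" if "k < n" for k
      using u less.prems that by (intro less.hyps word_less_shorter) auto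
    have 3: "insert_vec ?\<sigma> u1 x (v @ [i]) = g (e i) * insert_vec ?\<sigma> u1 x v" for x
      using 2 by (simp add: insert_vec_def sum_distrib_left algebra_simps)
    show ?thesis
      using straighten_descent[OF u(2), of "tail_character \<gamma> g" u1 "v @ [i]"]
        straighten_descent[OF u(2), of "tail_character \<gamma> g" u1 v] 1 3
      by (simp add: u algebra_simps)
  next
    case True
    show ?thesis
    proof (cases "sorted (u @ [i])")
      case s: True
      have "?\<sigma> (u @ [i]) = tail_character \<gamma> g (u @ [i])" by (rule straighten_sorted[OF s])
      also have "\<dots> = g (e i) * tail_character \<gamma> g u"
        using less.prems by (simp add: tail_character_def)
      finally show ?thesis by (simp add: straighten_sorted[OF True])
    next
      case ns: False
      then obtain u' k where u: "u = u' @ [k]"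
        by (metis append.left_neutral rev_exhaust sorted1)
      have ki: "i < k"
        using ns True unfolding u by (force simp: sorted_append)
      have k: "m \<le> k" "k < n" "set u' \<subseteq> {..<n}" using ki less.prems u by auto
      have wl: "((u' @ [i]) @ [k], u @ [i]) \<in> word_less"
        using word_less_swap[OF ki, of u' "[]"] u by simp
      \<comment> \<open>Here \<open>m \<le> i < k\<close>, so both letters belong to the commuting
        tail and the swap leaves no bracket term.\<close>
      have 1: "?\<sigma> (u @ [i]) = ?\<sigma> ((u' @ [i]) @ [k])"
        using straighten_descent[OF ki, of "tail_character \<gamma> g" u' "[]"] k less.prems
        by (simp add: u tail_commutes)
      have 2: "?\<sigma> ((u' @ [i]) @ [k]) = g (e k) * ?\<sigma> (u' @ [i])"
        using k less.prems by (intro less.hyps wl) auto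
      have 3: "?\<sigma> (u' @ [i]) = g (e i) * ?\<sigma> u'"
        using k less.prems u by (intro less.hyps word_less_shorter) auto
      have 4: "?\<sigma> (u' @ [k]) = g (e k) * ?\<sigma> u'"
        using k u by (intro less.hyps word_less_shorter) auto
      show ?thesis using 1 2 3 4 by (simp add: u)
    qed
  qed
qed

definition coefficient :: "nat list \<Rightarrow> ('a \<Rightarrow> 'k) \<Rightarrow> ('a list \<Rightarrow>\<^sub>0 'k) \<Rightarrow> 'k" where
  "coefficient \<gamma> g = functional (straighten (tail_character \<gamma> g))"

lemma coefficient_I: "p \<in> I \<Longrightarrow> coefficient \<gamma> g p = 0"
  unfolding coefficient_def by (intro functional_I commutation_straighten)

lemma coefficient_add: "coefficient \<gamma> g (p + q) = coefficient \<gamma> g p + coefficient \<gamma> g q"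
  by (simp add: coefficient_def functional_add)

lemma coefficient_diff: "coefficient \<gamma> g (p - q) = coefficient \<gamma> g p - coefficient \<gamma> g q"
  by (simp add: coefficient_def functional_diff)

lemma coefficient_scalar: "coefficient \<gamma> g (scalar c * p) = c * coefficient \<gamma> g p"
  by (induction p rule: poly_mapping_single_induct)
    (auto simp: coefficient_def functional_add functional_single single_word_mult algebra_simps)

lemma coefficient_one: "coefficient \<gamma> g 1 = (if \<gamma> = [] then 1 else 0)"
  unfolding single_Nil_one[symmetric] coefficient_def functional_single
  by (simp add: straighten_sorted tail_character_def)

lemma ext_cong: "(\<And>w. set w \<subseteq> {..<n} \<Longrightarrow> \<sigma> w = \<tau> w) \<Longrightarrow> ext u \<sigma> = ext u \<tau>"
proof (induction u arbitrary: \<sigma> \<tau>)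
  case (Cons x u)
  have "ext u (\<lambda>w. \<sigma> (i # w)) = ext u (\<lambda>w. \<tau> (i # w))" if "i < n" for i
    using that by (intro Cons.IH Cons.prems) auto
  then show ?case by simp
qed simp

text \<open>This is why the letters of P are sorted to the right: the coefficient functionals
  respect the relations of the module induced from \<open>g\<close>, which identify right
  multiplication by \<open>p\<close> with the scalar \<open>g p\<close>.\<close>

lemma coefficient_character:
  assumes g: "Vector_Spaces.linear scale (*) g" and p: "\<forall>i<m. co p i = 0"
  shows "coefficient \<gamma> g (q * (letter p - scalar (g p))) = 0"
proof (induction q rule: poly_mapping_single_induct)
  case zero
  show ?case by (simp add: coefficient_def)
next
  case (add q r)
  then show ?case by (simp add: distrib_right coefficient_add)
next
  case (single u c)
  interpret g: Vector_Spaces.linear scale "(*)" g by (rule g)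
  let ?\<sigma> = "straighten (tail_character \<gamma> g)"
  have gp: "g p = (\<Sum>i<n. co p i * g (e i))"
    by (subst co_sum[symmetric]) (simp only: g.sum g.scale)
  have "ext (u @ [p]) ?\<sigma> = ext u (\<lambda>w. \<Sum>i<n. co p i * ?\<sigma> (w @ [i]))"
    by (simp add: ext_append)
  also have "\<dots> = ext u (\<lambda>w. g p * ?\<sigma> w)"
  proof (rule ext_cong)
    fix w assume w: "set w \<subseteq> {..<n}"
    have "co p i * ?\<sigma> (w @ [i]) = co p i * g (e i) * ?\<sigma> w" if "i < n" for i
      using p straighten_tail[OF _ that w] by (cases "i < m") auto
    then show "(\<Sum>i<n. co p i * ?\<sigma> (w @ [i])) = g p * ?\<sigma> w"
      unfolding gp sum_distrib_right by (intro sum.cong refl) simp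
  qed
  also have "\<dots> = g p * ext u ?\<sigma>" by (rule ext_scale)
  finally show ?case
    by (simp add: right_diff_distrib single_word_mult coefficient_diff)
      (simp add: coefficient_def functional_single)
qed

end

section \<open>Nondegenerate functionals\<close>

locale abelian_ideal = lie_algebra scale bracket
  for scale :: "'k::field_char_0 \<Rightarrow> 'a::ab_group_add \<Rightarrow> 'a" and bracket :: "'a \<Rightarrow> 'a \<Rightarrow> 'a" +
  fixes P :: "'a set"
  assumes subspace_P: "subspace P"
    and ideal_P: "y \<in> P \<Longrightarrow> bracket x y \<in> P"
    and abelian_P: "x \<in> P \<Longrightarrow> y \<in> P \<Longrightarrow> bracket x y = 0"
begin

lemma ideal_P': "x \<in> P \<Longrightarrow> bracket x y \<in> P"
  using ideal_P[of x y] bracket_skew[of x y] subspace_neg[OF subspace_P, of "bracket y x"] by simp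

definition nondegenerate :: "('a \<Rightarrow> 'k) \<Rightarrow> bool" where
  "nondegenerate g \<longleftrightarrow> g \<in> dual scale \<and> (\<forall>y. (\<forall>p\<in>P. g (bracket p y) = 0) \<longrightarrow> y \<in> P)"

text \<open>The \<open>x j\<close> act as coordinate directions of L/P and the \<open>p j\<close> as
  the corresponding partial derivatives. Only this identity modulo P is used later, so neither
  family is required to be independent.\<close>

definition dual_system :: "('a \<Rightarrow> 'k) \<Rightarrow> nat \<Rightarrow> (nat \<Rightarrow> 'a) \<Rightarrow> (nat \<Rightarrow> 'a) \<Rightarrow> bool" where
  "dual_system g N p x \<longleftrightarrow> (\<forall>j<N. p j \<in> P) \<and> (\<forall>y. y - (\<Sum>j<N. scale (g (bracket (p j) y)) (x j)) \<in> P)"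

lemma linear_dual:
  assumes "g \<in> dual scale"
  shows "g (x + y) = g x + g y" "g (scale c x) = c * g x" "g (x - y) = g x - g y"
    "g (sum h A) = (\<Sum>a\<in>A. g (h a))" "g 0 = 0"
proof -
  interpret Vector_Spaces.linear scale "(*)" g using assms by (simp add: dual_def)
  show "g (x + y) = g x + g y" "g (scale c x) = c * g x" "g (x - y) = g x - g y"
    "g (sum h A) = (\<Sum>a\<in>A. g (h a))" "g 0 = 0"
    by (simp_all add: add scale diff sum)
qed

text \<open>Gram-Schmidt for the form \<open>g (bracket p y)\<close> between P and L/P: as vectors
  are adjoined one at a time, a residual outside P is detected by some element of P, by
  nondegeneracy, and is added to the system.\<close>

lemma dual_system_exists:
  assumes "nondegenerate g"
  obtains N p x where "dual_system g N p x"
proof -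
  have g: "g \<in> dual scale" using assms by (simp add: nondegenerate_def)
  note lin = linear_dual[OF g]
  define pr where "pr N p x y = y - (\<Sum>j<N. scale (g (bracket (p j) y)) (x j))" for N :: nat and p x y
  have pr_add: "pr N p x (y + z) = pr N p x y + pr N p x z" for N p x y z
    by (simp add: pr_def bracket_add_right lin scale_left_distrib sum.distrib algebra_simps)
  have pr_scale: "pr N p x (scale c y) = scale c (pr N p x y)" for N p x y c
    by (simp add: pr_def bracket_scale_right lin scale_right_diff_distrib scale_sum_right)
  have "\<exists>N p x. (\<forall>j<N. p j \<in> P) \<and> (\<forall>y\<in>span B. pr N p x y \<in> P)" if "finite B" for B
    using that
  proof (induction B)
    case empty
    show ?case
      by (intro exI[of _ 0]) (simp add: pr_def subspace_0[OF subspace_P])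
  next
    case (insert v B)
    then obtain N p x where IH: "\<forall>j<N. p j \<in> P" "\<And>y. y \<in> span B \<Longrightarrow> pr N p x y \<in> P" by blast
    define v' where "v' = pr N p x v"
    have dec: "\<exists>k z. y = z + scale k v \<and> z \<in> span B" if "y \<in> span (insert v B)" for y
      using that by (metis diff_add_cancel span_breakdown_eq)
    show ?case
    proof (cases "v' \<in> P")
      case True
      have "pr N p x y \<in> P" if y: "y \<in> span (insert v B)" for y
      proof -
        obtain k z where "y = z + scale k v" "z \<in> span B" using dec[OF y] by blast
        then show ?thesis
          using subspace_add[OF subspace_P IH(2) subspace_scale[OF subspace_P True]]
          by (simp add: pr_add pr_scale v'_def)
      qed
      with IH(1) show ?thesis by blast
    next
      case False
      then obtain p0 where p0: "p0 \<in> P" "g (bracket p0 v') \<noteq> 0"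
        using assms by (auto simp: nondegenerate_def)
      define q where "q = scale (1 / g (bracket p0 v')) p0"
      have q: "q \<in> P" "g (bracket q v') = 1"
        using p0 by (auto simp: q_def bracket_scale_left lin intro: subspace_scale[OF subspace_P])
      \<comment> \<open>The correction makes \<open>q'\<close> pair with \<open>y\<close> as
        \<open>q\<close> pairs with the residual of \<open>y\<close>, so the new coefficient is
        unaffected by the part of \<open>y\<close> that is already accounted for.\<close>
      define q' where "q' = q - (\<Sum>j<N. scale (g (bracket q (x j))) (p j))"
      have q': "q' \<in> P"
        unfolding q'_def using IH(1) q
        by (intro subspace_diff[OF subspace_P] subspace_sum[OF subspace_P] subspace_scale[OF subspace_P]) auto
      have gq': "g (bracket q' y) = g (bracket q (pr N p x y))" for y
      proof -
        have "bracket q (sum h A) = (\<Sum>a\<in>A. bracket q (h a))" for h :: "nat \<Rightarrow> 'a" and A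
          using bracket_sum_left[of h A q] bracket_skew[of q] by (simp add: sum_negf)
        moreover have "bracket q (y - z) = bracket q y - bracket q z" for z
          using bracket_add_right[of q "y - z" z] by simp
        ultimately show ?thesis
          by (simp add: q'_def pr_def bracket_diff_left bracket_sum_left lin bracket_scale_left
              bracket_scale_right mult.commute)
      qed
      let ?p = "p(N := q')" and ?x = "x(N := v')"
      have new: "pr (Suc N) ?p ?x y = pr N p x y - scale (g (bracket q (pr N p x y))) v'" for y
        by (simp add: pr_def[of "Suc N"] gq') (simp add: pr_def)
      have "pr (Suc N) ?p ?x y \<in> P" if y: "y \<in> span (insert v B)" for y
      proof -
        obtain k z where kz: "y = z + scale k v" "z \<in> span B" using dec[OF y] by blast
        have pz: "pr N p x z \<in> P" using IH(2) kz by blast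
        have "pr N p x y = pr N p x z + scale k v'" by (simp add: kz pr_add pr_scale v'_def)
        moreover have "g (bracket q (pr N p x z + scale k v')) = k"
          using abelian_P[OF q(1) pz] by (simp add: bracket_add_right bracket_scale_right lin q)
        ultimately show ?thesis using pz by (simp add: new)
      qed
      moreover have "\<forall>j<Suc N. ?p j \<in> P" using IH(1) q' by (auto simp: less_Suc_eq)
      ultimately show ?thesis by blast
    qed
  qed
  moreover obtain B where "finite B" "span B = UNIV" using finite_dimensional by blast
  ultimately obtain N p x where "\<forall>j<N. p j \<in> P" "\<forall>y\<in>span B. pr N p x y \<in> P" by blast
  then have "dual_system g N p x"
    unfolding dual_system_def pr_def \<open>span B = UNIV\<close> by simp
  then show ?thesis by (rule that)
qed

lemma finite_basis:
  obtains B where "finite B" "independent B" "span B = UNIV"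
proof -
  obtain B0 where B0: "finite B0" "span B0 = UNIV" using finite_dimensional by blast
  obtain B where "B \<subseteq> B0" "independent B" "B0 \<subseteq> span B"
    using maximal_independent_subset[of B0] by blast
  with B0 have "finite B" "span B = UNIV"
    by (auto intro: finite_subset simp: set_eq_iff) (metis UNIV_I span_minimal subsetD subspace_span)
  with \<open>independent B\<close> that show ?thesis by blast
qed

text \<open>Imposing one more linear condition lowers the dimension by at most one: a vector
  \<open>v\<close> violating it spans the quotient.\<close>

lemma dim_le_common_kernel:
  assumes "finite C" "subspace V" "\<And>c. c \<in> C \<Longrightarrow> Vector_Spaces.linear scale (*) (\<psi> c)"
  shows "dim V \<le> dim {x\<in>V. \<forall>c\<in>C. \<psi> c x = 0} + card C"
proof -
  obtain B where B: "finite B" "independent B" "span B = UNIV" by (rule finite_basis)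
  interpret fd: finite_dimensional_vector_space scale B
    by unfold_locales (use B in auto)
  show ?thesis
    using assms(1,3)
  proof (induction C)
    case empty
    then show ?case by simp
  next
    case (insert c C)
    let ?K = "{x\<in>V. \<forall>c\<in>C. \<psi> c x = 0}" and ?K' = "{x\<in>V. \<forall>d\<in>insert c C. \<psi> d x = 0}"
    interpret Vector_Spaces.linear scale "(*)" "\<psi> c" using insert.prems by simp
    have "dim ?K \<le> dim ?K' + 1"
    proof (cases "\<exists>v\<in>?K. \<psi> c v \<noteq> 0")
      case False
      then have "?K = ?K'" by auto
      then show ?thesis by simp
    next
      case True
      then obtain v where v: "v \<in> ?K" "\<psi> c v \<noteq> 0" by blast
      have lin: "\<psi> d (x - scale a y) = \<psi> d x - a * \<psi> d y" if "d \<in> insert c C" for d x y a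
      proof -
        interpret d: Vector_Spaces.linear scale "(*)" "\<psi> d" using insert.prems that by simp
        show ?thesis by (simp add: d.diff d.scale)
      qed
      have "?K \<subseteq> span (insert v ?K')"
      proof
        fix x assume x: "x \<in> ?K"
        let ?y = "x - scale (\<psi> c x / \<psi> c v) v"
        have "?y \<in> ?K'"
          using x v lin assms(2) by (auto intro!: subspace_diff subspace_scale)
        then have "scale (\<psi> c x / \<psi> c v) v + ?y \<in> span (insert v ?K')"
          by (intro span_add span_scale) (auto intro: span_base)
        then show "x \<in> span (insert v ?K')" by simp
      qed
      from fd.dim_subset[OF this] have "dim ?K \<le> dim (insert v ?K')"
        unfolding dim_span .
      also have "\<dots> \<le> dim ?K' + 1"
        by (simp add: fd.dim_insert)
      finally show ?thesis .
    qed
    moreover have "dim V \<le> dim ?K + card C" using insert by simp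
    ultimately show ?case using insert by simp
  qed
qed

text \<open>Let Q be the orthogonal of P. An element of P orthogonal to a complement of Q lies in
  L(f), so dim P + dim Q \<le> dim L + dim L(f). Regularity bounds dim L(f) by dim L(f0) for a
  functional f0 polarized by P, and the right side becomes at most 2 dim P. Since P is commutative,
  it lies in Q, hence equals Q.\<close>

lemma nondegenerate_regular:
  assumes "CP scale bracket P" "f \<in> regular scale bracket"
  shows "nondegenerate f"
proof -
  obtain B0 where B0: "finite B0" "independent B0" "span B0 = UNIV" by (rule finite_basis)
  interpret fd: finite_dimensional_vector_space scale B0
    by unfold_locales (use B0 in auto)
  have f: "f \<in> dual scale" using assms(2) by (simp add: regular_def)
  note lin = linear_dual[OF f]
  let ?Q = "{y. \<forall>p\<in>P. f (bracket p y) = 0}" and ?R = "radical bracket f UNIV"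
  have Q: "subspace ?Q"
    unfolding subspace_def by (auto simp: lin bracket_add_right bracket_scale_right)
  obtain B1 where B1: "B1 \<subseteq> ?Q" "independent B1" "?Q \<subseteq> span B1"
    using maximal_independent_subset by blast
  obtain B where B: "B1 \<subseteq> B" "independent B" "span B = UNIV"
    using maximal_independent_subset_extend[OF subset_UNIV B1(2)] by (metis top.extremum_uniqueI)
  have fin: "finite B" using B(2) by (rule fd.finiteI_independent)
  let ?C = "B - B1"
  have dimQ: "dim ?Q = card B1"
    using B1 by (intro dim_unique) auto
  have dimL: "dim (UNIV :: 'a set) = card B"
    using B by (intro dim_unique) auto
  have card: "card ?C + dim ?Q = dim (UNIV :: 'a set)"
    using card_Diff_subset[OF finite_subset[OF B(1) fin] B(1)] card_mono[OF fin B(1)]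
    unfolding dimQ dimL by simp
  have "dim P \<le> dim {x\<in>P. \<forall>c\<in>?C. f (bracket x c) = 0} + card ?C"
  proof (rule dim_le_common_kernel)
    show "Vector_Spaces.linear scale (*) (\<lambda>x. f (bracket x c))" for c
      by unfold_locales (auto simp: bracket_add_left bracket_scale_left lin algebra_simps)
  qed (use fin subspace_P in auto)
  \<comment> \<open>The basis of L consists of \<open>B1\<close>, which lies in Q and pairs to zero
    with all of P, and of the complement \<open>?C\<close>; so orthogonality to \<open>?C\<close>
    gives orthogonality to L.\<close>
  also have "dim {x\<in>P. \<forall>c\<in>?C. f (bracket x c) = 0} \<le> dim ?R"
  proof (rule fd.dim_subset, rule subsetI)
    fix x assume x: "x \<in> {x\<in>P. \<forall>c\<in>?C. f (bracket x c) = 0}"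
    have "f (bracket x y) = 0" if "y \<in> span B" for y
      using that
    proof (induction rule: span_induct_alt)
      case base
      then show ?case by (metis bracket_scale_right lin(2) mult_zero_left scale_zero_left)
    next
      case (step c v z)
      have "f (bracket x v) = 0"
        using x B1(1) step(1) by (cases "v \<in> B1") auto
      with step show ?case by (simp add: bracket_add_right bracket_scale_right lin)
    qed
    then show "x \<in> ?R" using B(3) by (auto simp: radical_def)
  qed
  finally have 1: "dim P + dim ?Q \<le> dim ?R + dim (UNIV :: 'a set)"
    using card by simp
  obtain f0 where f0: "f0 \<in> dual scale" "2 * dim P = dim (UNIV :: 'a set) + dim (radical bracket f0 UNIV)"
    using assms(1) by (auto simp: CP_def polarization_def)
  have "dim ?R = index scale bracket" using assms(2) by (simp add: regular_def)
  also have "\<dots> \<le> dim (radical bracket f0 UNIV)"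
    unfolding index_def using f0(1) by (intro Least_le) blast
  finally have "dim ?Q \<le> dim P" using 1 f0(2) by simp
  moreover have "P \<subseteq> ?Q" using abelian_P lin by auto
  ultimately have "P = ?Q"
    using fd.subspace_dim_equal[OF subspace_P Q] by blast
  then show ?thesis using f by (auto simp: nondegenerate_def)
qed

lemma frame_exists:
  obtains e co n m where "lie_frame scale bracket e co n m" "\<And>x. x \<in> P \<longleftrightarrow> (\<forall>i<m. co x i = 0)"
    "\<And>i. m \<le> i \<Longrightarrow> i < n \<Longrightarrow> e i \<in> P"
proof -
  obtain B0 where B0: "finite B0" "independent B0" "span B0 = UNIV" by (rule finite_basis)
  interpret fd: finite_dimensional_vector_space scale B0
    by unfold_locales (use B0 in auto)
  obtain B1 where B1: "B1 \<subseteq> P" "independent B1" "P \<subseteq> span B1"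
    using maximal_independent_subset by blast
  obtain B where B: "B1 \<subseteq> B" "independent B" "span B = UNIV"
    using maximal_independent_subset_extend[OF subset_UNIV B1(2)] by (metis top.extremum_uniqueI)
  have fin: "finite B" using B(2) by (rule fd.finiteI_independent)
  define m where "m = card (B - B1)"
  define n where "n = card B"
  obtain h1 where h1: "bij_betw h1 {0..<m} (B - B1)"
    using ex_bij_betw_nat_finite[of "B - B1"] fin m_def by blast
  obtain h2 where h2: "bij_betw h2 {0..<card B1} B1"
    using ex_bij_betw_nat_finite[of B1] fin B(1) by (metis finite_subset)
  \<comment> \<open>The basis vectors outside P receive the indices below \<open>m\<close>, so that
    those of P come last in sorted words.\<close>
  define e where "e i = (if i < m then h1 i else h2 (i - m))" for i
  have n: "n = m + card B1"
    using card_Diff_subset[OF finite_subset[OF B(1) fin] B(1)] card_mono[OF fin B(1)]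
    unfolding m_def n_def by simp
  have e1: "bij_betw e {0..<m} (B - B1)"
    using h1 by (rule bij_betw_cong[THEN iffD1, rotated]) (simp add: e_def)
  have "bij_betw (\<lambda>i. i - m) {m..<n} {0..<card B1}"
    by (rule bij_betw_byWitness[of _ "\<lambda>i. i + m"]) (auto simp: n)
  then have "bij_betw (h2 \<circ> (\<lambda>i. i - m)) {m..<n} B1"
    using h2 by (rule bij_betw_trans)
  then have e2: "bij_betw e {m..<n} B1"
    by (rule bij_betw_cong[THEN iffD1, rotated]) (simp add: e_def)
  have "bij_betw e ({0..<m} \<union> {m..<n}) ((B - B1) \<union> B1)"
    using e1 e2 by (rule bij_betw_combine) auto
  moreover have "{0..<m} \<union> {m..<n} = {..<n}" "(B - B1) \<union> B1 = B"
    using n B(1) by auto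
  ultimately have e: "bij_betw e {..<n} B" by simp
  define co where "co x i = representation B x (e i)" for x i
  have eB: "e i \<in> B" if "i < n" for i using e that by (auto simp: bij_betw_def)
  have eP: "e i \<in> P" if "m \<le> i" "i < n" for i using e2 that B1(1) by (auto simp: bij_betw_def)
  have co_sum: "(\<Sum>i<n. scale (co x i) (e i)) = x" for x
  proof -
    have "(\<Sum>i<n. scale (co x i) (e i)) = (\<Sum>v\<in>B. scale (representation B x v) v)"
      unfolding co_def using e by (rule sum.reindex_bij_betw)
    also have "\<dots> = x" using B fin by (intro sum_representation_eq) auto
    finally show ?thesis .
  qed
  have "lie_frame scale bracket e co n m"
  proof
    show "co (x + y) i = co x i + co y i" for x y i
      using B by (simp add: co_def representation_add)
    show "co (scale c x) i = c * co x i" for c x i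
      using B by (simp add: co_def representation_scale)
    show "co (e i) j = (if i = j then 1 else 0)" if "i < n" "j < n" for i j
    proof -
      have "e i = e j \<longleftrightarrow> i = j"
        using e that by (auto simp: bij_betw_def inj_on_def)
      then show ?thesis
        using B eB that by (auto simp: co_def representation_basis)
    qed
  qed (use co_sum n abelian_P eP in auto)
  moreover have "x \<in> P \<longleftrightarrow> (\<forall>i<m. co x i = 0)" for x
  proof
    assume "x \<in> P"
    then have "representation B x = representation B1 x"
      using B B1 by (intro representation_extend) auto
    then show "\<forall>i<m. co x i = 0"
      using e1 representation_ne_zero[of B1 x] by (fastforce simp: co_def bij_betw_def)
  next
    assume z: "\<forall>i<m. co x i = 0"
    have "(\<Sum>i<n. scale (co x i) (e i)) \<in> P"
    proof (rule subspace_sum[OF subspace_P])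
      fix i assume "i \<in> {..<n}"
      then show "scale (co x i) (e i) \<in> P"
        using z eP by (cases "i < m") (auto intro: subspace_scale[OF subspace_P] subspace_0[OF subspace_P])
    qed
    then show "x \<in> P" by (simp add: co_sum)
  qed
  ultimately show ?thesis using that eP by blast
qed

end

section \<open>Euler's identity\<close>

text \<open>Vectors reached from \<open>V\<close> by at most \<open>n\<close> operators. The rule
  \<open>base\<close> is available in every degree, which makes the filtration increasing; closure
  under scalars depends on \<open>V\<close> and is derived in \<open>fil_S\<close>.\<close>

inductive fil :: "('a \<Rightarrow> 'm \<Rightarrow> 'm) \<Rightarrow> 'm set \<Rightarrow> nat \<Rightarrow> 'm::ab_group_add \<Rightarrow> bool" for A V where
  base: "v \<in> V \<Longrightarrow> fil A V n v"
| add: "fil A V n y \<Longrightarrow> fil A V n z \<Longrightarrow> fil A V n (y + z)"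
| act: "fil A V n z \<Longrightarrow> fil A V (Suc n) (A x z)"

lemma fil_Suc: "fil A V n z \<Longrightarrow> fil A V (Suc n) z"
  by (induction rule: fil.induct) (auto intro: fil.intros)

lemma fil_mono: "fil A V n z \<Longrightarrow> n \<le> k \<Longrightarrow> fil A V k z"
  by (induction k) (auto simp: le_Suc_eq intro: fil_Suc)

lemma fil_0_iff:
  assumes "\<And>y z. y \<in> V \<Longrightarrow> z \<in> V \<Longrightarrow> y + z \<in> V"
  shows "fil A V 0 z \<longleftrightarrow> z \<in> V"
proof
  show "fil A V 0 z \<Longrightarrow> z \<in> V"
    by (induction "0::nat" z rule: fil.induct) (auto intro: assms)
qed (rule fil.base)

text \<open>
  The module is \<open>C\<close> modulo \<open>N\<close>: it is presented inside a type with exact addition, and its axioms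
  hold up to elements of \<open>N\<close>. Degree 0 is \<open>V\<close>, on which \<open>P\<close> acts through \<open>g\<close>.
\<close>

locale character_module = abelian_ideal scale bracket P
  for scale :: "'k::field_char_0 \<Rightarrow> 'a::ab_group_add \<Rightarrow> 'a" and bracket :: "'a \<Rightarrow> 'a \<Rightarrow> 'a" and P :: "'a set" +
  fixes A :: "'a \<Rightarrow> 'm \<Rightarrow> 'm::ab_group_add" and S :: "'k \<Rightarrow> 'm \<Rightarrow> 'm"
    and C N V :: "'m set" and g :: "'a \<Rightarrow> 'k" and d :: nat and p x :: "nat \<Rightarrow> 'a"
  assumes C_add: "y \<in> C \<Longrightarrow> z \<in> C \<Longrightarrow> y + z \<in> C"
    and C_uminus: "z \<in> C \<Longrightarrow> - z \<in> C"
    and C_A: "z \<in> C \<Longrightarrow> A u z \<in> C" and C_S: "z \<in> C \<Longrightarrow> S c z \<in> C"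
    and N_V: "N \<subseteq> V" and V_C: "V \<subseteq> C"
    and N_zero: "0 \<in> N"
    and N_add: "y \<in> N \<Longrightarrow> z \<in> N \<Longrightarrow> y + z \<in> N" and N_uminus: "z \<in> N \<Longrightarrow> - z \<in> N"
    and N_A: "z \<in> N \<Longrightarrow> A u z \<in> N"
    and V_add: "y \<in> V \<Longrightarrow> z \<in> V \<Longrightarrow> y + z \<in> V" and V_uminus: "z \<in> V \<Longrightarrow> - z \<in> V"
    and V_S: "z \<in> V \<Longrightarrow> S c z \<in> V"
    and A_add: "A u (y + z) = A u y + A u z" and S_add: "S c (y + z) = S c y + S c z"
    and A_add_left: "z \<in> C \<Longrightarrow> A (u + v) z - (A u z + A v z) \<in> N"
    and A_scale_left: "z \<in> C \<Longrightarrow> A (scale c u) z - S c (A u z) \<in> N"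
    and A_bracket: "z \<in> C \<Longrightarrow> A u (A v z) - A v (A u z) - A (bracket u v) z \<in> N"
    and S_add_left: "z \<in> C \<Longrightarrow> S (c + c') z - (S c z + S c' z) \<in> N"
    and S_mult: "z \<in> C \<Longrightarrow> S (c * c') z - S c (S c' z) \<in> N"
    and S_one: "z \<in> C \<Longrightarrow> S 1 z - z \<in> N"
    and A_S: "z \<in> C \<Longrightarrow> A u (S c z) - S c (A u z) \<in> N"
    and V_character: "z \<in> V \<Longrightarrow> u \<in> P \<Longrightarrow> A u z - S (g u) z \<in> N"
    and dual_g: "dual_system g d p x"
begin

definition T :: "'a \<Rightarrow> 'm \<Rightarrow> 'm" where "T u z = A u z - S (g u) z"

text \<open>Degree strictly below \<open>n\<close>; the null elements \<open>N\<close> play the part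
  of degree -1, so that statements about leading terms also make sense for
  \<open>n = 0\<close>.\<close>

definition low :: "nat \<Rightarrow> 'm \<Rightarrow> bool" where
  "low n z \<longleftrightarrow> (if n = 0 then z \<in> N else fil A V (n - 1) z)"

lemma A_uminus: "A u (- z) = - A u z"
proof -
  have "A u 0 = 0" using A_add[of u 0 0] by simp
  then show ?thesis using A_add[of u z "- z"] by (simp add: eq_neg_iff_add_eq_0 add.commute)
qed

lemma A_diff: "A u (y - z) = A u y - A u z"
  using A_add[of u y "- z"] by (simp add: A_uminus)

lemma T_add: "T u (y + z) = T u y + T u z"
  by (simp add: T_def A_add S_add)

lemma N_diff: "y \<in> N \<Longrightarrow> z \<in> N \<Longrightarrow> y - z \<in> N"
  using N_add[of y "- z"] N_uminus by simp

lemma fil_C: "fil A V n z \<Longrightarrow> z \<in> C"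
  by (induction rule: fil.induct) (use V_C C_add C_A in auto)

lemma fil_N: "z \<in> N \<Longrightarrow> fil A V n z"
  using N_V by (auto intro: fil.base)

lemma fil_uminus: "fil A V n z \<Longrightarrow> fil A V n (- z)"
proof (induction rule: fil.induct)
  case (act n z u)
  then show ?case using fil.act[of A V n "- z" u] by (simp add: A_uminus)
next
  case (add n y z)
  then show ?case using fil.add[of A V n "- y" "- z"] by simp
qed (auto intro: fil.base V_uminus)

lemma fil_diff: "fil A V n y \<Longrightarrow> fil A V n z \<Longrightarrow> fil A V n (y - z)"
  using fil.add[of A V n y "- z"] fil_uminus by simp

lemma fil_cong: "fil A V n y \<Longrightarrow> z - y \<in> N \<Longrightarrow> fil A V n z"
  using fil.add[of A V n y "z - y"] fil_N[of "z - y"] by simp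

lemma fil_cong': "fil A V n y \<Longrightarrow> y - z \<in> N \<Longrightarrow> fil A V n z"
  using fil_cong[of n y z] N_uminus[of "y - z"] by simp

lemma fil_S: "fil A V n z \<Longrightarrow> fil A V n (S c z)"
proof (induction rule: fil.induct)
  case (act n z u)
  have "fil A V (Suc n) (A u (S c z))" by (rule fil.act) (rule act.IH)
  then show ?case using A_S[OF fil_C[OF act.hyps]] by (rule fil_cong')
qed (auto intro: fil.base V_S fil.add simp: S_add)

lemma low_add: "low n y \<Longrightarrow> low n z \<Longrightarrow> low n (y + z)"
  by (auto simp: low_def intro: N_add fil.add split: if_splits)

lemma low_uminus: "low n z \<Longrightarrow> low n (- z)"
  by (auto simp: low_def intro: N_uminus fil_uminus split: if_splits)

lemma low_diff: "low n y \<Longrightarrow> low n z \<Longrightarrow> low n (y - z)"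
  using low_add[of n y "- z"] low_uminus by simp

lemma low_N: "z \<in> N \<Longrightarrow> low n z"
  by (auto simp: low_def intro: fil_N)

lemma low_fil: "low n z \<Longrightarrow> fil A V n z"
  by (cases n) (auto simp: low_def intro: fil_N fil_Suc)

lemma low_A: "low n z \<Longrightarrow> fil A V n (A u z)"
  by (cases n) (auto simp: low_def intro: fil_N N_A fil.act)

text \<open>\<open>T u\<close> passes the operator of \<open>y\<close> up to the operator of [u, y].
  Since P is an ideal, [u, y] lies in P and acts on degree \<open>n\<close> by its value under
  \<open>g\<close> plus a lower term, hence without raising the degree.\<close>

lemma T_low: "fil A V n z \<Longrightarrow> u \<in> P \<Longrightarrow> low n (T u z)"
proof (induction arbitrary: u rule: fil.induct)
  case (base v n)
  then show ?case using V_character by (auto simp: T_def intro: low_N)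
next
  case (add n y z)
  then show ?case by (simp add: T_add low_add)
next
  case (act n z y)
  have zC: "z \<in> C" by (rule fil_C) (rule act.hyps)
  let ?w = "bracket u y"
  have w: "?w \<in> P" using act.prems by (rule ideal_P')
  have "fil A V n (T ?w z + S (g ?w) z)"
    using low_fil[OF act.IH[OF w]] fil_S[OF act.hyps] by (rule fil.add)
  then have 1: "fil A V n (A ?w z)" by (simp add: T_def)
  have 2: "fil A V n (A y (T u z))" using act.IH[OF act.prems] by (rule low_A)
  have "T u (A y z) - (A ?w z + A y (T u z)) = (A u (A y z) - A y (A u z) - A ?w z) + (A y (S (g u) z) - S (g u) (A y z))"
    by (simp add: T_def A_diff algebra_simps)
  also have "\<dots> \<in> N" by (intro N_add A_bracket A_S zC)
  finally show ?case
    using fil_cong[OF fil.add[OF 1 2]] by (simp add: low_def)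
qed

definition E :: "'m \<Rightarrow> 'm" where "E z = (\<Sum>j<d. A (x j) (T (p j) z))"

lemma fil_sum: "(\<And>j. j < k \<Longrightarrow> fil A V n (h j)) \<Longrightarrow> fil A V n (\<Sum>j<(k::nat). h j)"
  by (induction k) (auto intro: fil.add fil_N N_zero)

lemma A_zero_left: "z \<in> C \<Longrightarrow> A 0 z \<in> N"
  using N_uminus[OF A_add_left[of z 0 0]] by simp

lemma A_sum_left: "z \<in> C \<Longrightarrow> A (\<Sum>j<k. h j) z - (\<Sum>j<(k::nat). A (h j) z) \<in> N"
proof (induction k)
  case (Suc k)
  have "A (\<Sum>j<Suc k. h j) z - (\<Sum>j<Suc k. A (h j) z) =
    (A ((\<Sum>j<k. h j) + h k) z - (A (\<Sum>j<k. h j) z + A (h k) z)) + (A (\<Sum>j<k. h j) z - (\<Sum>j<k. A (h j) z))"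
    by simp
  also have "\<dots> \<in> N" by (intro N_add A_add_left Suc)
  finally show ?case .
qed (simp add: A_zero_left)

lemma A_sum: "A u (\<Sum>j<k. h j) = (\<Sum>j<(k::nat). A u (h j))"
proof (induction k)
  case 0
  show ?case using A_add[of u 0 0] by simp
qed (simp add: A_add)

text \<open>Euler's identity for homogeneous polynomials, modulo terms of lower degree.\<close>

lemma euler: "fil A V n z \<Longrightarrow> low n (E z - S (of_nat n) z)"
proof (induction rule: fil.induct)
  case (base v n)
  have p: "p j \<in> P" if "j < d" for j using dual_g that by (simp add: dual_system_def)
  have "(\<Sum>j<k. A (x j) (T (p j) v)) \<in> N" if "k \<le> d" for k
    using that by (induction k) (auto intro!: N_zero N_add N_A simp: T_def V_character base p)
  then have Ev: "low n (E v)" unfolding E_def by (intro low_N) simp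
  \<comment> \<open>A vector of \<open>V\<close> may be listed in any degree \<open>n\<close>: for
    \<open>n > 0\<close> it is itself of lower degree, and for \<open>n = 0\<close> its coefficient
    is 0.\<close>
  have "low n (S (of_nat n) v)"
  proof (cases n)
    case 0
    have "S 0 v \<in> N" using N_uminus[OF S_add_left[of v 0 0]] base V_C by auto
    with 0 show ?thesis by (simp add: low_def)
  next
    case (Suc k)
    then show ?thesis using V_S[OF base] by (simp add: low_def fil.base)
  qed
  with Ev show ?case by (rule low_diff)
next
  case (add n y z)
  have "E (y + z) - S (of_nat n) (y + z) = (E y - S (of_nat n) y) + (E z - S (of_nat n) z)"
    by (simp add: E_def T_add A_add S_add sum.distrib)
  then show ?case using low_add[OF add.IH] by simp
next
  case (act n z y)
  let ?F = "fil A V n"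
  have zC: "z \<in> C" by (rule fil_C) (rule act.hyps)
  have p: "p j \<in> P" if "j < d" for j using dual_g that by (simp add: dual_system_def)
  define c where "c j = g (bracket (p j) y)" for j
  \<comment> \<open>Modulo P the vector \<open>y\<close> is the combination of the
    \<open>x j\<close> with coefficients \<open>c j\<close>; the difference \<open>q\<close> lies in
    P and does not raise the degree.\<close>
  define q where "q = y - (\<Sum>j<d. scale (c j) (x j))"
  have q: "q \<in> P" using dual_g by (simp add: q_def c_def dual_system_def)
  have TC: "T u z \<in> C" for u
    unfolding T_def using C_add[OF C_A[OF zC] C_uminus[OF C_S[OF zC]]] by simp
  \<comment> \<open>The derivative of the new factor \<open>y\<close> contributes \<open>c j\<close>
    times \<open>x j\<close>. The other commutators leave an operator applied to
    \<open>T ?w z\<close> or to \<open>T (p j) z\<close>, both of degree below \<open>n\<close>.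
    Summed over \<open>j\<close>, the contributions amount to \<open>y\<close> itself, the step from
    \<open>n\<close> to \<open>Suc n\<close>.\<close>
  have one: "?F (A (x j) (T (p j) (A y z)) - A (scale (c j) (x j)) z - A y (A (x j) (T (p j) z)))" if j: "j < d" for j
  proof -
    let ?w = "bracket (p j) y"
    have w: "?w \<in> P" using p[OF j] by (rule ideal_P')
    have 1: "?F (A (x j) (T ?w z))"
      using T_low[OF act.hyps w] by (rule low_A)
    have 2: "?F (A (bracket (x j) y) (T (p j) z))"
      using T_low[OF act.hyps p[OF j]] by (rule low_A)
    have n1: "T (p j) (A y z) - (A ?w z + A y (T (p j) z)) \<in> N"
    proof -
      have "T (p j) (A y z) - (A ?w z + A y (T (p j) z)) =
        (A (p j) (A y z) - A y (A (p j) z) - A ?w z) + (A y (S (g (p j)) z) - S (g (p j)) (A y z))"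
        by (simp add: T_def A_diff algebra_simps)
      also have "\<dots> \<in> N" by (intro N_add A_bracket A_S zC)
      finally show ?thesis .
    qed
    have "A (x j) (T (p j) (A y z)) - A (scale (c j) (x j)) z - A y (A (x j) (T (p j) z))
        - (A (x j) (T ?w z) + A (bracket (x j) y) (T (p j) z)) =
      A (x j) (T (p j) (A y z) - (A ?w z + A y (T (p j) z)))
      + (A (x j) (A y (T (p j) z)) - A y (A (x j) (T (p j) z)) - A (bracket (x j) y) (T (p j) z))
      + (A (x j) (S (c j) z) - S (c j) (A (x j) z))
      - (A (scale (c j) (x j)) z - S (c j) (A (x j) z))"
      by (simp add: A_diff A_add T_def[of ?w] c_def algebra_simps)
    also have "\<dots> \<in> N"
      by (intro N_add N_diff N_A n1 A_bracket A_S A_scale_left zC TC)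
    finally show ?thesis using fil_cong[OF fil.add[OF 1 2]] by blast
  qed
  have s1: "?F (E (A y z) - (\<Sum>j<d. A (scale (c j) (x j)) z) - A y (E z))"
    using fil_sum[OF one] unfolding E_def A_sum sum_subtractf by simp
  have s2: "?F (A y z - (\<Sum>j<d. A (scale (c j) (x j)) z))"
  proof -
    have "?F (T q z + S (g q) z)"
      using low_fil[OF T_low[OF act.hyps q]] fil_S[OF act.hyps] by (rule fil.add)
    then have 1: "?F (A q z)" by (simp add: T_def)
    have "A y z - (\<Sum>j<d. A (scale (c j) (x j)) z) - A q z =
      (A (q + (\<Sum>j<d. scale (c j) (x j))) z - (A q z + A (\<Sum>j<d. scale (c j) (x j)) z))
      + (A (\<Sum>j<d. scale (c j) (x j)) z - (\<Sum>j<d. A (scale (c j) (x j)) z))"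
      by (simp add: q_def)
    also have "\<dots> \<in> N" by (intro N_add A_add_left A_sum_left zC)
    finally show ?thesis by (rule fil_cong[OF 1])
  qed
  have s3: "?F (A y (E z) - A y (S (of_nat n) z))"
    using low_A[OF act.IH, of y] by (simp add: A_diff)
  have s4: "A y (S (of_nat n) z) + A y z - S (of_nat (Suc n)) (A y z) \<in> N"
  proof -
    have "A y (S (of_nat n) z) + A y z - S (of_nat (Suc n)) (A y z) =
      (A y (S (of_nat n) z) - S (of_nat n) (A y z)) - (S 1 (A y z) - A y z)
      - (S (of_nat n + 1) (A y z) - (S (of_nat n) (A y z) + S 1 (A y z)))"
      by (simp add: algebra_simps)
    also have "\<dots> \<in> N" by (intro N_diff A_S S_one S_add_left C_A zC)
    finally show ?thesis .
  qed
  have "?F (((E (A y z) - (\<Sum>j<d. A (scale (c j) (x j)) z) - A y (E z)) + (A y (E z) - A y (S (of_nat n) z)))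
     - (A y z - (\<Sum>j<d. A (scale (c j) (x j)) z)) + (A y (S (of_nat n) z) + A y z - S (of_nat (Suc n)) (A y z)))"
    by (rule fil.add[OF fil_diff[OF fil.add[OF s1 s3] s2] fil_N[OF s4]])
  then show ?case by (simp add: low_def algebra_simps)
qed

lemma annihilated_imp_V:
  assumes "fil A V n z" "\<And>u. u \<in> P \<Longrightarrow> T u z \<in> N"
  shows "z \<in> V"
  using assms(1)
proof (induction n)
  case 0
  then show ?case using fil_0_iff[OF V_add] by blast
next
  case (Suc n)
  have zC: "z \<in> C" by (rule fil_C) (rule Suc.prems)
  have "(\<Sum>j<k. A (x j) (T (p j) z)) \<in> N" if "k \<le> d" for k
    using that dual_g by (induction k) (auto intro!: N_zero N_add N_A assms(2) simp: dual_system_def)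
  then have "E z \<in> N" by (simp add: E_def)
  moreover have "fil A V n (E z - S (of_nat (Suc n)) z)"
    using euler[OF Suc.prems] by (simp add: low_def)
  ultimately have "fil A V n (E z - (E z - S (of_nat (Suc n)) z))"
    by (rule fil_diff[OF fil_N])
  then have "fil A V n (S (of_nat (Suc n)) z)" by simp
  \<comment> \<open>Characteristic zero: \<open>Suc n\<close> is invertible in k, so
    \<open>z\<close> itself has degree at most \<open>n\<close>, and the induction continues down to
    degree 0.\<close>
  then have "fil A V n (S (1 / of_nat (Suc n)) (S (of_nat (Suc n)) z))" by (rule fil_S)
  moreover have "(1 / of_nat (Suc n)) * of_nat (Suc n) = (1::'k)"
    by (simp del: of_nat_Suc)
  then have "S 1 z - S (1 / of_nat (Suc n)) (S (of_nat (Suc n)) z) \<in> N"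
    using S_mult[OF zC, of "1 / of_nat (Suc n)" "of_nat (Suc n)"] by (simp only:)
  ultimately have "fil A V n (S 1 z)" by (rule fil_cong)
  then have "fil A V n z" using S_one[OF zC] by (rule fil_cong')
  then show ?case by (rule Suc.IH)
qed

text \<open>Apply some \<open>T u\<close> with \<open>u \<in> P\<close> as long as the result is not
  null. The degree drops each time, so the process stops at a vector that all of them
  annihilate.\<close>

lemma submodule_meets_V:
  assumes M: "\<And>y z. y \<in> M \<Longrightarrow> z \<in> M \<Longrightarrow> y - z \<in> M" "\<And>u z. z \<in> M \<Longrightarrow> A u z \<in> M" "\<And>c z. z \<in> M \<Longrightarrow> S c z \<in> M"
    and z: "z \<in> M" "z \<notin> N" "fil A V n z"
  shows "\<exists>v\<in>M \<inter> V. v \<notin> N"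
  using z
proof (induction n arbitrary: z rule: less_induct)
  case (less n)
  show ?case
  proof (cases "\<forall>u\<in>P. T u z \<in> N")
    case True
    then have "z \<in> V" using annihilated_imp_V less.prems by blast
    with less.prems show ?thesis by blast
  next
    case False
    then obtain u where u: "u \<in> P" "T u z \<notin> N" by blast
    have "low n (T u z)" using less.prems(3) u(1) by (rule T_low)
    with u(2) have "n > 0" "fil A V (n - 1) (T u z)" by (auto simp: low_def split: if_splits)
    moreover have "T u z \<in> M" using M less.prems(1) by (simp add: T_def)
    ultimately show ?thesis using less.IH[of "n - 1" "T u z"] u(2) by simp
  qed
qed

end

section \<open>The centralizer of the ideal\<close>

text \<open>Dedekind's argument, for the monomials as characters of the monoid of all \<open>h\<close>.\<close>

lemma words_independent:
  fixes a :: "nat list \<Rightarrow> 'k::field_char_0"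
  assumes "finite W" "\<And>w. w \<in> W \<Longrightarrow> sorted w"
    and "\<And>h. (\<Sum>w\<in>W. a w * prod_list (map h w)) = 0"
  shows "\<forall>w\<in>W. a w = 0"
  using assms
proof (induction W arbitrary: a)
  case (insert w0 W)
  define \<chi> where "\<chi> h w = prod_list (map h w)" for h :: "nat \<Rightarrow> 'k" and w
  have \<chi>_mult: "\<chi> (\<lambda>i. h i * h' i) w = \<chi> h w * \<chi> h' w" for h h' w
    by (induction w) (auto simp: \<chi>_def)
  have z: "(\<Sum>w\<in>insert w0 W. a w * \<chi> h w) = 0" for h
    using insert.prems(2) by (simp only: \<chi>_def)
  \<comment> \<open>Evaluating the relation at the product of \<open>h0\<close> and \<open>h\<close>
    and subtracting \<open>\<chi> h0 w0\<close> times the relation at \<open>h\<close> removes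
    \<open>w0\<close>; the induction hypothesis applies to what is left.\<close>
  have zero: "a w * (\<chi> h0 w - \<chi> h0 w0) = 0" if "w \<in> W" for w h0
  proof -
    have "(\<Sum>w\<in>W. a w * (\<chi> h0 w - \<chi> h0 w0) * \<chi> h w) = 0" for h
    proof -
      have "(\<Sum>w\<in>W. a w * (\<chi> h0 w - \<chi> h0 w0) * \<chi> h w)
          = (\<Sum>w\<in>insert w0 W. a w * (\<chi> h0 w - \<chi> h0 w0) * \<chi> h w)"
        using insert.hyps by simp
      also have "\<dots> = (\<Sum>w\<in>insert w0 W. a w * \<chi> (\<lambda>i. h0 i * h i) w) - \<chi> h0 w0 * (\<Sum>w\<in>insert w0 W. a w * \<chi> h w)"
        unfolding \<chi>_mult sum_distrib_left sum_subtractf[symmetric]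
        by (intro sum.cong refl) (simp add: algebra_simps)
      finally show ?thesis by (simp only: z) simp
    qed
    then show ?thesis
      using insert.IH[of "\<lambda>w. a w * (\<chi> h0 w - \<chi> h0 w0)"] insert.prems(1) that
      by (simp add: \<chi>_def)
  qed
  have aW: "a w = 0" if w: "w \<in> W" for w
  proof -
    have "w \<noteq> w0" using w insert.hyps by blast
    moreover have "sorted w" "sorted w0" using insert.prems(1) w by auto
    ultimately have "mset w \<noteq> mset w0"
      by (metis properties_for_sort)
    then obtain i where i: "count (mset w) i \<noteq> count (mset w0) i"
      by (meson multiset_eqI)
    \<comment> \<open>For this choice the monomial takes the value 2 to the multiplicity of
      \<open>i\<close>. Sorted words that differ have different multiplicities somewhere, and powers
      of 2 are distinct in characteristic zero.\<close>
    define h where "h j = (if j = i then 2 else 1 :: 'k)" for j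
    have h: "\<chi> h u = 2 ^ count (mset u) i" for u
      by (induction u) (auto simp: \<chi>_def h_def)
    have "\<chi> h w \<noteq> \<chi> h w0"
    proof
      assume "\<chi> h w = \<chi> h w0"
      then have "of_nat (2 ^ count (mset w) i) = (of_nat (2 ^ count (mset w0) i) :: 'k)"
        by (simp add: h)
      then show False using i by (simp only: of_nat_eq_iff) simp
    qed
    then show ?thesis using zero[OF w, of h] by simp
  qed
  moreover have "a w0 = 0"
  proof -
    have one: "\<chi> (\<lambda>_. 1) w0 = 1" by (induction w0) (auto simp: \<chi>_def)
    have "(\<Sum>w\<in>W. a w * \<chi> (\<lambda>_. 1) w) = 0" using aW by (intro sum.neutral) simp
    then show ?thesis using z[of "\<lambda>_. 1"] insert.hyps one by simp
  qed
  ultimately show ?case by simp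
qed simp

section \<open>Functionals in general position\<close>

context abelian_ideal
begin

lemma finite_eigenvalues:
  assumes "Vector_Spaces.linear scale scale G"
  shows "finite {c. \<exists>y. y \<noteq> 0 \<and> G y = scale c y}"
proof (rule ccontr)
  assume inf: "infinite {c. \<exists>y. y \<noteq> 0 \<and> G y = scale c y}"
  obtain B where B: "finite B" "independent B" "span B = UNIV" by (rule finite_basis)
  interpret fd: finite_dimensional_vector_space scale B
    by unfold_locales (use B in auto)
  interpret G: Vector_Spaces.linear scale scale G by fact
  obtain S where S: "S \<subseteq> {c. \<exists>y. y \<noteq> 0 \<and> G y = scale c y}" "finite S" "card S = Suc (dim UNIV)"
    using infinite_arbitrarily_large[OF inf] by blast
  then obtain v where v: "\<And>c. c \<in> S \<Longrightarrow> v c \<noteq> 0 \<and> G (v c) = scale c (v c)"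
    by (simp add: subset_iff) metis
  have inj: "inj_on v S"
  proof (rule inj_onI)
    fix c c' assume c: "c \<in> S" "c' \<in> S" "v c = v c'"
    then have "scale c (v c) = scale c' (v c)" using v by metis
    then show "c = c'" using v[OF c(1)] by simp
  qed
  have "independent (v ` S')" if "S' \<subseteq> S" "finite S'" for S'
    using that(2,1)
  proof (induction S')
    case empty
    then show ?case by (simp add: independent_empty)
  next
    case (insert c S')
    then have ind: "independent (v ` S')" by simp
    have "v c \<notin> span (v ` S')"
    proof
      assume "v c \<in> span (v ` S')"
      then obtain u where u: "v c = (\<Sum>w\<in>v ` S'. scale (u w) w)"
        using span_finite[of "v ` S'"] insert.hyps by auto
      then have u': "v c = (\<Sum>c'\<in>S'. scale (u (v c')) (v c'))"
        using inj insert.prems by (subst (asm) sum.reindex) (auto intro: inj_on_subset)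
      \<comment> \<open>The operator \<open>G - c\<close> kills \<open>v c\<close> and multiplies
        each \<open>v c'\<close> by the nonzero number \<open>c' - c\<close>; independence of the
        latter then forces all coefficients \<open>u (v c')\<close> to vanish.\<close>
      have "(\<Sum>c'\<in>S'. scale ((c' - c) * u (v c')) (v c')) = G (v c) - scale c (v c)"
      proof -
        have "G (v c) = (\<Sum>c'\<in>S'. scale (u (v c')) (scale c' (v c')))"
        proof -
          have "G (v c') = scale c' (v c')" if "c' \<in> S'" for c' using v[of c'] insert.prems that by blast
          then show ?thesis
            by (subst u') (simp add: G.sum G.scale)
        qed
        moreover have "scale c (v c) = (\<Sum>c'\<in>S'. scale (c * u (v c')) (v c'))"
          by (subst u') (simp add: scale_sum_right)
        ultimately show ?thesis
          by (simp add: left_diff_distrib scale_left_diff_distrib sum_subtractf mult.commute)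
      qed
      also have "\<dots> = 0" using v insert.prems by simp
      finally have z: "(\<Sum>c'\<in>S'. scale ((c' - c) * u (v c')) (v c')) = 0" .
      define k where "k w = (the_inv_into S' v w - c) * u w" for w
      have injS': "inj_on v S'" using inj insert.prems by (auto intro: inj_on_subset)
      have "(\<Sum>w\<in>v ` S'. scale (k w) w) = 0"
        using z injS' by (simp add: sum.reindex k_def the_inv_into_f_f)
      then have "k (v c') = 0" if "c' \<in> S'" for c'
        using independentD[OF ind _ order_refl, of k "v c'"] insert.hyps that by auto
      then have "u (v c') = 0" if "c' \<in> S'" for c'
        using that insert.hyps injS' by (auto simp: k_def the_inv_into_f_f)
      then have "v c = 0" using u' by simp
      then show False using v insert.prems by simp
    qed
    then show ?case using ind by (simp add: independent_insertI)
  qed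
  then have "independent (v ` S)" using S(2) by blast
  then have "card (v ` S) \<le> dim (UNIV :: 'a set)"
    by (intro fd.independent_card_le_dim) auto
  then show False using S(3) card_image[OF inj] by simp
qed

lemma dual_add_scale: "f \<in> dual scale \<Longrightarrow> g \<in> dual scale \<Longrightarrow> (\<lambda>y. f y + t * g y) \<in> dual scale"
  unfolding dual_def mem_Collect_eq
  using linear_dual[of f] linear_dual[of g]
  by unfold_locales (auto simp: dual_def algebra_simps)

text \<open>If \<open>f + t g\<close> is degenerate, then \<open>- 1 / t\<close> is an eigenvalue of an operator that does not
  depend on \<open>t\<close>.\<close>

lemma nondegenerate_line:
  assumes f: "nondegenerate f" and g: "g \<in> dual scale"
  shows "finite {t. \<not> nondegenerate (\<lambda>y. f y + t * g y)}"
proof -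
  obtain d p x where ds: "dual_system f d p x" by (rule dual_system_exists[OF f])
  have fd: "f \<in> dual scale" using f by (simp add: nondegenerate_def)
  note linf = linear_dual[OF fd] and ling = linear_dual[OF g]
  define G where "G z = (\<Sum>j<d. scale (g (bracket (p j) z)) (x j))" for z
  have G: "Vector_Spaces.linear scale scale G"
    by unfold_locales (auto simp: G_def bracket_add_right bracket_scale_right ling
        scale_left_distrib sum.distrib scale_sum_right)
  have "(\<lambda>t. - inverse t) ` {t. \<not> nondegenerate (\<lambda>y. f y + t * g y)} \<subseteq> {c. \<exists>y. y \<noteq> 0 \<and> G y = scale c y}"
  proof (intro subsetI, elim imageE CollectE, intro CollectI)
    fix c t assume t: "\<not> nondegenerate (\<lambda>y. f y + t * g y)" and c: "c = - inverse t"
    obtain y where y: "y \<notin> P" "\<And>q. q \<in> P \<Longrightarrow> f (bracket q y) + t * g (bracket q y) = 0"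
      using t dual_add_scale[OF fd g] by (auto simp: nondegenerate_def)
    \<comment> \<open>Replace \<open>y\<close> by its representative modulo P in the span of the
      \<open>x j\<close>: it is nonzero because \<open>y \<notin> P\<close>, and it has the same
      brackets with P because P is commutative.\<close>
    define y' where "y' = (\<Sum>j<d. scale (f (bracket (p j) y)) (x j))"
    have yy: "y - y' \<in> P" using ds by (simp add: dual_system_def y'_def)
    have "y' \<noteq> 0" using yy y(1) by auto
    have p: "p j \<in> P" if "j < d" for j using ds that by (simp add: dual_system_def)
    have br: "bracket (p j) y = bracket (p j) y'" if "j < d" for j
      using bracket_add_right[of "p j" "y - y'" y'] abelian_P[OF p[OF that] yy] by simp
    have "f (bracket (p j) y) = - t * g (bracket (p j) y')" if "j < d" for j
      using y(2)[OF p[OF that]] br[OF that] by (simp add: eq_neg_iff_add_eq_0)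
    then have "(\<Sum>j<d. scale (f (bracket (p j) y)) (x j)) = (\<Sum>j<d. scale (- t * g (bracket (p j) y')) (x j))"
      by (intro sum.cong refl) simp
    from trans[OF y'_def this] have "y' = (\<Sum>j<d. scale (- t * g (bracket (p j) y')) (x j))" .
    also have "\<dots> = scale (- t) (G y')"
      by (simp add: G_def scale_sum_right sum_negf)
    finally have e: "y' = scale (- t) (G y')" .
    then have "t \<noteq> 0" using \<open>y' \<noteq> 0\<close> by auto
    have "scale c y' = scale c (scale (- t) (G y'))" using e by simp
    also have "\<dots> = G y'" using \<open>t \<noteq> 0\<close> by (simp add: c)
    finally show "\<exists>y. y \<noteq> 0 \<and> G y = scale c y" using \<open>y' \<noteq> 0\<close> by metis
  qed
  then have "finite ((\<lambda>t. - inverse t) ` {t. \<not> nondegenerate (\<lambda>y. f y + t * g y)})"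
    using finite_eigenvalues[OF G] by (rule finite_subset)
  \<comment> \<open>The map from \<open>t\<close> to \<open>- inverse t\<close> is injective on all
    of k, with 0 sent to 0.\<close>
  then show ?thesis by (rule finite_imageD) (auto intro: inj_onI)
qed

end

section \<open>Induced modules as quotients of the free algebra by left ideals\<close>

context abelian_ideal
begin

abbreviation mod_scalars :: "('a list \<Rightarrow>\<^sub>0 'k) set \<Rightarrow> ('a list \<Rightarrow>\<^sub>0 'k) set" where
  "mod_scalars J \<equiv> {w. \<exists>c. w - scalar c \<in> J}"

text \<open>The quotient of the free algebra by such a \<open>J\<close> is a quotient of the module
  induced from \<open>g\<close>, generated by the class of 1. Both the true kernel of the induced
  module and the ideals \<open>annihilator g\<close> have this form.\<close>

definition left_ideal_over :: "('a \<Rightarrow> 'k) \<Rightarrow> ('a list \<Rightarrow>\<^sub>0 'k) set \<Rightarrow> bool" where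
  "left_ideal_over g J \<longleftrightarrow> I \<subseteq> J \<and> (\<forall>y\<in>J. \<forall>z\<in>J. y + z \<in> J) \<and> (\<forall>a. \<forall>z\<in>J. a * z \<in> J) \<and>
     (\<forall>p\<in>P. letter p - scalar (g p) \<in> J)"

lemma word_module:
  assumes J: "left_ideal_over g J" and ds: "dual_system g d p x"
  shows "character_module scale bracket P (\<lambda>u z. letter u * z) (\<lambda>c z. scalar c * z) UNIV J
    (mod_scalars J) g d p x"
proof -
  have I: "I \<subseteq> J" and add: "y \<in> J \<Longrightarrow> z \<in> J \<Longrightarrow> y + z \<in> J" and mult: "z \<in> J \<Longrightarrow> a * z \<in> J"
    and char: "u \<in> P \<Longrightarrow> letter u - scalar (g u) \<in> J" for y z a u
    using J by (auto simp: left_ideal_over_def)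
  have uminus: "z \<in> J \<Longrightarrow> - z \<in> J" for z using mult[of z "- 1"] by simp
  have IJ: "r \<in> I \<Longrightarrow> r * z \<in> J" for r z using I I_mult_right by blast
  show ?thesis
  proof
    show "y + z \<in> mod_scalars J" if t: "y \<in> mod_scalars J" "z \<in> mod_scalars J" for y z
    proof -
      obtain c c' where "y - scalar c \<in> J" "z - scalar c' \<in> J" using t by blast
      from add[OF this] show ?thesis by (auto simp: scalar_add algebra_simps intro!: exI[of _ "c + c'"])
    qed
    show "- z \<in> mod_scalars J" if t: "z \<in> mod_scalars J" for z
    proof -
      obtain c where "z - scalar c \<in> J" using t by blast
      from uminus[OF this] show ?thesis by (auto simp: single_uminus algebra_simps intro!: exI[of _ "- c"])
    qed
    show "scalar a * z \<in> mod_scalars J" if t: "z \<in> mod_scalars J" for a z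
    proof -
      obtain c where "z - scalar c \<in> J" using t by blast
      from mult[OF this, of "scalar a"] show ?thesis
        by (auto simp: right_diff_distrib single_word_mult intro!: exI[of _ "a * c"])
    qed
    show "letter (u + v) * z - (letter u * z + letter v * z) \<in> J" for u v z
      using IJ[OF letter_add, of u v z] by (simp add: algebra_simps)
    show "letter (scale c u) * z - scalar c * (letter u * z) \<in> J" for c u z
      using IJ[OF letter_scale, of c u z] by (simp add: left_diff_distrib mult.assoc)
    show "letter u * (letter v * z) - letter v * (letter u * z) - letter (bracket u v) * z \<in> J" for u v z
      using IJ[OF letter_bracket, of u v z] by (simp add: left_diff_distrib mult.assoc)
    have zero: "0 \<in> J" using I I_zero by blast
    show "scalar (c + c') * z - (scalar c * z + scalar c' * z) \<in> J" for c c' z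
      using zero by (simp add: scalar_add distrib_right)
    show "scalar (c * c') * z - scalar c * (scalar c' * z) \<in> J" for c c' z
      using zero by (simp add: scalar_mult[symmetric] mult.assoc del: mult_single)
    show "scalar 1 * z - z \<in> J" for z using zero by simp
    show "letter u * (scalar c * z) - scalar c * (letter u * z) \<in> J" for u c z
    proof -
      have "letter u * (scalar c * z) = scalar c * (letter u * z)"
        by (metis mult.assoc scalar_commute)
      then show ?thesis using zero by simp
    qed
    show "letter u * z - scalar (g u) * z \<in> J" if t: "z \<in> mod_scalars J" "u \<in> P" for z u
    proof -
      obtain c where c: "z - scalar c \<in> J" using t by blast
      \<comment> \<open>The first summand is in \<open>J\<close> because \<open>z - scalar c\<close>
        is. The second corrects for the scalar, which has to be moved to the left of
        \<open>letter u - scalar (g u)\<close> as \<open>J\<close> is only a left ideal.\<close>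
      have "(letter u - scalar (g u)) * (z - scalar c) + scalar c * (letter u - scalar (g u)) \<in> J"
        by (intro add mult c char t)
      moreover have "(letter u - scalar (g u)) * (z - scalar c) + scalar c * (letter u - scalar (g u))
        = letter u * z - scalar (g u) * z"
        unfolding scalar_commute[of c] by (simp add: algebra_simps)
      ultimately show ?thesis by simp
    qed
    show "J \<subseteq> mod_scalars J" by (auto intro!: exI[of _ 0])
  qed (use ds add mult uminus I in \<open>auto simp: algebra_simps\<close>)
qed

lemma fil_word:
  assumes V: "\<And>c. scalar c \<in> V"
  shows "\<exists>n. fil (\<lambda>u z. letter u * z) V n (w :: 'a list \<Rightarrow>\<^sub>0 'k)"
proof (induction w rule: poly_mapping_single_induct)
  case zero
  then show ?case using V[of 0] by (auto intro: fil.base)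
next
  case (single w c)
  show ?case
  proof (induction w)
    case Nil
    then show ?case using V by (auto intro: fil.base)
  next
    case (Cons y w)
    then obtain k where "fil (\<lambda>u z. letter u * z) V k (Poly_Mapping.single w c)" by blast
    from fil.act[OF this, of y] show ?case unfolding single_Cons[of y w c] by blast
  qed
next
  case (add p q)
  then obtain k l where "fil (\<lambda>u z. letter u * z) V k p" "fil (\<lambda>u z. letter u * z) V l q" by blast
  then have "fil (\<lambda>u z. letter u * z) V (max k l) (p + q)"
    by (intro fil.add) (auto intro: fil_mono)
  then show ?case by blast
qed

text \<open>Degree 0 is the line of scalars modulo \<open>J\<close>. A larger left ideal therefore
  contains a nonzero scalar, and k is a field.\<close>

lemma left_ideal_maximal:
  assumes J: "left_ideal_over g J" and g: "nondegenerate g"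
    and M: "\<And>y z. y \<in> M \<Longrightarrow> z \<in> M \<Longrightarrow> y - z \<in> M" "\<And>a z. z \<in> M \<Longrightarrow> a * z \<in> M" "J \<subseteq> M"
    and z: "z \<in> M" "z \<notin> J"
  shows "1 \<in> M"
proof -
  obtain d p x where ds: "dual_system g d p x" by (rule dual_system_exists[OF g])
  interpret character_module scale bracket P "\<lambda>u z. letter u * z" "\<lambda>c z. scalar c * z" UNIV J
    "mod_scalars J" g d p x
    by (rule word_module[OF J ds])
  have "\<exists>k. fil (\<lambda>u z. letter u * z) (mod_scalars J) k z"
    by (rule fil_word) (metis (mono_tags, lifting) N_zero diff_self mem_Collect_eq)
  then obtain k where "fil (\<lambda>u z. letter u * z) (mod_scalars J) k z" by blast
  from submodule_meets_V[OF M(1) M(2) M(2) z this]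
  obtain v c where v: "v \<in> M" "v \<notin> J" "v - scalar c \<in> J" by blast
  have "c \<noteq> 0" using v by auto
  have "v - (v - scalar c) \<in> M" using v M by blast
  then have "scalar (1 / c) * scalar c \<in> M" using M(2) by simp
  then show ?thesis using \<open>c \<noteq> 0\<close> by (simp add: single_word_mult)
qed

lemma left_ideal_annihilated:
  assumes J: "left_ideal_over g J" and g: "nondegenerate g"
    and z: "\<And>u. u \<in> P \<Longrightarrow> (letter u - scalar (g u)) * z \<in> J"
  shows "\<exists>c. z - scalar c \<in> J"
proof -
  obtain d p x where ds: "dual_system g d p x" by (rule dual_system_exists[OF g])
  interpret character_module scale bracket P "\<lambda>u z. letter u * z" "\<lambda>c z. scalar c * z" UNIV J
    "mod_scalars J" g d p x
    by (rule word_module[OF J ds])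
  have "\<exists>k. fil (\<lambda>u z. letter u * z) (mod_scalars J) k z"
    by (rule fil_word) (metis (mono_tags, lifting) N_zero diff_self mem_Collect_eq)
  then obtain k where "fil (\<lambda>u z. letter u * z) (mod_scalars J) k z" by blast
  from annihilated_imp_V[OF this] z show ?thesis
    by (simp add: T_def left_diff_distrib)
qed

text \<open>The preimage in the free algebra of U(P) inside U(L).\<close>

definition words_over_P :: "('a list \<Rightarrow>\<^sub>0 'k) set" where
  "words_over_P = {w. \<exists>r. Poly_Mapping.keys r \<subseteq> lists P \<and> w - r \<in> I}"

end

locale framed_ideal = abelian_ideal scale bracket P + lie_frame scale bracket e co n m
  for scale :: "'k::field_char_0 \<Rightarrow> 'a::ab_group_add \<Rightarrow> 'a" and bracket P e co n m +
  assumes P_iff: "x \<in> P \<longleftrightarrow> (\<forall>i<m. co x i = 0)"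
    and tail_P: "m \<le> i \<Longrightarrow> i < n \<Longrightarrow> e i \<in> P"
begin

text \<open>The largest left ideal on which all coefficient functionals at \<open>g\<close> vanish; it contains the
  relations of the module induced from \<open>g\<close>.\<close>

definition annihilator :: "('a \<Rightarrow> 'k) \<Rightarrow> ('a list \<Rightarrow>\<^sub>0 'k) set" where
  "annihilator g = {w. \<forall>a \<gamma>. coefficient \<gamma> g (a * w) = 0}"

lemma left_ideal_annihilator:
  assumes "g \<in> dual scale"
  shows "left_ideal_over g (annihilator g)"
  unfolding left_ideal_over_def
proof (intro conjI ballI allI)
  show "I \<subseteq> annihilator g"
    by (auto simp: annihilator_def coefficient_I I_mult_left)
  show "letter p - scalar (g p) \<in> annihilator g" if "p \<in> P" for p
    using that coefficient_character[of g p] assms by (simp add: annihilator_def P_iff dual_def)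
qed (auto simp: annihilator_def distrib_left coefficient_add mult.assoc[symmetric])

text \<open>As \<open>w\<close> commutes with P, (p - g(p)) w = w (p - g(p)) up to relations, so the
  class of \<open>w\<close> in the quotient is killed by all p - g(p). It is therefore a multiple of
  the class of 1, whose coefficients at nonempty monomials are zero.\<close>

lemma commuting_coefficient:
  assumes g: "nondegenerate g" and w: "\<And>u. u \<in> P \<Longrightarrow> letter u * w - w * letter u \<in> I" and "\<gamma> \<noteq> []"
  shows "coefficient \<gamma> g w = 0"
proof -
  have gd: "g \<in> dual scale" using g by (simp add: nondegenerate_def)
  note J = left_ideal_annihilator[OF gd]
  have "(letter u - scalar (g u)) * w \<in> annihilator g" if u: "u \<in> P" for u
  proof -
    have "(letter u - scalar (g u)) * w = (letter u * w - w * letter u) + w * (letter u - scalar (g u))"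
      by (simp add: algebra_simps scalar_commute)
    also have "\<dots> \<in> annihilator g"
      using J w[OF u] u unfolding left_ideal_over_def by blast
    finally show ?thesis .
  qed
  from left_ideal_annihilated[OF J g this] obtain c where "w - scalar c \<in> annihilator g" by blast
  then have "coefficient \<gamma> g (1 * (w - scalar c)) = 0" unfolding annihilator_def by blast
  then have "coefficient \<gamma> g w = coefficient \<gamma> g (scalar c * 1)" by (simp add: coefficient_diff)
  then show ?thesis using assms(3) by (simp only: coefficient_scalar coefficient_one) simp
qed

lemma inj_e: "inj_on e {..<n}"
proof (rule inj_onI)
  fix i j assume ij: "i \<in> {..<n}" "j \<in> {..<n}" "e i = e j"
  have "co (e i) j = 1" using co_e[of j j] ij by simp
  then show "i = j" using co_e[of i j] ij by (simp split: if_splits)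
qed

lemma inj_map_e: "inj_on (map e) {w. set w \<subseteq> {..<n}}"
  by (rule inj_onI) (auto intro: map_inj_on inj_on_subset[OF inj_e])

lemma sorted_split: "sorted w \<Longrightarrow> w = filter (\<lambda>i. i < m) w @ filter (\<lambda>i. m \<le> i) w" for w :: "nat list"
proof (induction w)
  case (Cons i w)
  show ?case
  proof (cases "i < m")
    case True
    then show ?thesis using Cons by simp
  next
    case False
    then have "\<forall>j\<in>set w. m \<le> j" using Cons.prems by auto
    then show ?thesis using False by (auto simp: filter_empty_conv filter_id_conv)
  qed
qed simp

lemma centralizer:
  assumes f: "nondegenerate f" and w: "\<And>u. u \<in> P \<Longrightarrow> letter u * w - w * letter u \<in> I"
  shows "w \<in> words_over_P"
proof -
  have fd: "f \<in> dual scale" using f by (simp add: nondegenerate_def)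
  obtain r where r: "Poly_Mapping.keys r \<subseteq> map e ` {w. sorted w \<and> set w \<subseteq> {..<n}}" "w - r \<in> I"
    using sorted_words_span by blast
  define W where "W = {u. sorted u \<and> set u \<subseteq> {..<n} \<and> map e u \<in> Poly_Mapping.keys r}"
  have injW: "inj_on (map e) W" by (rule inj_on_subset[OF inj_map_e]) (auto simp: W_def)
  have imW: "map e ` W = Poly_Mapping.keys r" using r(1) by (auto simp: W_def)
  have finW: "finite W" using imW injW by (metis finite_imageD finite_keys)
  define a where "a u = Poly_Mapping.lookup r (map e u)" for u
  have coeff: "coefficient \<gamma> g w = (\<Sum>u\<in>W. a u * tail_character \<gamma> g u)" for \<gamma> g
  proof -
    have "coefficient \<gamma> g w = coefficient \<gamma> g r"
      using coefficient_I[OF r(2)] by (simp add: coefficient_diff)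
    also have "\<dots> = (\<Sum>v\<in>Poly_Mapping.keys r. Poly_Mapping.lookup r v * ext v (straighten (tail_character \<gamma> g)))"
      by (simp add: coefficient_def functional_def lin_ext_def)
    also have "\<dots> = (\<Sum>u\<in>W. a u * tail_character \<gamma> g u)"
      unfolding imW[symmetric] sum.reindex[OF injW] comp_def a_def
      by (intro sum.cong refl) (auto simp: W_def ext_map_e straighten_sorted)
    finally show ?thesis .
  qed
  have "a u = 0" if u: "u \<in> W" "filter (\<lambda>i. i < m) u \<noteq> []" for u
  proof -
    define \<gamma> where "\<gamma> = filter (\<lambda>i. i < m) u"
    define tl where "tl v = filter (\<lambda>i. m \<le> i) v" for v :: "nat list"
    define W' where "W' = {v\<in>W. filter (\<lambda>i. i < m) v = \<gamma>}"
    have W': "finite W'" "W' \<subseteq> W" using finW by (auto simp: W'_def)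
    have coeff': "coefficient \<gamma> g w = (\<Sum>v\<in>W'. a v * prod_list (map (g \<circ> e) (tl v)))" for g
      unfolding coeff W'_def tail_character_def tl_def
      by (simp add: sum.inter_filter[OF finW] if_distrib[of "\<lambda>c. _ * c"] cong: if_cong)
    \<comment> \<open>On the line f + t g the coefficient is a polynomial in t. It vanishes for all
      but finitely many t, hence identically, and t = 1 reaches f + g although this functional may
      be degenerate.\<close>
    have zero: "(\<Sum>v\<in>W'. a v * prod_list (map ((\<lambda>y. f y + g y) \<circ> e) (tl v))) = 0" if g: "g \<in> dual scale" for g
    proof -
      define q where "q = (\<Sum>v\<in>W'. Polynomial.smult (a v) (prod_list (map (\<lambda>i. [:f (e i), g (e i):]) (tl v))))"
      have pq: "poly q t = (\<Sum>v\<in>W'. a v * prod_list (map ((\<lambda>y. f y + t * g y) \<circ> e) (tl v)))" for t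
      proof -
        have "poly (prod_list (map (\<lambda>i. [:f (e i), g (e i):]) v)) t = prod_list (map ((\<lambda>y. f y + t * g y) \<circ> e) v)" for v
          by (induction v) (auto simp: algebra_simps)
        then show ?thesis by (simp add: q_def poly_sum)
      qed
      have "poly q t = 0" if "nondegenerate (\<lambda>y. f y + t * g y)" for t
        unfolding pq coeff'[symmetric] using u(2) by (intro commuting_coefficient[OF that w]) (simp_all add: \<gamma>_def)
      then have "UNIV \<subseteq> {t. \<not> nondegenerate (\<lambda>y. f y + t * g y)} \<union> {t. poly q t = 0}"
        by auto
      then have "infinite {t. poly q t = 0}"
        using nondegenerate_line[OF f g] infinite_UNIV_char_0[where 'a='k] by (meson finite_UnI finite_subset)
      then have "q = 0" using poly_roots_finite by blast
      then show ?thesis using pq[of 1] by simp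
    qed
    have all: "(\<Sum>v\<in>W'. a v * prod_list (map h (tl v))) = 0" for h :: "nat \<Rightarrow> 'k"
    proof -
      \<comment> \<open>Chosen so that f + g takes the prescribed values \<open>h\<close> on the
        basis; the coefficient thus vanishes as a function of arbitrary values.\<close>
      define g where "g y = (\<Sum>i<n. co y i * h i) - f y" for y
      have gd: "g \<in> dual scale"
        unfolding dual_def mem_Collect_eq using linear_dual[OF fd]
        by unfold_locales (auto simp: g_def co_add co_scale algebra_simps sum.distrib sum_distrib_left)
      have "f (e i) + g (e i) = h i" if "i < n" for i
        using that by (simp add: g_def co_e if_distrib[of "\<lambda>c. c * _"] cong: if_cong)
      then have "map ((\<lambda>y. f y + g y) \<circ> e) (tl v) = map h (tl v)" if "v \<in> W'" for v
        using that W'(2) by (auto simp: W_def tl_def)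
      then have "(\<Sum>v\<in>W'. a v * prod_list (map h (tl v))) = (\<Sum>v\<in>W'. a v * prod_list (map ((\<lambda>y. f y + g y) \<circ> e) (tl v)))"
        by (intro sum.cong refl) (simp only:)
      then show ?thesis using zero[OF gd] by (simp only:)
    qed
    \<comment> \<open>Words with the same part \<open>\<gamma>\<close> outside P are told apart by
      their tails, so independence of the tail monomials kills each coefficient separately.\<close>
    have split: "v = \<gamma> @ tl v" if "v \<in> W'" for v
      using sorted_split[of v] that by (simp add: W'_def W_def tl_def)
    have inj: "inj_on tl W'" by (rule inj_onI) (metis split)
    have "\<forall>v'\<in>tl ` W'. a (\<gamma> @ v') = 0"
    proof (rule words_independent)
      show "sorted v'" if "v' \<in> tl ` W'" for v'
        using that by (auto simp: tl_def W'_def W_def sorted_wrt_filter)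
      show "(\<Sum>v'\<in>tl ` W'. a (\<gamma> @ v') * prod_list (map h v')) = 0" for h
        using all[of h] split by (simp add: sum.reindex[OF inj] flip: split)
    qed (use W' in auto)
    moreover have "u \<in> W'" using u by (simp add: W'_def \<gamma>_def)
    ultimately show ?thesis using split by (metis imageI)
  qed
  then have "filter (\<lambda>i. i < m) u = []" if "u \<in> W" for u
    using that by (auto simp: a_def W_def in_keys_iff)
  then have "Poly_Mapping.keys r \<subseteq> lists P"
    unfolding imW[symmetric] using tail_P by (auto simp: W_def filter_empty_conv not_less subset_eq)
  then show ?thesis using r(2) by (auto simp: words_over_P_def)
qed

end

section \<open>The filtration of U(L) by degree over U(P)\<close>

context abelian_ideal
begin

lemma framed:
  obtains e co n m where "framed_ideal scale bracket P e co n m"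
proof -
  obtain e co n m where fr: "lie_frame scale bracket e co n m" "\<And>x. x \<in> P \<longleftrightarrow> (\<forall>i<m. co x i = 0)"
    "\<And>i. m \<le> i \<Longrightarrow> i < n \<Longrightarrow> e i \<in> P" using frame_exists by blast
  interpret F: lie_frame scale bracket e co n m by (rule fr(1))
  have "framed_ideal scale bracket P e co n m"
    by unfold_locales (use fr in auto)
  then show ?thesis by (rule that)
qed

lemma commuting_words_over_P:
  assumes "nondegenerate f" "\<And>u. u \<in> P \<Longrightarrow> letter u * w - w * letter u \<in> I"
  shows "w \<in> words_over_P"
proof -
  obtain e co n m where "framed_ideal scale bracket P e co n m" by (rule framed)
  then interpret F: framed_ideal scale bracket P e co n m .
  show ?thesis using assms by (rule F.centralizer)
qed

text \<open>The coefficient of the empty monomial, freed from the frame. Its value 1 at 1 is what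
  keeps the induced module and its base change from collapsing to zero.\<close>

lemma character_functional:
  assumes "f \<in> dual scale"
  obtains \<tau> :: "('a list \<Rightarrow>\<^sub>0 'k) \<Rightarrow> 'k" where "\<And>p q. \<tau> (p + q) = \<tau> p + \<tau> q" "\<And>c p. \<tau> (scalar c * p) = c * \<tau> p"
    "\<And>p. p \<in> I \<Longrightarrow> \<tau> p = 0" "\<And>q u. u \<in> P \<Longrightarrow> \<tau> (q * (letter u - scalar (f u))) = 0" "\<tau> 1 = 1"
proof -
  obtain e co n m where "framed_ideal scale bracket P e co n m" by (rule framed)
  then interpret F: framed_ideal scale bracket P e co n m .
  show ?thesis
  proof (rule that[of "F.coefficient [] f"])
    show "F.coefficient [] f (q * (letter u - scalar (f u))) = 0" if "u \<in> P" for q u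
      using F.coefficient_character[of f u] assms that by (simp add: F.P_iff dual_def)
  qed (auto simp: F.coefficient_add F.coefficient_scalar F.coefficient_I F.coefficient_one)
qed

lemma words_over_P_I: "p \<in> I \<Longrightarrow> p \<in> words_over_P"
  unfolding words_over_P_def by (intro CollectI exI[of _ 0]) simp

lemma words_over_P_scalar: "scalar c \<in> words_over_P"
  unfolding words_over_P_def by (intro CollectI exI[of _ "scalar c"]) simp

lemma words_over_P_add: "p \<in> words_over_P \<Longrightarrow> q \<in> words_over_P \<Longrightarrow> p + q \<in> words_over_P"
proof -
  assume "p \<in> words_over_P" "q \<in> words_over_P"
  then obtain r r' where r: "Poly_Mapping.keys r \<subseteq> lists P" "p - r \<in> I" "Poly_Mapping.keys r' \<subseteq> lists P" "q - r' \<in> I"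
    unfolding words_over_P_def by blast
  have "p + q - (r + r') \<in> I" using I_add[OF r(2,4)] by (simp add: algebra_simps)
  moreover have "Poly_Mapping.keys (r + r') \<subseteq> lists P"
    using keys_add[of r r'] r by blast
  ultimately show ?thesis unfolding words_over_P_def by blast
qed

lemma words_over_P_mult: "p \<in> words_over_P \<Longrightarrow> q \<in> words_over_P \<Longrightarrow> p * q \<in> words_over_P"
proof -
  assume "p \<in> words_over_P" "q \<in> words_over_P"
  then obtain r r' where r: "Poly_Mapping.keys r \<subseteq> lists P" "p - r \<in> I" "Poly_Mapping.keys r' \<subseteq> lists P" "q - r' \<in> I"
    unfolding words_over_P_def by blast
  have "p * q - r * r' = (p - r) * q + r * (q - r')" by (simp add: algebra_simps)
  also have "\<dots> \<in> I" by (intro I_add I_mult_left I_mult_right r)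
  finally show ?thesis using keys_mult_lists[OF r(1,3)] unfolding words_over_P_def by blast
qed

lemma words_over_P_letter: "u \<in> P \<Longrightarrow> letter u \<in> words_over_P"
  unfolding words_over_P_def by (intro CollectI exI[of _ "letter u"]) simp

lemma letters_commute: "u \<in> P \<Longrightarrow> v \<in> P \<Longrightarrow> letter u * letter v - letter v * letter u \<in> I"
  using I_add[OF letter_bracket[of u v] letter_zero] abelian_P by simp

lemma commute_mult:
  assumes "a * p - p * a \<in> I" "a * q - q * a \<in> I"
  shows "a * (p * q) - (p * q) * a \<in> I"
proof -
  have "a * (p * q) - (p * q) * a = (a * p - p * a) * q + p * (a * q - q * a)"
    by (simp add: algebra_simps)
  also have "\<dots> \<in> I" by (intro I_add I_mult_left I_mult_right assms)
  finally show ?thesis .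
qed

lemma words_over_P_commute_letter:
  assumes u: "u \<in> P" and q: "q \<in> words_over_P"
  shows "letter u * q - q * letter u \<in> I"
proof -
  obtain r where r: "Poly_Mapping.keys r \<subseteq> lists P" "q - r \<in> I" using q unfolding words_over_P_def by blast
  have "letter u * r - r * letter u \<in> I"
    using r(1)
  proof (induction rule: keys_subset_single_induct)
    case (single w c)
    then show ?case
    proof (induction w)
      case Nil
      show ?case using scalar_commute[of c "letter u"] by (metis I_zero diff_self)
    next
      case (Cons v w)
      then show ?case
        unfolding single_Cons[of v w c] by (intro commute_mult letters_commute u) auto
    qed
  next
    case (add p q)
    then show ?case using I_add[of "letter u * p - p * letter u" "letter u * q - q * letter u"]
      by (simp add: algebra_simps)
  qed simp
  moreover have "letter u * q - q * letter u =
      (letter u * r - r * letter u) + letter u * (q - r) - (q - r) * letter u"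
    by (simp add: algebra_simps)
  ultimately show ?thesis by (simp only: I_add I_diff I_mult_left I_mult_right r(2))
qed

lemma words_over_P_commute:
  assumes p: "p \<in> words_over_P" and q: "q \<in> words_over_P"
  shows "p * q - q * p \<in> I"
proof -
  obtain r where r: "Poly_Mapping.keys r \<subseteq> lists P" "p - r \<in> I" using p unfolding words_over_P_def by blast
  have "q * r - r * q \<in> I"
    using r(1)
  proof (induction rule: keys_subset_single_induct)
    case (single w c)
    then show ?case
    proof (induction w)
      case Nil
      show ?case using scalar_commute[of c q] by (metis I_zero diff_self)
    next
      case (Cons v w)
      have "q * letter v - letter v * q \<in> I"
      proof -
        have "v \<in> P" using Cons by blast
        from I_uminus[OF words_over_P_commute_letter[OF this q]] show ?thesis by simp
      qed
      then show ?case
        unfolding single_Cons[of v w c] using Cons by (intro commute_mult) auto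
    qed
  next
    case (add p p')
    then show ?case using I_add[of "q * p - p * q" "q * p' - p' * q"]
      by (simp add: algebra_simps)
  qed simp
  moreover have "p * q - q * p = (p - r) * q - q * (p - r) - (q * r - r * q)"
    by (simp add: algebra_simps)
  ultimately show ?thesis by (simp only: I_add I_diff I_mult_left I_mult_right r(2))
qed

abbreviation U_fil where "U_fil \<equiv> fil (\<lambda>u z. letter u * z) words_over_P"

lemma U_fil_I: "z \<in> I \<Longrightarrow> U_fil k z"
  by (intro fil.base words_over_P_I)

lemma U_fil_cong: "U_fil k y \<Longrightarrow> z - y \<in> I \<Longrightarrow> U_fil k z"
  using fil.add[OF _ U_fil_I, of k y "z - y"] by simp

lemma U_fil_scalar: "U_fil k z \<Longrightarrow> U_fil k (scalar c * z)"
proof (induction rule: fil.induct)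
  case (act k z y)
  have "scalar c * (letter y * z) = letter y * (scalar c * z)" by (metis mult.assoc scalar_commute)
  then show ?case using fil.act[OF act.IH, of y] by (simp only:)
qed (auto intro: fil.base fil.add words_over_P_mult words_over_P_scalar simp: distrib_left)

text \<open>Moving \<open>u\<close> to the right past a letter \<open>y\<close> leaves [u, y], which
  is again in P, so left multiplication by P never raises the degree.\<close>

lemma U_fil_P: "U_fil k z \<Longrightarrow> u \<in> P \<Longrightarrow> U_fil k (letter u * z)"
proof (induction arbitrary: u rule: fil.induct)
  case (act k z y)
  have "U_fil (Suc k) (letter y * (letter u * z) + letter (bracket u y) * z)"
    using fil.act[OF act.IH[OF act.prems], of y] fil_Suc[OF act.IH[OF ideal_P'[OF act.prems]]] by (rule fil.add)
  moreover have "letter u * (letter y * z) - (letter y * (letter u * z) + letter (bracket u y) * z) \<in> I"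
    using I_mult_right[OF letter_bracket[of u y], of z] by (simp add: algebra_simps)
  ultimately show ?case by (rule U_fil_cong)
qed (auto intro: fil.base fil.add words_over_P_mult words_over_P_letter simp: distrib_left)

text \<open>ad u is a derivation that turns the letter \<open>y\<close> into an element of P, which
  no longer counts for the degree; on U(P) it vanishes, as P is commutative.\<close>

lemma U_fil_commutator:
  "U_fil k z \<Longrightarrow> u \<in> P \<Longrightarrow> (if k = 0 then letter u * z - z * letter u \<in> I else U_fil (k - 1) (letter u * z - z * letter u))"
proof (induction rule: fil.induct)
  case (base v k)
  then show ?case using words_over_P_commute_letter by (auto intro: U_fil_I)
next
  case (add k y z)
  have "letter u * (y + z) - (y + z) * letter u = (letter u * y - y * letter u) + (letter u * z - z * letter u)"
    by (simp add: algebra_simps)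
  then show ?case using add by (auto simp del: mult_single intro: I_add fil.add split: if_splits)
next
  case (act k z y)
  let ?D = "letter u * z - z * letter u"
  have 1: "U_fil k (letter (bracket u y) * z)"
    using act.hyps ideal_P'[OF act.prems] by (rule U_fil_P)
  have 2: "U_fil k (letter y * ?D)"
  proof (cases k)
    case 0
    then show ?thesis using act by (auto intro: U_fil_I I_mult_left)
  next
    case (Suc l)
    then show ?thesis using act fil.act[of "\<lambda>u z. letter u * z" words_over_P l ?D y] by simp
  qed
  have "letter u * (letter y * z) - (letter y * z) * letter u - (letter (bracket u y) * z + letter y * ?D)
      = (letter u * letter y - letter y * letter u - letter (bracket u y)) * z"
    by (simp add: algebra_simps)
  also have "\<dots> \<in> I" by (intro I_mult_right letter_bracket)
  finally show ?case using U_fil_cong[OF fil.add[OF 1 2]] by simp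
qed

lemma U_fil_exists: "\<exists>k. U_fil k z"
  by (intro fil_word words_over_P_scalar)

text \<open>ad u lowers the degree, so it acts locally nilpotently on U(L) and has no eigenvector
  with nonzero eigenvalue.\<close>

lemma weight_zero:
  assumes u: "u \<in> P" and w: "letter u * w - w * letter u - scalar c * w \<in> I" and "c \<noteq> 0"
  shows "w \<in> I"
proof -
  have inv: "scalar (1 / c) * (scalar c * w) = w"
    using \<open>c \<noteq> 0\<close> by (simp add: mult.assoc[symmetric] single_word_mult)
  have "w \<in> I" if "U_fil k w" for k
    using that
  proof (induction k)
    case 0
    then have "letter u * w - w * letter u \<in> I" using U_fil_commutator[OF _ u, of 0 w] by simp
    from I_diff[OF this w] have "scalar c * w \<in> I" by simp
    from I_mult_left[OF this, of "scalar (1 / c)"] show ?case by (simp only: inv)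
  next
    case (Suc k)
    then have "U_fil k (letter u * w - w * letter u)" using U_fil_commutator[OF _ u, of "Suc k" w] by simp
    then have "U_fil k (scalar c * w)"
      by (rule U_fil_cong) (use I_uminus[OF w] in simp)
    from U_fil_scalar[OF this, of "1 / c"] have "U_fil k w" by (simp only: inv)
    then show ?case by (rule Suc.IH)
  qed
  then show ?thesis using U_fil_exists by blast
qed

lemma semi_invariant_words_over_P:
  assumes f: "nondegenerate f"
    and w: "\<And>u. u \<in> P \<Longrightarrow> letter u * w - w * letter u - scalar (\<mu> u) * w \<in> I"
  shows "w \<in> words_over_P"
proof (cases "w \<in> I")
  case False
  then have "\<mu> u = 0" if "u \<in> P" for u using weight_zero[OF that w[OF that]] by blast
  then show ?thesis using w by (intro commuting_words_over_P[OF f]) fastforce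
qed (rule words_over_P_I)

text \<open>Taking commutators with P stays in \<open>K\<close> and lowers the degree. The last
  nonzero element obtained commutes with P, and the centralizer of P is U(P).\<close>

lemma ad_closed_meets_words_over_P:
  assumes f: "nondegenerate f"
    and K: "\<And>u z. u \<in> P \<Longrightarrow> z \<in> K \<Longrightarrow> letter u * z - z * letter u \<in> K"
    and z: "z \<in> K" "z \<notin> I"
  shows "\<exists>v\<in>K \<inter> words_over_P. v \<notin> I"
proof -
  obtain k where "U_fil k z" using U_fil_exists by blast
  then show ?thesis using z
  proof (induction k arbitrary: z rule: less_induct)
    case (less k)
    show ?case
    proof (cases "\<forall>u\<in>P. letter u * z - z * letter u \<in> I")
      case True
      then show ?thesis using commuting_words_over_P[OF f] less.prems by blast
    next
      case False
      then obtain u where u: "u \<in> P" "letter u * z - z * letter u \<notin> I" by blast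
      with U_fil_commutator[OF less.prems(1) u(1)] have "k > 0" "U_fil (k - 1) (letter u * z - z * letter u)"
        by (auto split: if_splits)
      then show ?thesis using less.IH[of "k - 1"] u K less.prems by auto
    qed
  qed
qed

end

section \<open>Semi-centers\<close>

lemma word_coset:
  "J +>\<^bsub>word_algebra S\<^esub> w = {i + w | i. i \<in> (J :: ('a list \<Rightarrow>\<^sub>0 'k::field_char_0) set)}"
  by (auto simp: a_r_coset_def r_coset_def word_algebra_simps)

lemma word_coset_mem: "v \<in> J +>\<^bsub>word_algebra S\<^esub> w \<longleftrightarrow> v - w \<in> (J :: ('a list \<Rightarrow>\<^sub>0 'k::field_char_0) set)"
  unfolding word_coset by (auto simp: algebra_simps intro: exI[of _ "v - w"])

context lie_algebra
begin

abbreviation U where "U \<equiv> env scale bracket UNIV"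

definition cls :: "('a list \<Rightarrow>\<^sub>0 'k) \<Rightarrow> ('a list \<Rightarrow>\<^sub>0 'k) set" where
  "cls w = I +>\<^bsub>word_algebra UNIV\<^esub> w"

lemma cls_mem: "v \<in> cls w \<longleftrightarrow> v - w \<in> I"
  by (simp add: cls_def word_coset_mem)

lemma cls_eq: "cls v = cls w \<longleftrightarrow> v - w \<in> I"
proof
  assume "cls v = cls w"
  then have "v \<in> cls w" using cls_mem[of v v] by simp
  then show "v - w \<in> I" by (simp add: cls_mem)
next
  assume vw: "v - w \<in> I"
  show "cls v = cls w"
  proof (rule Set.set_eqI)
    fix z
    show "z \<in> cls v \<longleftrightarrow> z \<in> cls w"
      using I_add[of "z - v" "v - w"] I_diff[of "z - w" "v - w"] vw by (auto simp: cls_mem)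
  qed
qed

lemma ring_U: "ring U"
  unfolding env_def by (rule ideal.quotient_is_ring[OF ideal_I])

lemma carrier_U: "carrier U = range cls"
  by (auto simp: env_def FactRing_def A_RCOSETS_def RCOSETS_def a_r_coset_def cls_def word_algebra_simps)

lemma cls_carrier [simp]: "cls w \<in> carrier U"
  by (simp add: carrier_U)

lemma zero_U: "\<zero>\<^bsub>U\<^esub> = cls 0"
proof -
  have "cls 0 = I" by (auto simp: cls_mem)
  then show ?thesis by (simp add: env_def FactRing_def)
qed

lemma one_U: "\<one>\<^bsub>U\<^esub> = cls 1"
  by (simp add: env_def FactRing_def cls_def word_algebra_simps)

lemma mult_U: "cls v \<otimes>\<^bsub>U\<^esub> cls w = cls (v * w)"
  using ideal.rcoset_mult_add[OF ideal_I, of v w]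
  by (simp add: env_def FactRing_def cls_def word_algebra_simps)

lemma add_U: "cls v \<oplus>\<^bsub>U\<^esub> cls w = cls (v + w)"
  using abelian_subgroup.a_rcos_sum[OF abelian_subgroupI3[OF ideal.axioms(1)[OF ideal_I] ring.is_abelian_group[OF ring_word_algebra]], of v w]
  by (simp add: env_def FactRing_def cls_def word_algebra_simps)

lemma uminus_U: "\<ominus>\<^bsub>U\<^esub> cls w = cls (- w)"
proof -
  interpret R: ring U by (rule ring_U)
  show ?thesis by (rule R.minus_equality) (simp_all add: add_U zero_U)
qed

lemma minus_U: "cls v \<ominus>\<^bsub>U\<^esub> cls w = cls (v - w)"
  by (simp add: a_minus_def uminus_U add_U)

lemma env_gen_cls: "env_gen scale bracket x = cls (letter x)"
  by (simp add: env_gen_def cls_def)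

lemma env_scalar_cls: "env_scalar scale bracket c = cls (scalar c)"
  by (simp add: env_scalar_def cls_def)

end

context abelian_ideal
begin

lemma carrier_relations: "env_relations scale bracket P \<subseteq> carrier (word_algebra P)"
  using subspace_P ideal_P by (intro env_relations_carrier) (auto simp: subspace_def)

lemma env_ideal_P_subset: "env_ideal scale bracket P \<subseteq> I \<inter> carrier (word_algebra P)"
proof (rule env_ideal_least)
  have "env_relations scale bracket P \<subseteq> env_relations scale bracket UNIV"
    by (auto simp: env_relations_def)
  then show "env_relations scale bracket P \<subseteq> I \<inter> carrier (word_algebra P)"
    using I_relations carrier_relations by blast
  show "p + q \<in> I \<inter> carrier (word_algebra P)" if "p \<in> I \<inter> carrier (word_algebra P)" "q \<in> I \<inter> carrier (word_algebra P)" for p q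
    using that keys_add[of p q] by (auto simp: word_algebra_simps intro: I_add)
  show "q * p \<in> I \<inter> carrier (word_algebra P) \<and> p * q \<in> I \<inter> carrier (word_algebra P)"
    if "p \<in> I \<inter> carrier (word_algebra P)" "q \<in> carrier (word_algebra P)" for p q
    using that keys_mult_lists[of p P q] keys_mult_lists[of q P p]
    by (simp add: word_algebra_simps I_mult_left I_mult_right)
qed (auto simp: word_algebra_simps I_uminus)

lemma ideal_env_P: "ideal (env_ideal scale bracket P) (word_algebra P)"
  by (rule env_ideal_ideal[OF carrier_relations])

definition cls_P :: "('a list \<Rightarrow>\<^sub>0 'k) \<Rightarrow> ('a list \<Rightarrow>\<^sub>0 'k) set" where
  "cls_P w = env_ideal scale bracket P +>\<^bsub>word_algebra P\<^esub> w"

lemma carrier_env_P: "carrier (env scale bracket P) =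
    cls_P ` {w. Poly_Mapping.keys w \<subseteq> lists P}"
  by (auto simp: env_def FactRing_def A_RCOSETS_def RCOSETS_def a_r_coset_def cls_P_def word_algebra_simps)

lemma zero_env_ideal_P: "0 \<in> env_ideal scale bracket P"
  using additive_subgroup.zero_closed[OF ideal.axioms(1)[OF ideal_env_P]] by (simp add: word_algebra_simps)

lemma env_incl_cls:
  "env_incl scale bracket (cls_P w) = cls w"
proof -
  have "env_incl scale bracket (cls_P w)
      = {i + (i' + w) | i i'. i \<in> I \<and> i' \<in> env_ideal scale bracket P}"
    by (auto simp: env_incl_def cls_P_def set_add_def set_mult_def word_coset word_algebra_simps)
  also have "\<dots> = cls w"
  proof
    show "{i + (i' + w) | i i'. i \<in> I \<and> i' \<in> env_ideal scale bracket P} \<subseteq> cls w"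
      using env_ideal_P_subset by (auto simp: cls_mem add.assoc[symmetric] intro!: I_add)
    show "cls w \<subseteq> {i + (i' + w) | i i'. i \<in> I \<and> i' \<in> env_ideal scale bracket P}"
    proof
      fix z assume "z \<in> cls w"
      then have "z = (z - w) + (0 + w)" "z - w \<in> I" by (auto simp: cls_mem)
      then show "z \<in> {i + (i' + w) | i i'. i \<in> I \<and> i' \<in> env_ideal scale bracket P}"
        using zero_env_ideal_P by blast
    qed
  qed
  finally show ?thesis .
qed

lemma env_sub_cls: "env_sub scale bracket P = cls ` words_over_P"
proof -
  have "env_sub scale bracket P = cls ` {w. Poly_Mapping.keys w \<subseteq> lists P}"
    by (simp add: env_sub_def carrier_env_P image_image env_incl_cls)
  also have "\<dots> = cls ` words_over_P"
  proof
    show "cls ` {w. Poly_Mapping.keys w \<subseteq> lists P} \<subseteq> cls ` words_over_P"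
      by (intro image_mono) (auto simp: words_over_P_def intro!: exI)
    show "cls ` words_over_P \<subseteq> cls ` {w. Poly_Mapping.keys w \<subseteq> lists P}"
      using cls_eq by (auto simp: words_over_P_def)
  qed
  finally show ?thesis .
qed

lemma words_over_P_uminus: "w \<in> words_over_P \<Longrightarrow> - w \<in> words_over_P"
  using words_over_P_mult[OF words_over_P_scalar[of "- 1"], of w] by (simp add: single_uminus)

lemma subgroup_env_sub: "subgroup (env_sub scale bracket P) (add_monoid U)"
proof -
  interpret R: ring U by (rule ring_U)
  have "\<ominus>\<^bsub>U\<^esub> z \<in> env_sub scale bracket P" if "z \<in> env_sub scale bracket P" for z
    using that by (auto simp: env_sub_cls uminus_U intro: words_over_P_uminus)
  moreover have "y \<oplus>\<^bsub>U\<^esub> z \<in> env_sub scale bracket P" if "y \<in> env_sub scale bracket P" "z \<in> env_sub scale bracket P" for y z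
    using that by (auto simp: env_sub_cls add_U intro: words_over_P_add)
  ultimately show ?thesis
    using words_over_P_I[OF I_zero]
    by (intro R.add.subgroupI) (auto simp: env_sub_cls)
qed

lemma weight_space_U:
  assumes "z \<in> weight_space U (env_gen scale bracket) (env_scalar scale bracket) \<mu>"
  obtains w where "z = cls w" "\<And>x. letter x * w - w * letter x - scalar (\<mu> x) * w \<in> I"
proof -
  obtain w where w: "z = cls w" using assms by (auto simp: weight_space_def carrier_U)
  have "cls (letter x * w - w * letter x) = cls (scalar (\<mu> x) * w)" for x
    using assms by (simp add: weight_space_def w env_gen_cls env_scalar_cls mult_U minus_U del: mult_single)
  then show ?thesis by (intro that[OF w]) (simp only: cls_eq)
qed

lemma semicenter_U_subset:
  assumes "nondegenerate f"
  shows "semicenter scale U (env_gen scale bracket) (env_scalar scale bracket) \<subseteq> env_sub scale bracket P"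
proof -
  interpret R: ring U by (rule ring_U)
  have "weight_space U (env_gen scale bracket) (env_scalar scale bracket) \<mu> \<subseteq> env_sub scale bracket P" for \<mu>
  proof
    fix z assume "z \<in> weight_space U (env_gen scale bracket) (env_scalar scale bracket) \<mu>"
    then obtain w where "z = cls w" "\<And>x. letter x * w - w * letter x - scalar (\<mu> x) * w \<in> I"
      using weight_space_U by blast
    then show "z \<in> env_sub scale bracket P"
      using semi_invariant_words_over_P[OF assms, of w \<mu>] by (auto simp: env_sub_cls)
  qed
  then show ?thesis
    unfolding semicenter_def by (intro R.add.generate_subgroup_incl subgroup_env_sub) blast
qed

lemma P_subset_weights_kernel: "P \<subseteq> weights_kernel scale bracket"
proof (clarsimp simp: weights_kernel_def)
  fix u \<mu> assume u: "u \<in> P" and \<mu>: "\<mu> \<in> env_weights scale bracket"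
  interpret R: ring U by (rule ring_U)
  let ?W = "weight_space U (env_gen scale bracket) (env_scalar scale bracket) \<mu>"
  have "?W \<noteq> {\<zero>\<^bsub>U\<^esub>}" using \<mu> by (simp add: env_weights_def)
  moreover have "\<zero>\<^bsub>U\<^esub> \<in> ?W"
    by (simp add: weight_space_def env_gen_cls env_scalar_cls)
  ultimately obtain z where z: "z \<in> ?W" "z \<noteq> \<zero>\<^bsub>U\<^esub>" by blast
  from z(1) obtain w where w: "z = cls w" "\<And>x. letter x * w - w * letter x - scalar (\<mu> x) * w \<in> I"
    using weight_space_U by blast
  have "w \<notin> I" using z(2) by (auto simp: w(1) zero_U cls_eq)
  then show "\<mu> u = 0" using weight_zero[OF u w(2)] by blast
qed

lemma semicenter_D_subset:
  fixes D :: "'d ring" (structure)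
  assumes f: "nondegenerate f" and D: "quotient_division_ring U D j"
  shows "semicenter scale D (j \<circ> env_gen scale bracket) (j \<circ> env_scalar scale bracket)
    \<subseteq> fractions_of U D j (env_sub scale bracket P)"
proof -
  let ?F = "fractions_of U D j (env_sub scale bracket P)"
  interpret R: ring U by (rule ring_U)
  interpret D: ring D using D by (simp add: quotient_division_ring_def)
  have j: "j \<in> ring_hom U D" and inj: "inj_on j (carrier U)" and units: "Units D = carrier D - {\<zero>}"
    and frac: "\<And>z. z \<in> carrier D \<Longrightarrow> \<exists>u\<in>carrier U. \<exists>v\<in>carrier U - {\<zero>\<^bsub>U\<^esub>}. z = j u \<otimes> inv\<^bsub>D\<^esub> (j v)"
    using D by (auto simp: quotient_division_ring_def)
  interpret j: ring_hom_ring U D j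
    by (rule ring_hom_ringI2[OF ring_U D.ring_axioms j])
  define J where "J w = j (cls w)" for w
  have JC [simp]: "J w \<in> carrier D" for w by (simp add: J_def)
  have J_eq: "J v = J w \<longleftrightarrow> v - w \<in> I" for v w
    unfolding J_def using inj_on_eq_iff[OF inj, of "cls v" "cls w"] by (simp add: cls_eq)
  have J_add: "J v \<oplus> J w = J (v + w)" and J_mult: "J v \<otimes> J w = J (v * w)" for v w
    by (simp_all add: J_def flip: add_U mult_U)
  have J_minus: "J v \<ominus> J w = J (v - w)" for v w
    by (simp add: J_def D.minus_eq flip: minus_U) (simp add: R.minus_eq)
  have J_zero: "J 0 = \<zero>" by (simp add: J_def flip: zero_U)
  have J_unit: "J w \<in> Units D \<longleftrightarrow> w \<notin> I" for w
    using J_eq[of w 0] by (simp add: units J_zero)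
  \<comment> \<open>It is more convenient to work with equations
    \<open>z \<otimes> J v = J w\<close> than with fractions; this and \<open>fractionsD\<close>
    translate between the two.\<close>
  have quot: "z = a \<otimes> inv\<^bsub>D\<^esub> c" if "z \<in> carrier D" "c \<in> Units D" "z \<otimes> c = a" for z a c
    using that D.Units_inv_closed D.Units_r_inv by (metis D.Units_closed D.m_assoc D.r_one)
  have fractions: "z \<in> ?F"
    if "z \<in> carrier D" "v \<in> words_over_P" "v \<notin> I" "w \<in> words_over_P" "z \<otimes> J v = J w" for z v w
  proof -
    have "z = J w \<otimes> inv\<^bsub>D\<^esub> (J v)" using that by (intro quot) (auto simp: J_unit)
    moreover have "cls v \<noteq> \<zero>\<^bsub>U\<^esub>" using that(3) by (auto simp: zero_U cls_eq)
    ultimately show ?thesis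
      using that(2,4) unfolding fractions_of_def J_def by (auto simp: env_sub_cls)
  qed
  have fractionsD: "\<exists>v w. v \<in> words_over_P \<and> v \<notin> I \<and> w \<in> words_over_P \<and> z \<in> carrier D \<and> z \<otimes> J v = J w"
    if z: "z \<in> ?F" for z
  proof -
    obtain v w where vw: "z = J w \<otimes> inv\<^bsub>D\<^esub> (J v)" "v \<in> words_over_P" "w \<in> words_over_P" "cls v \<noteq> \<zero>\<^bsub>U\<^esub>"
      using z unfolding fractions_of_def env_sub_cls J_def by auto
    then have v: "v \<notin> I" by (auto simp: zero_U cls_eq)
    then have "J v \<in> Units D" by (simp add: J_unit)
    then have "z \<in> carrier D" "z \<otimes> J v = J w"
      by (simp_all add: vw D.m_assoc)
    then show ?thesis using vw v by blast
  qed
  have weight: "weight_space D (j \<circ> env_gen scale bracket) (j \<circ> env_scalar scale bracket) \<mu>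
      \<subseteq> ?F" for \<mu>
  proof
    fix z assume z: "z \<in> weight_space D (j \<circ> env_gen scale bracket) (j \<circ> env_scalar scale bracket) \<mu>"
    then have zC [simp]: "z \<in> carrier D" by (simp add: weight_space_def)
    have zw: "J (letter x) \<otimes> z \<ominus> z \<otimes> J (letter x) = J (scalar (\<mu> x)) \<otimes> z" for x
      using z by (simp add: weight_space_def J_def env_gen_cls env_scalar_cls)
    have comm: "z \<otimes> J (letter x) = J (letter x) \<otimes> z \<ominus> J (scalar (\<mu> x)) \<otimes> z" for x
      unfolding zw[symmetric] by (simp add: D.minus_eq D.minus_add D.add.m_assoc[symmetric] D.r_neg)
    define K where "K = {v. \<exists>y. z \<otimes> J v = J y}"
    \<comment> \<open>By \<open>comm\<close>, passing a letter to the left of \<open>z\<close> costs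
      only the scalar \<open>\<mu>\<close>. Hence the set \<open>K\<close> of denominators of
      \<open>z\<close> is stable under commutators, and the numerator of the commutator is
      explicit.\<close>
    have step: "z \<otimes> J (letter u * v - v * letter u) = J (letter u * y - scalar (\<mu> u) * y - y * letter u)"
      if "z \<otimes> J v = J y" for u v y
    proof -
      have "z \<otimes> J (letter u * v - v * letter u)
          = (z \<otimes> J (letter u)) \<otimes> J v \<ominus> (z \<otimes> J v) \<otimes> J (letter u)"
        by (simp add: J_minus[symmetric] J_mult[symmetric] D.minus_eq D.r_distr D.r_minus D.m_assoc)
      also have "\<dots> = (J (letter u) \<otimes> (z \<otimes> J v) \<ominus> J (scalar (\<mu> u)) \<otimes> (z \<otimes> J v))
           \<ominus> (z \<otimes> J v) \<otimes> J (letter u)"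
        unfolding comm by (simp add: D.minus_eq D.l_distr D.l_minus D.m_assoc)
      also have "\<dots> = J (letter u * y - scalar (\<mu> u) * y - y * letter u)"
        unfolding that by (simp add: J_mult J_minus)
      finally show ?thesis .
    qed
    obtain w0 v0 where wv: "z = J w0 \<otimes> inv\<^bsub>D\<^esub> (J v0)" "v0 \<notin> I"
    proof -
      obtain y v where yv: "y \<in> carrier U" "v \<in> carrier U" "v \<noteq> \<zero>\<^bsub>U\<^esub>" "z = j y \<otimes> inv\<^bsub>D\<^esub> (j v)"
        using frac[OF zC] by blast
      then obtain w0 v0 where "y = cls w0" "v = cls v0" by (auto simp: carrier_U)
      with yv show ?thesis by (intro that[of w0 v0]) (simp_all add: J_def zero_U cls_eq)
    qed
    then have "J v0 \<in> Units D" by (simp add: J_unit)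
    then have "z \<otimes> J v0 = J w0" by (simp add: wv D.m_assoc)
    then have "v0 \<in> K" by (auto simp: K_def)
    moreover have "letter u * v - v * letter u \<in> K" if "v \<in> K" for u v
      using that step unfolding K_def by blast
    ultimately obtain v where v: "v \<in> K" "v \<in> words_over_P" "v \<notin> I"
      using ad_closed_meets_words_over_P[OF f, of K v0] wv(2) by blast
    then obtain y where y: "z \<otimes> J v = J y" by (auto simp: K_def)
    have "y \<in> words_over_P"
    \<comment> \<open>The denominator \<open>v\<close> now commutes with P, so the left side of
      \<open>step\<close> is zero for \<open>u \<in> P\<close>; the right side then says that the
      numerator \<open>y\<close> has weight \<open>\<mu>\<close> on P.\<close>
    proof (rule semi_invariant_words_over_P[OF f])
      fix u assume "u \<in> P"
      then have "letter u * v - v * letter u \<in> I" using v(2) by (rule words_over_P_commute_letter)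
      then have "J (letter u * v - v * letter u) = \<zero>"
        using J_eq[of _ 0] by (simp add: J_zero[symmetric])
      then have "J (letter u * y - scalar (\<mu> u) * y - y * letter u) = \<zero>"
        using step[OF y, of u] by simp
      then have "letter u * y - scalar (\<mu> u) * y - y * letter u \<in> I"
        using J_eq[of _ 0] by (simp add: J_zero[symmetric] del: mult_single)
      then show "letter u * y - y * letter u - scalar (\<mu> u) * y \<in> I"
        by (simp add: algebra_simps)
    qed
    then show "z \<in> ?F"
      using fractions[OF zC v(2,3) _ y] by blast
  qed
  have "subgroup (?F) (add_monoid D)"
  proof (rule D.add.subgroupI)
    show "?F \<subseteq> carrier D" using fractionsD by blast
    have "J 1 = \<one>" by (simp add: J_def flip: one_U)
    then have "1 \<notin> I" using J_unit[of 1] by simp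
    then have "\<zero> \<in> ?F"
      using words_over_P_scalar[of 1] words_over_P_I[OF I_zero] by (intro fractions[of _ 1 0]) (auto simp: J_zero)
    then show "?F \<noteq> {}" by blast
    show "\<ominus> z \<in> ?F"
      if z: "z \<in> ?F" for z
    proof -
      obtain v w where vw: "v \<in> words_over_P" "v \<notin> I" "w \<in> words_over_P" "z \<in> carrier D" "z \<otimes> J v = J w"
        using fractionsD[OF z] by blast
      have "(\<ominus> z) \<otimes> J v = J (- w)"
        using J_minus[of 0 w] vw by (simp add: D.l_minus J_zero D.minus_eq)
      then show ?thesis using vw words_over_P_uminus by (intro fractions[of _ v "- w"]) auto
    qed
    show "z \<oplus> z' \<in> ?F"
      if zz: "z \<in> ?F" "z' \<in> ?F" for z z'
    proof -
      obtain v w where vw: "v \<in> words_over_P" "v \<notin> I" "w \<in> words_over_P" "z \<in> carrier D" "z \<otimes> J v = J w"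
        using fractionsD[OF zz(1)] by blast
      obtain v' w' where vw': "v' \<in> words_over_P" "v' \<notin> I" "w' \<in> words_over_P" "z' \<in> carrier D" "z' \<otimes> J v' = J w'"
        using fractionsD[OF zz(2)] by blast
      \<comment> \<open>U(P) is commutative, so the product of the two denominators is a common
        denominator on the right for both fractions.\<close>
      have c: "J (v * v') = J (v' * v)"
        using words_over_P_commute[OF vw(1) vw'(1)] by (simp add: J_eq)
      have "(z \<oplus> z') \<otimes> J (v * v') = z \<otimes> J (v * v') \<oplus> z' \<otimes> J (v' * v)"
        using vw vw' c by (simp add: D.l_distr)
      also have "\<dots> = (z \<otimes> J v) \<otimes> J v' \<oplus> (z' \<otimes> J v') \<otimes> J v"
        using vw(4) vw'(4) by (simp add: J_mult[symmetric] D.m_assoc)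
      also have "\<dots> = J (w * v' + w' * v)" using vw vw' by (simp add: J_mult J_add)
      finally have "(z \<oplus> z') \<otimes> J (v * v') = J (w * v' + w' * v)" .
      moreover have "v * v' \<notin> I"
        using D.Units_m_closed[of "J v" "J v'"] vw(2) vw'(2) by (simp add: J_unit J_mult)
      ultimately show ?thesis
        using vw vw' by (intro fractions[of _ "v * v'" "w * v' + w' * v"])
          (auto intro: words_over_P_mult words_over_P_add)
    qed
  qed
  then show ?thesis
    unfolding semicenter_def using weight by (intro D.add.generate_subgroup_incl) blast
qed

end

section \<open>Tensor products\<close>

lemma tensor_coset_eq_set: "tensor_coset N x = {n + x | n. n \<in> N}"
  by (auto simp: tensor_coset_def r_coset_def)

lemma set_mult_free_Abelian_group: "set_mult (free_Abelian_group Xs) A B = {a + c | a c. a \<in> A \<and> c \<in> B}"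
  by (auto simp: set_mult_def)

text \<open>Cosets are formed in the free group on all pairs, so \<open>tc_eq\<close> and
  \<open>mult_G\<close> need no conditions on representatives; \<open>Xs\<close> matters only for
  membership in the carrier and for inverses.\<close>

locale tensor_quotient =
  fixes Xs :: "'p set" and N :: "('p \<Rightarrow>\<^sub>0 int) set"
  assumes subgroup_N: "subgroup N (free_Abelian_group Xs)"
begin

abbreviation G where "G \<equiv> free_Abelian_group Xs Mod N"
abbreviation tc where "tc \<equiv> tensor_coset N"

lemma keys_N: "x \<in> N \<Longrightarrow> Poly_Mapping.keys x \<subseteq> Xs"
  using subsetD[OF subgroup.subset[OF subgroup_N], of x] by simp

lemma N_zero: "0 \<in> N"
  using subgroup.one_closed[OF subgroup_N] by simp

lemma N_add: "x \<in> N \<Longrightarrow> y \<in> N \<Longrightarrow> x + y \<in> N"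
  using subgroup.m_closed[OF subgroup_N] by simp

lemma N_uminus: "x \<in> N \<Longrightarrow> - x \<in> N"
  using subgroup.m_inv_closed[OF subgroup_N, of x] keys_N[of x] by simp

lemma N_diff: "x \<in> N \<Longrightarrow> y \<in> N \<Longrightarrow> x - y \<in> N"
  using N_add[of x "- y"] N_uminus[of y] by simp

lemma tc_mem: "y \<in> tc x \<longleftrightarrow> y - x \<in> N"
  unfolding tensor_coset_eq_set by (auto intro: exI[of _ "y - x"])

lemma tc_eq: "tc x = tc y \<longleftrightarrow> x - y \<in> N"
proof
  assume "tc x = tc y"
  then have "x \<in> tc y" using tc_mem[of x x] N_zero by simp
  then show "x - y \<in> N" by (simp add: tc_mem)
next
  assume xy: "x - y \<in> N"
  have "z \<in> tc x \<longleftrightarrow> z \<in> tc y" for z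
    using N_add[of "z - x" "x - y"] N_diff[of "z - y" "x - y"] xy by (auto simp: tc_mem)
  then show "tc x = tc y" by blast
qed

lemma carrier_G: "carrier G = tc ` {x. Poly_Mapping.keys x \<subseteq> Xs}"
  by (auto simp: FactGroup_def RCOSETS_def r_coset_def tensor_coset_def)

lemma tc_carrier: "Poly_Mapping.keys x \<subseteq> Xs \<Longrightarrow> tc x \<in> carrier G"
  by (auto simp: carrier_G)

lemma mult_G: "tc x \<otimes>\<^bsub>G\<^esub> tc y = tc (x + y)"
proof -
  have "tc x \<otimes>\<^bsub>G\<^esub> tc y = {a + c | a c. a \<in> tc x \<and> c \<in> tc y}"
    by (simp add: FactGroup_def set_mult_free_Abelian_group)
  also have "\<dots> = tc (x + y)"
  proof
    show "{a + c | a c. a \<in> tc x \<and> c \<in> tc y} \<subseteq> tc (x + y)"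
    proof clarify
      fix a c assume "a \<in> tc x" "c \<in> tc y"
      then show "a + c \<in> tc (x + y)" using N_add[of "a - x" "c - y"] by (simp add: tc_mem algebra_simps)
    qed
    show "tc (x + y) \<subseteq> {a + c | a c. a \<in> tc x \<and> c \<in> tc y}"
    proof
      fix z assume "z \<in> tc (x + y)"
      then have "z = (z - y) + y" "z - y \<in> tc x" "y \<in> tc y" by (auto simp: tc_mem N_zero algebra_simps)
      then show "z \<in> {a + c | a c. a \<in> tc x \<and> c \<in> tc y}" by blast
    qed
  qed
  finally show ?thesis .
qed

lemma one_G: "\<one>\<^bsub>G\<^esub> = tc 0"
proof -
  have "tc 0 = N" by (auto simp: tc_mem)
  then show ?thesis by (simp add: FactGroup_def)
qed

lemma comm_group_G: "comm_group G"
proof -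
  interpret F: comm_group "free_Abelian_group Xs" by (rule abelian_free_Abelian_group)
  show ?thesis by (rule F.abelian_FactGroup) (rule subgroup_N)
qed

lemma inv_G: "Poly_Mapping.keys x \<subseteq> Xs \<Longrightarrow> inv\<^bsub>G\<^esub> tc x = tc (- x)"
proof -
  assume "Poly_Mapping.keys x \<subseteq> Xs"
  interpret G: comm_group G by (rule comm_group_G)
  have "tc (- x) \<otimes>\<^bsub>G\<^esub> tc x = \<one>\<^bsub>G\<^esub>" unfolding mult_G one_G by simp
  then show ?thesis using \<open>Poly_Mapping.keys x \<subseteq> Xs\<close>
    by (intro G.inv_equality tc_carrier) simp_all
qed

lemma subgroup_diff:
  assumes H: "subgroup H G" and x: "Poly_Mapping.keys x \<subseteq> Xs" "tc x \<in> H" and y: "Poly_Mapping.keys y \<subseteq> Xs" "tc y \<in> H"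
  shows "tc (x - y) \<in> H"
  using subgroup.m_closed[OF H x(2) subgroup.m_inv_closed[OF H y(2)]] unfolding inv_G[OF y(1)] mult_G by simp

end

lemma tensor_map_coset:
  assumes N: "subgroup N (free_Abelian_group Xs)" and N': "subgroup N' (free_Abelian_group Xs')"
    and "\<And>x. x \<in> N \<Longrightarrow> frag_extend (\<lambda>p. frag_of (g p)) x \<in> N'"
  shows "tensor_map N' g (tensor_coset N x) = tensor_coset N' (frag_extend (\<lambda>p. frag_of (g p)) x)"
proof -
  interpret T: tensor_quotient Xs N by (rule tensor_quotient.intro[OF N])
  interpret T': tensor_quotient Xs' N' by (rule tensor_quotient.intro[OF N'])
  have "T'.tc (frag_extend (\<lambda>p. frag_of (g p)) y) = T'.tc (frag_extend (\<lambda>p. frag_of (g p)) x)" if "y \<in> T.tc x" for y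
    using assms(3)[of "y - x"] that by (simp add: T'.tc_eq T.tc_mem frag_extend_diff)
  moreover have "x \<in> T.tc x" by (simp add: T.tc_mem T.N_zero)
  ultimately show ?thesis unfolding tensor_map_def by blast
qed

lemma frag_extend_add_fun: "frag_extend (\<lambda>p. F p + G p) x = frag_extend F x + frag_extend G x"
  by (simp add: frag_extend_def frag_cmul_distrib2 sum.distrib)

lemma frag_extend_diff_fun: "frag_extend (\<lambda>p. F p - G p) x = frag_extend F x - frag_extend G x"
  using frag_extend_add_fun[of "\<lambda>p. F p - G p" G x] by simp

text \<open>Compatibility is assumed only against single pairs of the other factor; biadditivity
  extends it to all formal sums, and the union defining \<open>tensor_map2\<close> collapses to one
  coset.\<close>

lemma tensor_map2_coset:
  assumes N: "subgroup N (free_Abelian_group Xs)" and N': "subgroup N' (free_Abelian_group Xs')"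
    and N'': "subgroup N'' (free_Abelian_group Xs'')"
    and left: "\<And>x r. x \<in> N \<Longrightarrow> r \<in> Xs' \<Longrightarrow> frag_extend (\<lambda>p. frag_of (g p r)) x \<in> N''"
    and right: "\<And>p y. p \<in> Xs \<Longrightarrow> y \<in> N' \<Longrightarrow> frag_extend (\<lambda>r. frag_of (g p r)) y \<in> N''"
    and x: "Poly_Mapping.keys x \<subseteq> Xs" and y: "Poly_Mapping.keys y \<subseteq> Xs'"
  shows "tensor_map2 N'' g (tensor_coset N x) (tensor_coset N' y)
    = tensor_coset N'' (frag_extend (\<lambda>p. frag_extend (\<lambda>r. frag_of (g p r)) y) x)"
proof -
  interpret T: tensor_quotient Xs N by (rule tensor_quotient.intro[OF N])
  interpret T': tensor_quotient Xs' N' by (rule tensor_quotient.intro[OF N'])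
  interpret T'': tensor_quotient Xs'' N'' by (rule tensor_quotient.intro[OF N''])
  define B where "B x y = frag_extend (\<lambda>p. frag_extend (\<lambda>r. frag_of (g p r)) y) x" for x y
  have B_diff_left: "B (x - x') y = B x y - B x' y" for x x' y
    by (simp add: B_def frag_extend_diff)
  have B_diff_right: "B x (y - y') = B x y - B x y'" for x y y'
    by (simp add: B_def frag_extend_diff frag_extend_diff_fun)
  have L: "B n y \<in> N''" if n: "n \<in> N" and y: "Poly_Mapping.keys y \<subseteq> Xs'" for n y
    using y
  proof (induction rule: frag_induction)
    case zero
    then show ?case using B_diff_right[of n 0 0] T''.N_zero by simp
  next
    case (one r)
    then show ?case using left[OF n] by (simp add: B_def)
  next
    case (diff a c)
    then show ?case by (simp add: B_diff_right T''.N_diff)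
  qed
  have R: "B x n \<in> N''" if n: "n \<in> N'" and x: "Poly_Mapping.keys x \<subseteq> Xs" for n x
    using x
  proof (induction rule: frag_induction)
    case zero
    then show ?case using B_diff_left[of 0 0 n] T''.N_zero by simp
  next
    case (one r)
    then show ?case using right[OF _ n] by (simp add: B_def)
  next
    case (diff a c)
    then show ?case by (simp add: B_diff_left T''.N_diff)
  qed
  have "T''.tc (B x' y') = T''.tc (B x y)" if x': "x' \<in> T.tc x" and y': "y' \<in> T'.tc y" for x' y'
  proof -
    have "Poly_Mapping.keys y' \<subseteq> Xs'"
      using keys_add[of "y' - y" y] T'.keys_N[of "y' - y"] y y' by (auto simp: T'.tc_mem)
    then have 1: "B (x' - x) y' \<in> N''" using L x' by (simp add: T.tc_mem)
    have 2: "B x (y' - y) \<in> N''" using R x y' by (simp add: T'.tc_mem)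
    show ?thesis using T''.N_add[OF 1 2] by (simp add: T''.tc_eq B_diff_left B_diff_right)
  qed
  moreover have "x \<in> T.tc x" "y \<in> T'.tc y" by (simp_all add: T.tc_mem T.N_zero T'.tc_mem T'.N_zero)
  ultimately show ?thesis unfolding tensor_map2_def B_def[symmetric] by blast
qed

lemma keys_frag_of_diff3:
  "a \<in> Xs \<Longrightarrow> c \<in> Xs \<Longrightarrow> d \<in> Xs \<Longrightarrow> Poly_Mapping.keys (frag_of a - frag_of c - frag_of d) \<subseteq> Xs"
  using keys_diff[of "frag_of a - frag_of c" "frag_of d"] keys_diff[of "frag_of a" "frag_of c"] by auto

lemma keys_frag_of_diff2:
  "a \<in> Xs \<Longrightarrow> c \<in> Xs \<Longrightarrow> Poly_Mapping.keys (frag_of a - frag_of c) \<subseteq> Xs"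
  using keys_diff[of "frag_of a" "frag_of c"] by auto

locale tensor_data =
  fixes R :: "('r, 'm) ring_scheme" and A :: "('a, 'n) monoid_scheme" and ra :: "'a \<Rightarrow> 'r \<Rightarrow> 'a"
    and B :: "('b, 'l) monoid_scheme" and lb :: "'r \<Rightarrow> 'b \<Rightarrow> 'b"
  assumes A_closed: "x \<in> carrier A \<Longrightarrow> x' \<in> carrier A \<Longrightarrow> x \<otimes>\<^bsub>A\<^esub> x' \<in> carrier A"
    and B_closed: "y \<in> carrier B \<Longrightarrow> y' \<in> carrier B \<Longrightarrow> y \<otimes>\<^bsub>B\<^esub> y' \<in> carrier B"
    and ra_closed: "x \<in> carrier A \<Longrightarrow> r \<in> carrier R \<Longrightarrow> ra x r \<in> carrier A"
    and lb_closed: "y \<in> carrier B \<Longrightarrow> r \<in> carrier R \<Longrightarrow> lb r y \<in> carrier B"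
begin

abbreviation null where "null \<equiv> tensor_null R A ra B lb"

lemma subgroup_null: "subgroup null (free_Abelian_group (carrier A \<times> carrier B))"
  unfolding tensor_null_def
  by (rule group.generate_is_subgroup[OF group_free_Abelian_group])
    (intro Un_least subsetI; elim CollectE exE conjE; hypsubst; unfold carrier_free_Abelian_group_iff;
      (rule keys_frag_of_diff3 | rule keys_frag_of_diff2); simp add: A_closed B_closed ra_closed lb_closed)

lemma null_left: "x \<in> carrier A \<Longrightarrow> x' \<in> carrier A \<Longrightarrow> y \<in> carrier B \<Longrightarrow>
    frag_of (x \<otimes>\<^bsub>A\<^esub> x', y) - frag_of (x, y) - frag_of (x', y) \<in> null"
  unfolding tensor_null_def by (rule generate.incl) blast

lemma null_right: "x \<in> carrier A \<Longrightarrow> y \<in> carrier B \<Longrightarrow> y' \<in> carrier B \<Longrightarrow>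
    frag_of (x, y \<otimes>\<^bsub>B\<^esub> y') - frag_of (x, y) - frag_of (x, y') \<in> null"
  unfolding tensor_null_def by (rule generate.incl) blast

lemma null_balanced: "x \<in> carrier A \<Longrightarrow> y \<in> carrier B \<Longrightarrow> r \<in> carrier R \<Longrightarrow>
    frag_of (ra x r, y) - frag_of (x, lb r y) \<in> null"
  unfolding tensor_null_def by (rule generate.incl) blast

lemma null_least:
  assumes zero: "0 \<in> H" and diff: "\<And>x y. x \<in> H \<Longrightarrow> y \<in> H \<Longrightarrow> x - y \<in> H"
    and left: "\<And>x x' y. x \<in> carrier A \<Longrightarrow> x' \<in> carrier A \<Longrightarrow> y \<in> carrier B \<Longrightarrow>
      frag_of (x \<otimes>\<^bsub>A\<^esub> x', y) - frag_of (x, y) - frag_of (x', y) \<in> H"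
    and right: "\<And>x y y'. x \<in> carrier A \<Longrightarrow> y \<in> carrier B \<Longrightarrow> y' \<in> carrier B \<Longrightarrow>
      frag_of (x, y \<otimes>\<^bsub>B\<^esub> y') - frag_of (x, y) - frag_of (x, y') \<in> H"
    and balanced: "\<And>x y r. x \<in> carrier A \<Longrightarrow> y \<in> carrier B \<Longrightarrow> r \<in> carrier R \<Longrightarrow>
      frag_of (ra x r, y) - frag_of (x, lb r y) \<in> H"
  shows "null \<subseteq> H"
proof
  fix z assume "z \<in> null"
  let ?F = "free_Abelian_group (carrier A \<times> carrier B)"
  interpret F: group ?F by simp
  \<comment> \<open>\<open>H\<close> is not assumed to consist of formal sums over the given
    carriers, so it is cut down to \<open>null\<close> before minimality is applied.\<close>
  have sg: "subgroup (null \<inter> H) ?F"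
  proof (rule F.subgroupI)
    show "null \<inter> H \<subseteq> carrier ?F" using subgroup.subset[OF subgroup_null] by blast
    show "null \<inter> H \<noteq> {}" using zero subgroup.one_closed[OF subgroup_null] by auto
    fix x assume x: "x \<in> null \<inter> H"
    have k: "Poly_Mapping.keys x \<subseteq> carrier A \<times> carrier B" using x subsetD[OF subgroup.subset[OF subgroup_null], of x] by simp
    have "inv\<^bsub>?F\<^esub> x \<in> null" using x subgroup.m_inv_closed[OF subgroup_null] by blast
    then show "inv\<^bsub>?F\<^esub> x \<in> null \<inter> H" using diff[OF zero, of x] x k by simp
    fix y assume y: "y \<in> null \<inter> H"
    have "x - (0 - y) \<in> H" by (intro diff zero) (use x y in auto)
    then show "x \<otimes>\<^bsub>?F\<^esub> y \<in> null \<inter> H" using x y subgroup.m_closed[OF subgroup_null, of x y] by simp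
  qed
  have "null \<subseteq> null \<inter> H"
    by (rule ord_eq_le_trans[OF tensor_null_def], rule F.generate_subgroup_incl[OF _ sg])
      (intro Un_least subsetI; elim CollectE exE conjE; hypsubst;
        rule IntI; (rule null_left null_right null_balanced left right balanced); assumption)
  then show "z \<in> H" using \<open>z \<in> null\<close> by blast
qed

text \<open>The universal property in the form needed to show that a pure tensor is nonzero: a
  balanced biadditive map with a nonzero value at (x, y) keeps \<open>frag_of (x, y)\<close> out of
  the relations.\<close>

lemma lift:
  fixes Q :: "('q, 'z) monoid_scheme" (structure)
  assumes Q: "comm_group Q"
    and closed: "\<And>x y. x \<in> carrier A \<Longrightarrow> y \<in> carrier B \<Longrightarrow> \<phi> x y \<in> carrier Q"
    and left: "\<And>x x' y. x \<in> carrier A \<Longrightarrow> x' \<in> carrier A \<Longrightarrow> y \<in> carrier B \<Longrightarrow>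
      \<phi> (x \<otimes>\<^bsub>A\<^esub> x') y = \<phi> x y \<otimes> \<phi> x' y"
    and right: "\<And>x y y'. x \<in> carrier A \<Longrightarrow> y \<in> carrier B \<Longrightarrow> y' \<in> carrier B \<Longrightarrow>
      \<phi> x (y \<otimes>\<^bsub>B\<^esub> y') = \<phi> x y \<otimes> \<phi> x y'"
    and balanced: "\<And>x y r. x \<in> carrier A \<Longrightarrow> y \<in> carrier B \<Longrightarrow> r \<in> carrier R \<Longrightarrow> \<phi> (ra x r) y = \<phi> x (lb r y)"
  shows "\<exists>g. (\<forall>x\<in>carrier A. \<forall>y\<in>carrier B. g (frag_of (x, y)) = \<phi> x y) \<and> (\<forall>z\<in>null. g z = \<one>)"
proof -
  interpret Q: comm_group Q by (rule Q)
  let ?F = "free_Abelian_group (carrier A \<times> carrier B)"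
  obtain g where g: "g \<in> hom ?F Q" "\<And>p. p \<in> carrier A \<times> carrier B \<Longrightarrow> g (frag_of p) = (\<lambda>(x, y). \<phi> x y) p"
    by (rule Q.free_Abelian_group_universal[of "\<lambda>(x, y). \<phi> x y" "carrier A \<times> carrier B"]) (auto intro: closed)
  interpret g: group_hom ?F Q g
    by (rule group_hom.intro[OF _ Q.is_group group_hom_axioms.intro[OF g(1)]]) simp
  let ?Z = "{z \<in> carrier ?F. g z = \<one>}"
  have of_F: "frag_of (x, y) \<in> carrier ?F" "g (frag_of (x, y)) = \<phi> x y" if "x \<in> carrier A" "y \<in> carrier B" for x y
    using g(2)[of "(x, y)"] that by auto
  have diff: "x - y \<in> carrier ?F" "g (x - y) = g x \<otimes> inv\<^bsub>Q\<^esub> g y" if "x \<in> carrier ?F" "y \<in> carrier ?F" for x y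
    using g.hom_mult[of x "inv\<^bsub>?F\<^esub> y"] g.hom_inv[of y] g.G.m_closed[of x "inv\<^bsub>?F\<^esub> y"] that by auto
  have cancel: "(u \<otimes> v) \<otimes> inv\<^bsub>Q\<^esub> u \<otimes> inv\<^bsub>Q\<^esub> v = \<one>" if "u \<in> carrier Q" "v \<in> carrier Q" for u v
  proof -
    have "(u \<otimes> v) \<otimes> inv\<^bsub>Q\<^esub> u \<otimes> inv\<^bsub>Q\<^esub> v = (u \<otimes> v) \<otimes> inv\<^bsub>Q\<^esub> (u \<otimes> v)"
      using that by (simp add: Q.inv_mult Q.m_assoc)
    then show ?thesis using that by simp
  qed
  have "null \<subseteq> ?Z"
  proof (rule null_least)
    fix x x' y assume xy: "x \<in> carrier A" "x' \<in> carrier A" "y \<in> carrier B"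
    then show "frag_of (x \<otimes>\<^bsub>A\<^esub> x', y) - frag_of (x, y) - frag_of (x', y) \<in> ?Z"
      using diff[OF diff(1)[OF of_F(1) of_F(1)] of_F(1), of "x \<otimes>\<^bsub>A\<^esub> x'" y x y x' y]
      by (simp only: mem_Collect_eq diff(2)[OF of_F(1) of_F(1)] of_F(2) A_closed left cancel closed)
  next
    fix x y y' assume xy: "x \<in> carrier A" "y \<in> carrier B" "y' \<in> carrier B"
    then show "frag_of (x, y \<otimes>\<^bsub>B\<^esub> y') - frag_of (x, y) - frag_of (x, y') \<in> ?Z"
      using diff[OF diff(1)[OF of_F(1) of_F(1)] of_F(1), of x "y \<otimes>\<^bsub>B\<^esub> y'" x y x y']
      by (simp only: mem_Collect_eq diff(2)[OF of_F(1) of_F(1)] of_F(2) B_closed right cancel closed)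
  next
    fix x y r assume xy: "x \<in> carrier A" "y \<in> carrier B" "r \<in> carrier R"
    then show "frag_of (ra x r, y) - frag_of (x, lb r y) \<in> ?Z"
      using diff[OF of_F(1) of_F(1), of "ra x r" y x "lb r y"]
      by (simp only: mem_Collect_eq of_F(2) ra_closed lb_closed balanced closed Q.r_inv)
  next
    fix x y assume "x \<in> ?Z" "y \<in> ?Z"
    then show "x - y \<in> ?Z" using diff[of x y] by simp
  qed (use g.hom_one in simp)
  then show ?thesis by (intro exI[of _ g]) (auto simp: of_F(2))
qed

end

sublocale tensor_data \<subseteq> tensor_quotient "carrier A \<times> carrier B" "tensor_null R A ra B lb"
  by (rule tensor_quotient.intro[OF subgroup_null])

section \<open>The induced module\<close>

lemma ring_of_type_algebra_simps:
  "carrier (ring_of_type_algebra :: 'k::comm_ring_1 ring) = UNIV"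
  "x \<otimes>\<^bsub>ring_of_type_algebra\<^esub> y = (x * y :: 'k)"
  "x \<oplus>\<^bsub>ring_of_type_algebra\<^esub> y = (x + y :: 'k)"
  "\<one>\<^bsub>ring_of_type_algebra\<^esub> = (1 :: 'k)"
  "\<zero>\<^bsub>ring_of_type_algebra\<^esub> = (0 :: 'k)"
  by (simp_all add: ring_of_type_algebra_def)

locale induced_module = abelian_ideal scale bracket P
  for scale :: "'k::field_char_0 \<Rightarrow> 'a::ab_group_add \<Rightarrow> 'a" and bracket :: "'a \<Rightarrow> 'a \<Rightarrow> 'a" and P :: "'a set" +
  fixes f :: "'a \<Rightarrow> 'k"
  assumes nondegenerate_f: "nondegenerate f"
begin

abbreviation N1 where "N1 \<equiv> ind_null scale bracket f P"
abbreviation M where "M \<equiv> ind_module scale bracket f P"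
abbreviation act where "act \<equiv> ind_action scale bracket f P"
abbreviation kring :: "'k ring" where "kring \<equiv> ring_of_type_algebra"

lemma dual_f: "f \<in> dual scale"
  using nondegenerate_f by (simp add: nondegenerate_def)

lemma env_character_coset:
  assumes "Poly_Mapping.keys w \<subseteq> lists P"
  shows "env_character f (cls_P w) = word_eval f w"
proof -
  note lin = linear_dual[OF dual_f]
  let ?K = "{p \<in> carrier (word_algebra P). word_eval f p = 0}"
  have neg: "word_eval f (- p) = - word_eval f p" for p
    by (simp add: word_eval_eq_lin_ext lin_ext_uminus)
  \<comment> \<open>\<open>word_eval f\<close> is multiplicative, and it kills the relations because
    \<open>f\<close> is linear and P is commutative. Its image of a coset is therefore a single
    value, as \<open>the_elem\<close> requires.\<close>
  have "env_ideal scale bracket P \<subseteq> ?K"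
  proof (rule env_ideal_least)
    show "env_relations scale bracket P \<subseteq> ?K"
    proof
      fix z assume z: "z \<in> env_relations scale bracket P"
      then have "word_eval f z = 0"
        unfolding env_relations_def
        by (auto simp: word_eval_diff) (auto simp: word_eval_eq_lin_ext lin abelian_P)
      then show "z \<in> ?K" using carrier_relations z by blast
    qed
    show "p + q \<in> ?K" if "p \<in> ?K" "q \<in> ?K" for p q
      using that keys_add[of p q] by (auto simp: word_algebra_simps word_eval_add)
    show "q * p \<in> ?K \<and> p * q \<in> ?K" if "p \<in> ?K" "q \<in> carrier (word_algebra P)" for p q
      using that keys_mult_lists[of p P q] keys_mult_lists[of q P p]
      by (simp add: word_algebra_simps word_eval_mult)
  qed (auto simp: word_algebra_simps word_eval_eq_lin_ext lin_ext_uminus)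
  then have "word_eval f ` (cls_P w) = {word_eval f w}"
    unfolding cls_P_def word_coset using zero_env_ideal_P
    by (fastforce simp: word_eval_add image_iff)
  then show ?thesis by (simp add: env_character_def)
qed

sublocale ind: tensor_data "env scale bracket P" "add_monoid U"
  "\<lambda>u Z. u \<otimes>\<^bsub>U\<^esub> env_incl scale bracket Z" "add_monoid kring" "\<lambda>Z c. env_character f Z * c"
proof -
  have "x \<oplus>\<^bsub>U\<^esub> x' \<in> carrier U" if "x \<in> carrier U" "x' \<in> carrier U" for x x'
    using that by (auto simp: carrier_U add_U)
  moreover have "x \<otimes>\<^bsub>U\<^esub> env_incl scale bracket r \<in> carrier U" if "x \<in> carrier U" "r \<in> carrier (env scale bracket P)" for x r
    using that by (auto simp: carrier_U carrier_env_P env_incl_cls mult_U)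
  ultimately show "tensor_data (env scale bracket P) (add_monoid U)
    (\<lambda>u Z. u \<otimes>\<^bsub>U\<^esub> env_incl scale bracket Z) (add_monoid kring) (\<lambda>Z c. env_character f Z * c)"
    by unfold_locales (auto simp: ring_of_type_algebra_simps)
qed

lemma N1_null: "N1 = ind.null"
  by (simp add: ind_null_def)

lemma M_quotient: "M = ind.G"
  by (simp add: ind_module_def tensor_group_def)

lemma N1_left: "frag_of (cls (v + w), c) - frag_of (cls v, c) - frag_of (cls w, c) \<in> N1"
  using ind.null_left[of "cls v" "cls w" c] by (simp add: N1_null add_U ring_of_type_algebra_simps)

lemma N1_right: "frag_of (cls v, c + c') - frag_of (cls v, c) - frag_of (cls v, c') \<in> N1"
  using ind.null_right[of "cls v" c c'] by (simp add: N1_null ring_of_type_algebra_simps)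

lemma N1_balanced:
  assumes "Poly_Mapping.keys w \<subseteq> lists P"
  shows "frag_of (cls (v * w), c) - frag_of (cls v, word_eval f w * c) \<in> N1"
  using ind.null_balanced[of "cls v" c "cls_P w"] assms
  by (simp add: N1_null ring_of_type_algebra_simps carrier_env_P env_incl_cls env_character_coset mult_U)

lemma N1_least:
  assumes zero: "0 \<in> H" and diff: "\<And>x y. x \<in> H \<Longrightarrow> y \<in> H \<Longrightarrow> x - y \<in> H"
    and left: "\<And>v w c. frag_of (cls (v + w), c) - frag_of (cls v, c) - frag_of (cls w, c) \<in> H"
    and right: "\<And>v c c'. frag_of (cls v, c + c') - frag_of (cls v, c) - frag_of (cls v, c') \<in> H"
    and balanced: "\<And>v w c. Poly_Mapping.keys w \<subseteq> lists P \<Longrightarrow>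
      frag_of (cls (v * w), c) - frag_of (cls v, word_eval f w * c) \<in> H"
  shows "N1 \<subseteq> H"
  unfolding N1_null
proof (rule ind.null_least)
  fix x x' :: "('a list \<Rightarrow>\<^sub>0 'k) set" and y y' :: 'k and r
  assume x: "x \<in> carrier (add_monoid U)"
  then obtain v where v: "x = cls v" by (auto simp: carrier_U)
  show "frag_of (x, y \<otimes>\<^bsub>add_monoid kring\<^esub> y') - frag_of (x, y) - frag_of (x, y') \<in> H"
    using right[of v y y'] by (simp add: v ring_of_type_algebra_simps)
  {
    assume "x' \<in> carrier (add_monoid U)"
    then obtain w where w: "x' = cls w" by (auto simp: carrier_U)
    show "frag_of (x \<otimes>\<^bsub>add_monoid U\<^esub> x', y) - frag_of (x, y) - frag_of (x', y) \<in> H"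
      using left[of v w y] by (simp add: v w add_U)
  }
  {
    assume "r \<in> carrier (env scale bracket P)"
    then obtain w where w: "r = cls_P w" "Poly_Mapping.keys w \<subseteq> lists P"
      by (auto simp: carrier_env_P)
    show "frag_of (x \<otimes>\<^bsub>U\<^esub> env_incl scale bracket r, y) - frag_of (x, env_character f r * y) \<in> H"
      using balanced[OF w(2), of v y] by (simp add: v w(1) env_incl_cls env_character_coset[OF w(2)] mult_U)
  }
qed (use zero diff in auto)

text \<open>The vector w tensor 1. Scalars can be moved to the left factor, so every element has
  this form, and the induced module becomes the free algebra modulo the left ideal
  \<open>ker_iota\<close>.\<close>

definition iota :: "('a list \<Rightarrow>\<^sub>0 'k) \<Rightarrow> (('a list \<Rightarrow>\<^sub>0 'k) set \<times> 'k \<Rightarrow>\<^sub>0 int) set" where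
  "iota w = tensor_coset N1 (frag_of (cls w, 1))"

definition ker_iota :: "('a list \<Rightarrow>\<^sub>0 'k) set" where
  "ker_iota = {w. frag_of (cls w, 1) \<in> N1}"

lemma subgroup_N1: "subgroup N1 (free_Abelian_group (carrier U \<times> UNIV))"
  using ind.subgroup_null by (simp add: N1_null ring_of_type_algebra_simps)

lemma N1_zero: "0 \<in> N1" and N1_add: "x \<in> N1 \<Longrightarrow> y \<in> N1 \<Longrightarrow> x + y \<in> N1"
  and N1_uminus: "x \<in> N1 \<Longrightarrow> - x \<in> N1" and N1_diff: "x \<in> N1 \<Longrightarrow> y \<in> N1 \<Longrightarrow> x - y \<in> N1"
  using ind.N_zero ind.N_add ind.N_uminus ind.N_diff by (simp_all add: N1_null)

lemma tc_N1_eq: "tensor_coset N1 x = tensor_coset N1 y \<longleftrightarrow> x - y \<in> N1"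
  unfolding N1_null by (rule ind.tc_eq)

lemma N1_scalar: "frag_of (cls v, c) - frag_of (cls (scalar c * v), 1) \<in> N1"
  using N1_uminus[OF N1_balanced[of "scalar c" v 1]]
  by (simp add: word_eval_eq_lin_ext scalar_commute)

lemma iota_zero: "tensor_coset N1 0 = iota 0"
  using N1_left[of 0 0 1] by (simp add: iota_def tc_N1_eq)

lemma M_mult_iota: "iota v \<otimes>\<^bsub>M\<^esub> iota w = iota (v + w)"
proof -
  have "iota v \<otimes>\<^bsub>M\<^esub> iota w = tensor_coset N1 (frag_of (cls v, 1) + frag_of (cls w, 1))"
    unfolding M_quotient iota_def N1_null by (rule ind.mult_G)
  also have "\<dots> = iota (v + w)"
    using N1_uminus[OF N1_left[of v w 1]] by (simp add: iota_def tc_N1_eq algebra_simps)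
  finally show ?thesis .
qed

lemma M_one: "\<one>\<^bsub>M\<^esub> = iota 0"
  unfolding M_quotient ind.one_G iota_zero[symmetric] N1_null ..

lemma iota_eq: "iota v = iota w \<longleftrightarrow> v - w \<in> ker_iota"
proof -
  have "frag_of (cls v, 1) - frag_of (cls w, 1) - frag_of (cls (v - w), 1) \<in> N1"
    using N1_left[of "v - w" w 1] by (simp add: algebra_simps)
  from N1_add[OF this, of "frag_of (cls (v - w), 1)"]
    N1_diff[OF _ this, of "frag_of (cls v, 1) - frag_of (cls w, 1)"]
  show ?thesis by (auto simp: iota_def ker_iota_def tc_N1_eq)
qed

lemma iota_surj:
  assumes "Poly_Mapping.keys x \<subseteq> carrier U \<times> UNIV"
  shows "\<exists>w. tensor_coset N1 x = iota w"
  using assms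
proof (induction rule: frag_induction)
  case zero
  then show ?case using iota_zero by blast
next
  case (one p)
  then obtain v c where p: "p = (cls v, c)" by (auto simp: carrier_U)
  have "tensor_coset N1 (frag_of p) = iota (scalar c * v)"
    unfolding p iota_def tc_N1_eq by (rule N1_scalar)
  then show ?case by blast
next
  case (diff a c)
  then obtain v w where vw: "a - frag_of (cls v, 1) \<in> N1" "c - frag_of (cls w, 1) \<in> N1"
    by (auto simp: iota_def tc_N1_eq)
  have "frag_of (cls v, 1) - frag_of (cls (v - w), 1) - frag_of (cls w, 1) \<in> N1"
    using N1_left[of "v - w" w 1] by simp
  from N1_add[OF N1_diff[OF vw] this] have "tensor_coset N1 (a - c) = iota (v - w)"
    by (simp add: iota_def tc_N1_eq algebra_simps)
  then show ?case by blast
qed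

lemma carrier_M: "carrier M = range iota"
proof -
  have "carrier (add_monoid U) \<times> carrier (add_monoid kring) = carrier U \<times> UNIV"
    by (simp add: ring_of_type_algebra_simps)
  then have M: "carrier M = tensor_coset N1 ` {x. Poly_Mapping.keys x \<subseteq> carrier U \<times> UNIV}"
    unfolding M_quotient N1_null using ind.carrier_G by (simp only:)
  have "iota w \<in> carrier M" for w
    unfolding M iota_def by (rule imageI) simp
  moreover have "tensor_coset N1 x \<in> range iota" if "Poly_Mapping.keys x \<subseteq> carrier U \<times> UNIV" for x
    using iota_surj[OF that] by auto
  ultimately show ?thesis unfolding M by blast
qed

lemma act_iota: "act (cls a) (iota w) = iota (a * w)"
proof -
  let ?g = "\<lambda>(v, c). (cls a \<otimes>\<^bsub>U\<^esub> v, c :: 'k)"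
  have g: "?g (cls v, c) = (cls (a * v), c)" for v c by (simp add: mult_U)
  have "N1 \<subseteq> {x. frag_extend (\<lambda>p. frag_of (?g p)) x \<in> N1}"
  proof (rule N1_least)
    show "frag_of (cls (v * w), c) - frag_of (cls v, word_eval f w * c) \<in> {x. frag_extend (\<lambda>p. frag_of (?g p)) x \<in> N1}"
      if "Poly_Mapping.keys w \<subseteq> lists P" for v w c
      using N1_balanced[OF that, of "a * v" c] by (simp add: frag_extend_diff mult_U mult.assoc)
  qed (use N1_left[of "a * _" "a * _"] N1_right[of "a * _"] in \<open>simp_all add: frag_extend_diff mult_U N1_zero N1_diff distrib_left\<close>)
  then have "act (cls a) (iota w) = tensor_coset N1 (frag_extend (\<lambda>p. frag_of (?g p)) (frag_of (cls w, 1)))"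
    unfolding ind_action_def iota_def by (intro tensor_map_coset[OF subgroup_N1 subgroup_N1]) auto
  then show ?thesis by (simp add: iota_def mult_U)
qed

lemma word_eval_functional:
  fixes \<tau> :: "('a list \<Rightarrow>\<^sub>0 'k) \<Rightarrow> 'k"
  assumes \<tau>: "\<And>p q. \<tau> (p + q) = \<tau> p + \<tau> q" "\<And>c p. \<tau> (scalar c * p) = c * \<tau> p"
    "\<And>q u. u \<in> P \<Longrightarrow> \<tau> (q * (letter u - scalar (f u))) = 0"
    and w: "Poly_Mapping.keys w \<subseteq> lists P"
  shows "\<tau> (v * w) = word_eval f w * \<tau> v"
  using w
proof (induction w rule: keys_subset_single_induct)
  case zero
  have "\<tau> 0 = 0" using \<tau>(1)[of 0 0] by simp
  then show ?case by (simp add: word_eval_eq_lin_ext)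
next
  case (single w c)
  then show ?case
  proof (induction w arbitrary: v)
    case Nil
    show ?case using \<tau>(2)[of c v] by (simp add: scalar_commute word_eval_eq_lin_ext)
  next
    case (Cons u w)
    have "v * letter u = v * (letter u - scalar (f u)) + scalar (f u) * v"
      by (simp add: right_diff_distrib scalar_commute)
    then have "\<tau> (v * letter u) = f u * \<tau> v" using \<tau>(1,2) \<tau>(3)[of u v] Cons by simp
    moreover have "\<tau> (v * letter u * Poly_Mapping.single w c) = word_eval f (Poly_Mapping.single w c) * \<tau> (v * letter u)"
      using Cons by blast
    ultimately show ?case
      unfolding single_Cons[of u w c] mult.assoc[symmetric]
      by (simp add: word_eval_mult[symmetric] single_word_mult) (simp add: word_eval_eq_lin_ext)
  qed
next
  case (add p q)
  then show ?case by (simp add: distrib_left distrib_right \<tau>(1) word_eval_add)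
qed

lemma ker_iota_functional:
  fixes \<tau> :: "('a list \<Rightarrow>\<^sub>0 'k) \<Rightarrow> 'k"
  assumes \<tau>: "\<And>p q. \<tau> (p + q) = \<tau> p + \<tau> q" "\<And>c p. \<tau> (scalar c * p) = c * \<tau> p"
    "\<And>p. p \<in> I \<Longrightarrow> \<tau> p = 0" "\<And>q u. u \<in> P \<Longrightarrow> \<tau> (q * (letter u - scalar (f u))) = 0"
    and w: "w \<in> ker_iota"
  shows "\<tau> w = 0"
proof -
  interpret k: field kring by (rule field_from_type_algebra)
  \<comment> \<open>As \<open>\<tau>\<close> vanishes on the relations, its value does not depend on
    the representative that SOME selects.\<close>
  have \<tau>_cls: "\<tau> (SOME v'. cls v = cls v') = \<tau> v" for v
  proof -
    have "cls v = cls (SOME v'. cls v = cls v')" by (rule someI[of _ v]) simp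
    then show ?thesis using \<tau>(3)[of "v - (SOME v'. cls v = cls v')"] \<tau>(1)[of "v - (SOME v'. cls v = cls v')" "SOME v'. cls v = cls v'"]
      by (simp add: cls_eq)
  qed
  let ?\<phi> = "\<lambda>z c. c * \<tau> (SOME v. z = cls v)"
  have "\<exists>h. (\<forall>x\<in>carrier (add_monoid U). \<forall>y\<in>carrier (add_monoid kring). h (frag_of (x, y)) = ?\<phi> x y) \<and>
      (\<forall>z\<in>N1. h z = \<one>\<^bsub>add_monoid kring\<^esub>)"
    unfolding N1_null
  proof (rule ind.lift[OF k.a_comm_group, of ?\<phi>])
    fix x y r assume "x \<in> carrier (add_monoid U)" "r \<in> carrier (env scale bracket P)"
    then obtain v w where "x = cls v" "r = cls_P w" "Poly_Mapping.keys w \<subseteq> lists P"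
      by (auto simp: carrier_U carrier_env_P)
    then show "?\<phi> (x \<otimes>\<^bsub>U\<^esub> env_incl scale bracket r) y = ?\<phi> x (env_character f r * y)"
      by (simp add: env_incl_cls mult_U \<tau>_cls env_character_coset word_eval_functional[OF \<tau>(1,2,4)])
  qed (auto simp: ring_of_type_algebra_simps carrier_U add_U \<tau>_cls \<tau>(1) algebra_simps)
  then obtain h where h: "\<forall>x\<in>carrier (add_monoid U). \<forall>y\<in>carrier (add_monoid kring). h (frag_of (x, y)) = ?\<phi> x y"
      "\<forall>z\<in>N1. h z = \<one>\<^bsub>add_monoid kring\<^esub>" by blast
  have "h (frag_of (cls w, 1)) = 0" using h(2) w by (simp add: ker_iota_def ring_of_type_algebra_simps)
  then show ?thesis using h(1) by (simp add: \<tau>_cls ring_of_type_algebra_simps)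
qed

lemma left_ideal_ker_iota: "left_ideal_over f ker_iota"
  unfolding left_ideal_over_def
proof (intro conjI ballI allI)
  have mem: "w \<in> ker_iota \<longleftrightarrow> iota w = iota 0" for w using iota_eq[of w 0] by simp
  show "I \<subseteq> ker_iota"
  proof
    fix w assume "w \<in> I"
    then have "cls w = cls 0" by (simp add: cls_eq)
    then show "w \<in> ker_iota" by (simp add: mem iota_def)
  qed
  show "y + z \<in> ker_iota" if "y \<in> ker_iota" "z \<in> ker_iota" for y z
    using that M_mult_iota[of y z] M_mult_iota[of 0 0] by (simp add: mem)
  show "a * z \<in> ker_iota" if "z \<in> ker_iota" for a z
    using that act_iota[of a z] act_iota[of a 0] by (simp add: mem)
  show "letter p - scalar (f p) \<in> ker_iota" if "p \<in> P" for p
  proof -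
    \<comment> \<open>Read p as p acting on 1 tensor 1: balancing moves it to the scalar factor,
      where it becomes f(p).\<close>
    have 1: "frag_of (cls (letter p), 1) - frag_of (cls 1, f p) \<in> N1"
      using N1_balanced[of "letter p" 1 1] that by (simp add: word_eval_eq_lin_ext)
    have 2: "frag_of (cls 1, f p) - frag_of (cls (scalar (f p)), 1) \<in> N1"
      using N1_scalar[of 1 "f p"] by simp
    have "iota (letter p) = iota (scalar (f p))"
      using N1_add[OF 1 2] by (simp add: iota_def tc_N1_eq)
    then show ?thesis by (simp add: iota_eq)
  qed
qed

text \<open>The place where Poincare-Birkhoff-Witt gives nontriviality: a functional compatible with
  all relations takes the value 1 at 1.\<close>

lemma one_notin_ker_iota: "1 \<notin> ker_iota"
proof
  assume 1: "1 \<in> ker_iota"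
  obtain \<tau> :: "('a list \<Rightarrow>\<^sub>0 'k) \<Rightarrow> 'k" where \<tau>: "\<And>p q. \<tau> (p + q) = \<tau> p + \<tau> q" "\<And>c p. \<tau> (scalar c * p) = c * \<tau> p"
    "\<And>p. p \<in> I \<Longrightarrow> \<tau> p = 0" "\<And>q u. u \<in> P \<Longrightarrow> \<tau> (q * (letter u - scalar (f u))) = 0" "\<tau> 1 = 1"
    using character_functional[OF dual_f] by blast
  have "\<tau> 1 = 0" by (rule ker_iota_functional[OF \<tau>(1-4) 1])
  with \<tau>(5) show False by simp
qed

lemma iota_diff_closed:
  assumes H: "subgroup H M" and "iota v \<in> H" "iota w \<in> H"
  shows "iota (v - w) \<in> H"
proof -
  interpret G: comm_group M unfolding M_quotient by (rule ind.comm_group_G)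
  have c: "iota w \<in> carrier M" for w by (simp add: carrier_M)
  have "inv\<^bsub>M\<^esub> iota w = iota (- w)"
    by (rule G.inv_equality) (simp_all add: c M_mult_iota M_one)
  then have "iota (- w) \<in> H" using subgroup.m_inv_closed[OF H assms(3)] by simp
  from subgroup.m_closed[OF H assms(2) this] show ?thesis by (simp add: M_mult_iota)
qed

lemma simple_induced: "simple_module U M act"
  unfolding simple_module_def
proof (intro conjI allI impI)
  show "carrier M \<noteq> {\<one>\<^bsub>M\<^esub>}"
  proof
    assume "carrier M = {\<one>\<^bsub>M\<^esub>}"
    then have "iota 1 = iota 0" by (auto simp: carrier_M M_one)
    then show False using one_notin_ker_iota by (simp add: iota_eq)
  qed
next
  fix H assume H: "subgroup H M \<and> (\<forall>r\<in>carrier U. \<forall>x\<in>H. act r x \<in> H)"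
  then have sub: "subgroup H M" by blast
  have closed: "iota (a * w) \<in> H" if "iota w \<in> H" for a w
    using H that act_iota[of a w] by (metis cls_carrier)
  show "H = {\<one>\<^bsub>M\<^esub>} \<or> H = carrier M"
  proof (cases "H \<subseteq> {\<one>\<^bsub>M\<^esub>}")
    case True
    then show ?thesis using subgroup.one_closed[OF sub] by blast
  next
    case False
    then obtain x where x: "x \<in> H" "x \<noteq> \<one>\<^bsub>M\<^esub>" by blast
    then obtain z where "x = iota z" using subgroup.subset[OF sub] unfolding carrier_M by blast
    with x have z: "iota z \<in> H" "iota z \<noteq> iota 0" by (simp_all add: M_one)
    have "1 \<in> {w. iota w \<in> H}"
    proof (rule left_ideal_maximal[OF left_ideal_ker_iota nondegenerate_f])
      show "ker_iota \<subseteq> {w. iota w \<in> H}"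
      proof
        fix w assume "w \<in> ker_iota"
        then have "iota w = iota 0" using iota_eq[of w 0] by simp
        then show "w \<in> {w. iota w \<in> H}" using subgroup.one_closed[OF sub] by (simp add: M_one)
      qed
      show "z \<notin> ker_iota" using z(2) by (simp add: iota_eq)
    qed (use z closed iota_diff_closed[OF sub] in auto)
    then have "iota w \<in> H" for w using closed[of 1 w] by simp
    then show ?thesis using subgroup.subset[OF sub] by (auto simp: carrier_M)
  qed
qed

end

section \<open>Base change\<close>

locale base_changed_module = induced_module scale bracket P f + K: field K
  for scale :: "'k::field_char_0 \<Rightarrow> 'a::ab_group_add \<Rightarrow> 'a" and bracket :: "'a \<Rightarrow> 'a \<Rightarrow> 'a"
    and P :: "'a set" and f :: "'a \<Rightarrow> 'k" and K :: "'c ring" (structure) +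
  fixes h :: "'k \<Rightarrow> 'c"
  assumes h_hom: "h \<in> ring_hom kring K"
begin

abbreviation sm where "sm \<equiv> \<lambda>c. act (env_scalar scale bracket c)"
abbreviation smU where "smU \<equiv> \<lambda>c a. env_scalar scale bracket c \<otimes>\<^bsub>U\<^esub> a"
abbreviation N2 where "N2 \<equiv> base_change_null K h M sm"
abbreviation N3 where "N3 \<equiv> base_change_null K h (add_monoid U) smU"
abbreviation BM where "BM \<equiv> base_change K h M sm"
abbreviation BR where "BR \<equiv> base_change_ring K h U (env_scalar scale bracket)"
abbreviation mact where "mact \<equiv> tensor_map2 N2 (\<lambda>(d, a) (d', m). (d \<otimes> d', act a m))"

lemma h_closed [simp]: "h c \<in> carrier K"
  using ring_hom_closed[OF h_hom, of c] by (simp add: ring_of_type_algebra_simps)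

lemma h_one: "h 1 = \<one>"
  using ring_hom_one[OF h_hom] by (simp add: ring_of_type_algebra_simps)

lemma h_add: "h (c + c') = h c \<oplus> h c'"
  using ring_hom_add[OF h_hom, of c c'] by (simp add: ring_of_type_algebra_simps)

lemma h_mult: "h (c * c') = h c \<otimes> h c'"
  using ring_hom_mult[OF h_hom, of c c'] by (simp add: ring_of_type_algebra_simps)

lemma sm_iota: "sm c (iota w) = iota (scalar c * w)"
  by (simp add: env_scalar_cls act_iota)

sublocale T2: tensor_data kring "add_monoid K" "\<lambda>d c. d \<otimes> h c" M sm
proof
  show "y \<otimes>\<^bsub>M\<^esub> y' \<in> carrier M" if "y \<in> carrier M" "y' \<in> carrier M" for y y'
    using that by (auto simp: carrier_M M_mult_iota)
  show "sm r y \<in> carrier M" if "y \<in> carrier M" for r y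
    using that by (auto simp: carrier_M sm_iota)
qed auto

sublocale T3: tensor_data kring "add_monoid K" "\<lambda>d c. d \<otimes> h c" "add_monoid U" smU
proof
  show "y \<otimes>\<^bsub>add_monoid U\<^esub> y' \<in> carrier (add_monoid U)" if "y \<in> carrier (add_monoid U)" "y' \<in> carrier (add_monoid U)" for y y'
    using that by (auto simp: carrier_U add_U)
  show "smU r y \<in> carrier (add_monoid U)" if "y \<in> carrier (add_monoid U)" for r y
    using that by (auto simp: carrier_U mult_U env_scalar_cls)
qed auto

lemma N2_null: "N2 = T2.null" by (simp add: base_change_null_def)
lemma N3_null: "N3 = T3.null" by (simp add: base_change_null_def)
lemma BM_quotient: "BM = T2.G" by (simp add: base_change_def tensor_group_def)

lemma carrier_BR: "carrier BR = carrier T3.G"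
  by (simp add: base_change_ring_def base_change_def tensor_group_def Let_def)

lemma N2_zero: "0 \<in> N2" and N2_add: "x \<in> N2 \<Longrightarrow> y \<in> N2 \<Longrightarrow> x + y \<in> N2"
  and N2_uminus: "x \<in> N2 \<Longrightarrow> - x \<in> N2" and N2_diff: "x \<in> N2 \<Longrightarrow> y \<in> N2 \<Longrightarrow> x - y \<in> N2"
  unfolding N2_null by (rule T2.N_zero T2.N_add T2.N_uminus T2.N_diff; assumption)+

lemma N2_left: "d \<in> carrier K \<Longrightarrow> d' \<in> carrier K \<Longrightarrow>
    frag_of (d \<oplus> d', iota w) - frag_of (d, iota w) - frag_of (d', iota w) \<in> N2"
  using T2.null_left[of d d' "iota w"] by (simp add: N2_null carrier_M)

lemma N2_right: "d \<in> carrier K \<Longrightarrow>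
    frag_of (d, iota (v + w)) - frag_of (d, iota v) - frag_of (d, iota w) \<in> N2"
  using T2.null_right[of d "iota v" "iota w"] by (simp add: N2_null carrier_M M_mult_iota)

lemma N2_balanced: "d \<in> carrier K \<Longrightarrow>
    frag_of (d \<otimes> h c, iota w) - frag_of (d, iota (scalar c * w)) \<in> N2"
  using T2.null_balanced[of d "iota w" c] by (simp add: N2_null carrier_M sm_iota ring_of_type_algebra_simps)

lemma N2_least:
  assumes zero: "0 \<in> H" and diff: "\<And>x y. x \<in> H \<Longrightarrow> y \<in> H \<Longrightarrow> x - y \<in> H"
    and left: "\<And>d d' w. d \<in> carrier K \<Longrightarrow> d' \<in> carrier K \<Longrightarrow>
      frag_of (d \<oplus> d', iota w) - frag_of (d, iota w) - frag_of (d', iota w) \<in> H"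
    and right: "\<And>d v w. d \<in> carrier K \<Longrightarrow>
      frag_of (d, iota (v + w)) - frag_of (d, iota v) - frag_of (d, iota w) \<in> H"
    and balanced: "\<And>d c w. d \<in> carrier K \<Longrightarrow>
      frag_of (d \<otimes> h c, iota w) - frag_of (d, iota (scalar c * w)) \<in> H"
  shows "N2 \<subseteq> H"
  unfolding N2_null
proof (rule T2.null_least)
  fix x x' y y' and r :: 'k
  assume x: "x \<in> carrier (add_monoid K)" and "y \<in> carrier M"
  then obtain v where v: "y = iota v" by (auto simp: carrier_M)
  show "frag_of (x \<otimes> h r, y) - frag_of (x, sm r y) \<in> H"
    using balanced[of x r v] x by (simp add: v sm_iota)
  {
    assume "x' \<in> carrier (add_monoid K)"
    then show "frag_of (x \<otimes>\<^bsub>add_monoid K\<^esub> x', y) - frag_of (x, y) - frag_of (x', y) \<in> H"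
      using left[of x x' v] x by (simp add: v)
  }
  {
    assume "y' \<in> carrier M"
    then obtain w where w: "y' = iota w" by (auto simp: carrier_M)
    show "frag_of (x, y \<otimes>\<^bsub>M\<^esub> y') - frag_of (x, y) - frag_of (x, y') \<in> H"
      using right[of x v w] x by (simp add: v w M_mult_iota)
  }
qed (use zero diff in auto)

lemma N2_act:
  assumes d: "d \<in> carrier K" and y: "y \<in> N2"
  shows "frag_extend (\<lambda>(d', m). frag_of (d \<otimes> d', act (cls a) m)) y \<in> N2"
proof -
  have "N2 \<subseteq> {y. frag_extend (\<lambda>(d', m). frag_of (d \<otimes> d', act (cls a) m)) y \<in> N2}"
  proof (rule N2_least)
    fix d' v w c assume d': "d' \<in> carrier K"
    show "frag_of (d', iota (v + w)) - frag_of (d', iota v) - frag_of (d', iota w)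
        \<in> {y. frag_extend (\<lambda>(d', m). frag_of (d \<otimes> d', act (cls a) m)) y \<in> N2}"
      using N2_right[of "d \<otimes> d'" "a * v" "a * w"] d d'
      by (simp add: frag_extend_diff act_iota distrib_left)
    show "frag_of (d' \<otimes> h c, iota w) - frag_of (d', iota (scalar c * w))
        \<in> {y. frag_extend (\<lambda>(d', m). frag_of (d \<otimes> d', act (cls a) m)) y \<in> N2}"
    proof -
      have "a * (scalar c * w) = scalar c * (a * w)" by (metis mult.assoc scalar_commute)
      then show ?thesis
        using N2_balanced[of "d \<otimes> d'" c "a * w"] d d'
        by (simp add: frag_extend_diff act_iota K.m_assoc)
    qed
  next
    fix d1 d2 w assume d12: "d1 \<in> carrier K" "d2 \<in> carrier K"
    show "frag_of (d1 \<oplus> d2, iota w) - frag_of (d1, iota w) - frag_of (d2, iota w)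
        \<in> {y. frag_extend (\<lambda>(d', m). frag_of (d \<otimes> d', act (cls a) m)) y \<in> N2}"
      using N2_left[of "d \<otimes> d1" "d \<otimes> d2" "a * w"] d d12
      by (simp add: frag_extend_diff act_iota K.r_distr)
  qed (auto simp: frag_extend_diff N2_zero N2_diff)
  with y show ?thesis by blast
qed

lemma subgroup_N2: "subgroup N2 (free_Abelian_group (carrier K \<times> carrier M))"
  unfolding N2_null using T2.subgroup_null by simp

lemma subgroup_N3: "subgroup N3 (free_Abelian_group (carrier K \<times> carrier U))"
  unfolding N3_null using T3.subgroup_null by simp

text \<open>Pure tensors of the ring suffice: they preserve a submodule, and they move a generator
  to any pure tensor of the module.\<close>

lemma mact_frag_of:
  assumes d: "d \<in> carrier K" and y: "Poly_Mapping.keys y \<subseteq> carrier K \<times> carrier M"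
  shows "mact (tensor_coset N3 (frag_of (d, cls a))) (tensor_coset N2 y)
    = tensor_coset N2 (frag_extend (\<lambda>(d', m). frag_of (d \<otimes> d', act (cls a) m)) y)"
proof -
  let ?g = "\<lambda>(d, a) (d', m). (d \<otimes> d', act a m)"
  have "mact (tensor_coset N3 (frag_of (d, cls a))) (tensor_coset N2 y)
    = tensor_coset N2 (frag_extend (\<lambda>p. frag_extend (\<lambda>r. frag_of (?g p r)) y) (frag_of (d, cls a)))"
  proof (rule tensor_map2_coset[OF subgroup_N3 subgroup_N2 subgroup_N2])
    fix x r assume x: "x \<in> N3" and r: "r \<in> carrier K \<times> carrier M"
    then obtain d' w where dw: "r = (d', iota w)" "d' \<in> carrier K" by (auto simp: carrier_M)
    have "N3 \<subseteq> {x. frag_extend (\<lambda>p. frag_of (?g p r)) x \<in> N2}"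
      unfolding N3_null
    proof (rule T3.null_least)
      fix e e' z z' and c :: 'k
      assume e: "e \<in> carrier (add_monoid K)" and "z \<in> carrier (add_monoid U)"
      then obtain v where v: "z = cls v" by (auto simp: carrier_U)
      show "frag_of (e \<otimes> h c, z) - frag_of (e, smU c z) \<in> {x. frag_extend (\<lambda>p. frag_of (?g p r)) x \<in> N2}"
      proof -
        have "(e \<otimes> h c) \<otimes> d' = (e \<otimes> d') \<otimes> h c"
          using e dw by (simp add: K.m_ac)
        then show ?thesis
          using N2_balanced[of "e \<otimes> d'" c "v * w"] e dw
          by (simp add: frag_extend_diff v mult_U act_iota env_scalar_cls mult.assoc)
      qed
      {
        assume "e' \<in> carrier (add_monoid K)"
        then show "frag_of (e \<otimes>\<^bsub>add_monoid K\<^esub> e', z) - frag_of (e, z) - frag_of (e', z)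
            \<in> {x. frag_extend (\<lambda>p. frag_of (?g p r)) x \<in> N2}"
          using N2_left[of "e \<otimes> d'" "e' \<otimes> d'" "v * w"] e dw
          by (simp add: frag_extend_diff v act_iota K.l_distr)
      }
      {
        assume "z' \<in> carrier (add_monoid U)"
        then obtain v' where v': "z' = cls v'" by (auto simp: carrier_U)
        show "frag_of (e, z \<otimes>\<^bsub>add_monoid U\<^esub> z') - frag_of (e, z) - frag_of (e, z')
            \<in> {x. frag_extend (\<lambda>p. frag_of (?g p r)) x \<in> N2}"
          using N2_right[of "e \<otimes> d'" "v * w" "v' * w"] e dw
          by (simp add: frag_extend_diff v v' add_U act_iota distrib_right)
      }
    qed (auto simp: frag_extend_diff N2_zero N2_diff)
    with x show "frag_extend (\<lambda>p. frag_of (?g p r)) x \<in> N2" by blast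
  next
    fix p y assume p: "p \<in> carrier K \<times> carrier U" and y: "y \<in> N2"
    then obtain e v where "p = (e, cls v)" "e \<in> carrier K" by (auto simp: carrier_U)
    then show "frag_extend (\<lambda>r. frag_of (?g p r)) y \<in> N2"
      using N2_act[of e y v] y by (simp add: case_prod_unfold)
  qed (use d y in auto)
  then show ?thesis by (simp add: case_prod_unfold)
qed

text \<open>
  The free abelian group on pairs of a scalar in \<open>K\<close> and a word polynomial maps onto the base change
  of the induced module, with kernel \<open>NZ\<close>.
\<close>

definition Zc :: "('c \<times> ('a list \<Rightarrow>\<^sub>0 'k) \<Rightarrow>\<^sub>0 int) set" where
  "Zc = {z. Poly_Mapping.keys z \<subseteq> carrier K \<times> UNIV}"

definition proj :: "('c \<times> ('a list \<Rightarrow>\<^sub>0 'k) \<Rightarrow>\<^sub>0 int) \<Rightarrow> ('c \<times> (('a list \<Rightarrow>\<^sub>0 'k) set \<times> 'k \<Rightarrow>\<^sub>0 int) set \<Rightarrow>\<^sub>0 int)" where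
  "proj = frag_extend (\<lambda>(d, w). frag_of (d, iota w))"

definition NZ :: "('c \<times> ('a list \<Rightarrow>\<^sub>0 'k) \<Rightarrow>\<^sub>0 int) set" where
  "NZ = {z \<in> Zc. proj z \<in> N2}"

text \<open>Only U(L) acts on the formal sums. The degree argument uses no more than this; scalars
  from K enter at the end of \<open>simple_base_change\<close>.\<close>

definition lmul :: "('a list \<Rightarrow>\<^sub>0 'k) \<Rightarrow> ('c \<times> ('a list \<Rightarrow>\<^sub>0 'k) \<Rightarrow>\<^sub>0 int) \<Rightarrow> ('c \<times> ('a list \<Rightarrow>\<^sub>0 'k) \<Rightarrow>\<^sub>0 int)" where
  "lmul a = frag_extend (\<lambda>(d, w). frag_of (d, a * w))"

text \<open>The formal sums whose class is d tensor the generator, with d in K: degree 0 after base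
  change.\<close>

definition VZ :: "('c \<times> ('a list \<Rightarrow>\<^sub>0 'k) \<Rightarrow>\<^sub>0 int) set" where
  "VZ = {z \<in> Zc. \<exists>d\<in>carrier K. z - frag_of (d, 1) \<in> NZ}"

lemma Zc_frag_of [simp]: "frag_of (d, w) \<in> Zc \<longleftrightarrow> d \<in> carrier K"
  by (simp add: Zc_def)

lemma Zc_add: "y \<in> Zc \<Longrightarrow> z \<in> Zc \<Longrightarrow> y + z \<in> Zc"
  using keys_add[of y z] by (auto simp: Zc_def)

lemma Zc_uminus: "z \<in> Zc \<Longrightarrow> - z \<in> Zc"
  by (simp add: Zc_def)

lemma Zc_diff: "y \<in> Zc \<Longrightarrow> z \<in> Zc \<Longrightarrow> y - z \<in> Zc"
  using Zc_add[of y "- z"] Zc_uminus by simp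

lemma Zc_induct [consumes 1, case_names zero one diff]:
  assumes "z \<in> Zc" "Q 0" "\<And>d w. d \<in> carrier K \<Longrightarrow> Q (frag_of (d, w))" "\<And>y z. y \<in> Zc \<Longrightarrow> z \<in> Zc \<Longrightarrow> Q y \<Longrightarrow> Q z \<Longrightarrow> Q (y - z)"
  shows "Q z"
proof -
  have "Poly_Mapping.keys z \<subseteq> carrier K \<times> UNIV" using assms(1) by (simp add: Zc_def)
  then show ?thesis
    by (rule free_Abelian_group_induct) (use assms in \<open>auto simp: Zc_def\<close>)
qed

lemma proj_simps: "proj 0 = 0" "proj (frag_of (d, w)) = frag_of (d, iota w)"
  "proj (y + z) = proj y + proj z" "proj (y - z) = proj y - proj z" "proj (- z) = - proj z"
  by (simp_all add: proj_def frag_extend_add frag_extend_diff frag_extend_minus)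

lemma lmul_simps: "lmul a 0 = 0" "lmul a (frag_of (d, w)) = frag_of (d, a * w)"
  "lmul a (y + z) = lmul a y + lmul a z" "lmul a (y - z) = lmul a y - lmul a z" "lmul a (- z) = - lmul a z"
  by (simp_all add: lmul_def frag_extend_add frag_extend_diff frag_extend_minus)

lemma lmul_Zc: "z \<in> Zc \<Longrightarrow> lmul a z \<in> Zc"
proof (induction rule: Zc_induct)
  case zero
  then show ?case by (simp add: lmul_simps Zc_def)
qed (simp_all add: lmul_simps Zc_diff)

lemma proj_keys: "z \<in> Zc \<Longrightarrow> Poly_Mapping.keys (proj z) \<subseteq> carrier K \<times> carrier M"
proof (induction rule: Zc_induct)
  case (diff y z)
  then show ?case using keys_diff[of "proj y" "proj z"] unfolding proj_simps by blast
qed (simp_all add: proj_simps carrier_M)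

lemma lmul_lmul: "z \<in> Zc \<Longrightarrow> lmul a (lmul a' z) = lmul (a * a') z"
  by (induction rule: Zc_induct) (simp_all add: lmul_simps mult.assoc)

lemma lmul_one: "z \<in> Zc \<Longrightarrow> lmul 1 z = z"
  by (induction rule: Zc_induct) (simp_all add: lmul_simps)

lemma NZ_Zc: "z \<in> NZ \<Longrightarrow> z \<in> Zc" by (simp add: NZ_def)

lemma NZ_zero: "0 \<in> NZ" by (simp add: NZ_def Zc_def proj_simps N2_zero)

lemma NZ_add: "y \<in> NZ \<Longrightarrow> z \<in> NZ \<Longrightarrow> y + z \<in> NZ"
  by (simp add: NZ_def Zc_add proj_simps N2_add)

lemma NZ_uminus: "z \<in> NZ \<Longrightarrow> - z \<in> NZ"
  by (simp add: NZ_def Zc_uminus proj_simps N2_uminus)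

lemma NZ_diff: "y \<in> NZ \<Longrightarrow> z \<in> NZ \<Longrightarrow> y - z \<in> NZ"
  by (simp add: NZ_def Zc_diff proj_simps N2_diff)

lemma NZ_left: "d \<in> carrier K \<Longrightarrow> d' \<in> carrier K \<Longrightarrow>
    frag_of (d \<oplus> d', w) - frag_of (d, w) - frag_of (d', w) \<in> NZ"
  by (simp add: NZ_def proj_simps N2_left Zc_diff)

lemma NZ_right: "d \<in> carrier K \<Longrightarrow> frag_of (d, v + w) - frag_of (d, v) - frag_of (d, w) \<in> NZ"
  by (simp add: NZ_def proj_simps N2_right Zc_diff)

lemma NZ_balanced: "d \<in> carrier K \<Longrightarrow> frag_of (d \<otimes> h c, w) - frag_of (d, scalar c * w) \<in> NZ"
  by (simp add: NZ_def proj_simps N2_balanced Zc_diff)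

lemma NZ_ker: "d \<in> carrier K \<Longrightarrow> v - w \<in> ker_iota \<Longrightarrow> frag_of (d, v) - frag_of (d, w) \<in> NZ"
  using iota_eq[of v w] by (simp add: NZ_def proj_simps Zc_diff N2_zero)

lemma NZ_zero_left: "frag_of (\<zero>, w) \<in> NZ"
  using NZ_uminus[OF NZ_left[of "\<zero>" "\<zero>" w]] by simp

lemma I_ker: "r \<in> I \<Longrightarrow> r * w \<in> ker_iota"
  using left_ideal_ker_iota I_mult_right[of r w] by (auto simp: left_ideal_over_def)

lemma lmul_cong: "z \<in> Zc \<Longrightarrow> a - a' \<in> I \<Longrightarrow> lmul a z - lmul a' z \<in> NZ"
proof (induction rule: Zc_induct)
  case (one d w)
  then show ?case using NZ_ker[of d "a * w" "a' * w"] I_ker[of "a - a'" w]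
    by (simp add: lmul_simps left_diff_distrib)
next
  case (diff y z)
  then show ?case using NZ_diff[of "lmul a y - lmul a' y" "lmul a z - lmul a' z"]
    by (simp add: lmul_simps algebra_simps)
qed (simp add: lmul_simps NZ_zero)

lemma lmul_add: "z \<in> Zc \<Longrightarrow> lmul (a + a') z - (lmul a z + lmul a' z) \<in> NZ"
proof (induction rule: Zc_induct)
  case (one d w)
  then show ?case using NZ_right[of d "a * w" "a' * w"]
    by (simp add: lmul_simps distrib_right algebra_simps)
next
  case (diff y z)
  then show ?case using NZ_diff[of "lmul (a + a') y - (lmul a y + lmul a' y)" "lmul (a + a') z - (lmul a z + lmul a' z)"]
    by (simp add: lmul_simps algebra_simps)
qed (simp add: lmul_simps NZ_zero)

lemma lmul_NZ: "z \<in> NZ \<Longrightarrow> lmul a z \<in> NZ"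
proof -
  assume z: "z \<in> NZ"
  then have "z \<in> Zc" by (rule NZ_Zc)
  then have "proj (lmul a z) = frag_extend (\<lambda>(d', m). frag_of (\<one> \<otimes> d', act (cls a) m)) (proj z)"
    by (induction rule: Zc_induct) (simp_all add: lmul_simps proj_simps act_iota frag_extend_diff)
  also have "\<dots> \<in> N2" using z by (intro N2_act) (auto simp: NZ_def)
  finally show ?thesis using \<open>z \<in> Zc\<close> by (simp add: NZ_def lmul_Zc)
qed

lemma word_tensor_module:
  assumes ds: "dual_system f d p x"
  shows "character_module scale bracket P (\<lambda>u. lmul (letter u)) (\<lambda>c. lmul (scalar c)) Zc NZ VZ f d p x"
proof
  have V_I: "z \<in> VZ" if "z \<in> Zc" "d \<in> carrier K" "z - frag_of (d, 1) \<in> NZ" for z d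
    using that by (auto simp: VZ_def)
  have V_E: "\<exists>d\<in>carrier K. z - frag_of (d, 1) \<in> NZ" "z \<in> Zc" if "z \<in> VZ" for z
    using that by (auto simp: VZ_def)
  show "NZ \<subseteq> VZ"
  proof
    fix z assume "z \<in> NZ"
    then show "z \<in> VZ" using NZ_diff[OF _ NZ_zero_left, of z 1] by (intro V_I[of _ "\<zero>"]) (auto simp: NZ_Zc)
  qed
  show "VZ \<subseteq> Zc" by (auto simp: VZ_def)
  show "y + z \<in> VZ" if y: "y \<in> VZ" and z: "z \<in> VZ" for y z
  proof -
    obtain d d' where d: "d \<in> carrier K" "d' \<in> carrier K" "y - frag_of (d, 1) \<in> NZ" "z - frag_of (d', 1) \<in> NZ"
      using V_E(1)[OF y] V_E(1)[OF z] by blast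
    have "(y - frag_of (d, 1)) + (z - frag_of (d', 1)) - (frag_of (d \<oplus> d', 1) - frag_of (d, 1) - frag_of (d', 1)) \<in> NZ"
      by (intro NZ_add NZ_diff[OF _ NZ_left] d)
    then show ?thesis using V_E(2)[OF y] V_E(2)[OF z] d
      by (intro V_I[of _ "d \<oplus> d'"] Zc_add) (simp_all add: algebra_simps)
  qed
  show "- z \<in> VZ" if z: "z \<in> VZ" for z
  proof -
    obtain d where d: "d \<in> carrier K" "z - frag_of (d, 1) \<in> NZ" using V_E(1)[OF z] by blast
    \<comment> \<open>Minus the formal pair with d agrees with the pair with the negative of d only
      modulo \<open>NZ\<close>: expand the sum of d and its negative, and note that a pair with
      first entry 0 is null.\<close>
    have "frag_of (d \<oplus> \<ominus> d, 1) - frag_of (d, 1) - frag_of (\<ominus> d, 1) - frag_of (\<zero>, 1) - (z - frag_of (d, 1)) \<in> NZ"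
      using d by (intro NZ_diff[OF NZ_diff[OF NZ_left NZ_zero_left]]) auto
    then have "- z - frag_of (\<ominus> d, 1) \<in> NZ" using d by (simp add: K.r_neg algebra_simps minus_diff_commute[of z])
    then show ?thesis using V_E(2)[OF z] d by (intro V_I[of _ "\<ominus> d"] Zc_uminus) auto
  qed
  show "lmul (scalar c) z \<in> VZ" if z: "z \<in> VZ" for c z
  proof -
    obtain d where d: "d \<in> carrier K" "z - frag_of (d, 1) \<in> NZ" using V_E(1)[OF z] by blast
    \<comment> \<open>The scalar is carried across the tensor product, so the coefficient d in K
      becomes d times \<open>h c\<close>.\<close>
    have "lmul (scalar c) (z - frag_of (d, 1)) - (frag_of (d \<otimes> h c, 1) - frag_of (d, scalar c * 1)) \<in> NZ"
      by (intro NZ_diff lmul_NZ NZ_balanced d)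
    then show ?thesis using V_E(2)[OF z] d
      by (intro V_I[of _ "d \<otimes> h c"] lmul_Zc) (simp_all add: lmul_simps)
  qed
  show "lmul (letter (u + v)) z - (lmul (letter u) z + lmul (letter v) z) \<in> NZ" if "z \<in> Zc" for z u v
    using NZ_add[OF lmul_cong[OF that, of "letter (u + v)" "letter u + letter v"] lmul_add[OF that, of "letter u" "letter v"]]
      letter_add[of u v] by (simp add: algebra_simps)
  show "lmul (letter (scale c u)) z - lmul (scalar c) (lmul (letter u) z) \<in> NZ" if "z \<in> Zc" for z c u
    using lmul_cong[OF that letter_scale[of c u]] by (simp add: lmul_lmul that)
  show "lmul (letter u) (lmul (letter v) z) - lmul (letter v) (lmul (letter u) z) - lmul (letter (bracket u v)) z \<in> NZ"
    if "z \<in> Zc" for z u v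
    using NZ_add[OF lmul_cong[OF that, of "letter u * letter v" "letter v * letter u + letter (bracket u v)"]
      lmul_add[OF that, of "letter v * letter u" "letter (bracket u v)"]] letter_bracket[of u v]
    by (simp add: lmul_lmul that algebra_simps)
  show "lmul (scalar (c + c')) z - (lmul (scalar c) z + lmul (scalar c') z) \<in> NZ" if "z \<in> Zc" for z c c'
    unfolding scalar_add using that by (rule lmul_add)
  show "lmul (scalar (c * c')) z - lmul (scalar c) (lmul (scalar c') z) \<in> NZ" if "z \<in> Zc" for z c c'
    using that by (simp add: lmul_lmul scalar_mult NZ_zero)
  show "lmul (scalar 1) z - z \<in> NZ" if "z \<in> Zc" for z
    using that by (simp add: lmul_one NZ_zero)
  show "lmul (letter u) (lmul (scalar c) z) - lmul (scalar c) (lmul (letter u) z) \<in> NZ" if "z \<in> Zc" for z u c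
    unfolding lmul_lmul[OF that] scalar_commute[of c] by (simp add: NZ_zero)
  show "lmul (letter u) z - lmul (scalar (f u)) z \<in> NZ" if z: "z \<in> VZ" and u: "u \<in> P" for z u
  proof -
    obtain d where d: "d \<in> carrier K" "z - frag_of (d, 1) \<in> NZ" using V_E(1)[OF z] by blast
    have "letter u - scalar (f u) \<in> ker_iota" using left_ideal_ker_iota u by (simp add: left_ideal_over_def)
    then have "frag_of (d, letter u) - frag_of (d, scalar (f u)) \<in> NZ" using d(1) by (intro NZ_ker)
    from NZ_add[OF NZ_diff[OF lmul_NZ[OF d(2)] lmul_NZ[OF d(2)]] this]
    have "lmul (letter u) (z - frag_of (d, 1)) - lmul (scalar (f u)) (z - frag_of (d, 1))
      + (frag_of (d, letter u) - frag_of (d, scalar (f u))) \<in> NZ" .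
    then show ?thesis by (simp add: lmul_simps algebra_simps)
  qed
qed (use ds in \<open>auto simp: Zc_add Zc_uminus lmul_Zc lmul_NZ NZ_zero NZ_add NZ_uminus lmul_simps\<close>)

lemma tensor_fil_exists:
  assumes "z \<in> Zc"
  shows "\<exists>n. fil (\<lambda>u. lmul (letter u)) VZ n z"
proof -
  let ?fil = "fil (\<lambda>u. lmul (letter u)) VZ"
  obtain d p x where ds: "dual_system f d p x" by (rule dual_system_exists[OF nondegenerate_f])
  interpret E: character_module scale bracket P "\<lambda>u. lmul (letter u)" "\<lambda>c. lmul (scalar c)" Zc NZ VZ f d p x
    by (rule word_tensor_module[OF ds])
  have diff: "\<exists>n. ?fil n (y - z)"
    if ex: "\<exists>n. ?fil n y" "\<exists>n. ?fil n z" for y z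
  proof -
    obtain k l where "?fil k y" "?fil l z" using ex by blast
    then have "?fil (max k l) (y - z)"
      by (intro E.fil_diff) (auto intro: fil_mono)
    then show ?thesis by blast
  qed
  have gen: "\<exists>n. ?fil n (frag_of (d, w))" if d: "d \<in> carrier K" for d w
  proof (induction w rule: poly_mapping_single_induct)
    case zero
    have "frag_of (d, 0) \<in> NZ" using NZ_uminus[OF NZ_right[OF d, of 0 0]] by simp
    then show ?case using E.fil_N by blast
  next
    case (single w c)
    show ?case
    proof (induction w)
      case Nil
      have "frag_of (d, scalar c) - frag_of (d \<otimes> h c, 1) \<in> NZ"
        using NZ_uminus[OF NZ_balanced[OF d, of c 1]] by simp
      then have "frag_of (d, scalar c) \<in> VZ" using d by (auto simp: VZ_def)
      then show ?case by (auto intro: fil.base)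
    next
      case (Cons u w)
      then obtain n where "?fil n (frag_of (d, Poly_Mapping.single w c))" by blast
      from fil.act[OF this, of u] show ?case unfolding lmul_simps single_Cons[of u w c] by blast
    qed
  next
    case (add v w)
    then obtain k l where "?fil k (frag_of (d, v))" "?fil l (frag_of (d, w))" by blast
    then have "?fil (max k l) (frag_of (d, v) + frag_of (d, w))"
      by (intro fil.add) (auto intro: fil_mono)
    then have "?fil (max k l) (frag_of (d, v + w))"
      by (rule E.fil_cong) (use NZ_right[OF d, of v w] in \<open>simp add: algebra_simps\<close>)
    then show ?case by blast
  qed
  show ?thesis using assms
  proof (induction rule: Zc_induct)
    case zero
    show ?case using E.fil_N[OF NZ_zero] by blast
  qed (auto intro: gen diff)
qed

lemma one_notin_NZ: "frag_of (\<one>, 1) \<notin> NZ"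
proof
  assume 1: "frag_of (\<one>, 1) \<in> NZ"
  obtain \<tau> :: "('a list \<Rightarrow>\<^sub>0 'k) \<Rightarrow> 'k" where \<tau>: "\<And>p q. \<tau> (p + q) = \<tau> p + \<tau> q" "\<And>c p. \<tau> (scalar c * p) = c * \<tau> p"
    "\<And>p. p \<in> I \<Longrightarrow> \<tau> p = 0" "\<And>q u. u \<in> P \<Longrightarrow> \<tau> (q * (letter u - scalar (f u))) = 0" "\<tau> 1 = 1"
    using character_functional[OF dual_f] by blast
  have \<tau>_iota: "\<tau> (SOME v'. iota v = iota v') = \<tau> v" for v
  proof -
    have "iota v = iota (SOME v'. iota v = iota v')" by (rule someI[of _ v]) simp
    then have "\<tau> (v - (SOME v'. iota v = iota v')) = 0"
      using ker_iota_functional[OF \<tau>(1-4)] by (simp add: iota_eq)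
    then show ?thesis using \<tau>(1)[of "v - (SOME v'. iota v = iota v')" "SOME v'. iota v = iota v'"] by simp
  qed
  \<comment> \<open>The extension of \<open>\<tau>\<close> to K: it sends d tensor the class of v to
    d times \<open>h (\<tau> v)\<close>, hence the generator to 1.\<close>
  let ?\<phi> = "\<lambda>d m. d \<otimes> h (\<tau> (SOME v. m = iota v))"
  have "\<exists>g. (\<forall>x\<in>carrier (add_monoid K). \<forall>y\<in>carrier M. g (frag_of (x, y)) = ?\<phi> x y) \<and>
      (\<forall>z\<in>N2. g z = \<one>\<^bsub>add_monoid K\<^esub>)"
    unfolding N2_null
    by (rule T2.lift[OF K.a_comm_group, of ?\<phi>])
      (auto simp: carrier_M M_mult_iota sm_iota \<tau>_iota \<tau>(1,2) h_add h_mult K.l_distr K.r_distr K.m_assoc)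
  then obtain g where g: "\<forall>x\<in>carrier (add_monoid K). \<forall>y\<in>carrier M. g (frag_of (x, y)) = ?\<phi> x y"
      "\<forall>z\<in>N2. g z = \<one>\<^bsub>add_monoid K\<^esub>" by blast
  have "frag_of (\<one>, iota 1) \<in> N2" using 1 by (simp add: NZ_def proj_simps)
  then have "g (frag_of (\<one>, iota 1)) = \<zero>" using g(2) by simp
  then show False using g(1) by (simp add: carrier_M \<tau>_iota \<tau>(5) h_one)
qed

lemma simple_base_change: "simple_module BR BM mact"
  unfolding simple_module_def
proof (intro conjI allI impI)
  have tc_eq: "tensor_coset N2 x = tensor_coset N2 y \<longleftrightarrow> x - y \<in> N2" for x y
    unfolding N2_null by (rule T2.tc_eq)
  have one: "\<one>\<^bsub>BM\<^esub> = tensor_coset N2 0" unfolding BM_quotient N2_null by (rule T2.one_G)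
  have carrier: "carrier BM = (\<lambda>z. tensor_coset N2 (proj z)) ` Zc"
  proof -
    have c: "carrier BM = tensor_coset N2 ` {x. Poly_Mapping.keys x \<subseteq> carrier K \<times> carrier M}"
      unfolding BM_quotient N2_null using T2.carrier_G by simp
    have "\<exists>z\<in>Zc. x = proj z" if "Poly_Mapping.keys x \<subseteq> carrier K \<times> carrier M" for x
      using that
    proof (induction rule: frag_induction)
      case zero
      then show ?case by (intro bexI[of _ 0]) (auto simp: proj_simps Zc_def)
    next
      case (diff x y)
      then obtain z z' where "z \<in> Zc" "x = proj z" "z' \<in> Zc" "y = proj z'" by blast
      then show ?case by (intro bexI[of _ "z - z'"]) (auto simp: proj_simps Zc_diff)
    next
      case (one a)
      then obtain d w where "a = (d, iota w)" "d \<in> carrier K" by (auto simp: carrier_M)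
      then show ?case by (intro bexI[of _ "frag_of (d, w)"]) (auto simp: proj_simps)
    qed
    then show ?thesis unfolding c using proj_keys by auto
  qed
  have NZ_iff: "z \<in> NZ \<longleftrightarrow> tensor_coset N2 (proj z) = \<one>\<^bsub>BM\<^esub>" if "z \<in> Zc" for z
    using that by (simp add: NZ_def one tc_eq)
  show "carrier BM \<noteq> {\<one>\<^bsub>BM\<^esub>}"
  proof
    assume a: "carrier BM = {\<one>\<^bsub>BM\<^esub>}"
    have "tensor_coset N2 (proj (frag_of (\<one>, 1))) \<in> carrier BM" unfolding carrier by (rule imageI) simp
    then have "frag_of (\<one>, 1) \<in> NZ" using a by (simp add: NZ_iff)
    then show False using one_notin_NZ by blast
  qed
  fix H assume H: "subgroup H BM \<and> (\<forall>r\<in>carrier BR. \<forall>x\<in>H. mact r x \<in> H)"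
  then have sub: "subgroup H BM" by blast
  define Hz where "Hz = {z \<in> Zc. tensor_coset N2 (proj z) \<in> H}"
  have ring_elt: "tensor_coset N3 (frag_of (d, cls a)) \<in> carrier BR" if "d \<in> carrier K" for d a
    unfolding carrier_BR N3_null using that by (intro T3.tc_carrier) simp
  have act_Hz: "mact (tensor_coset N3 (frag_of (d, cls a))) (tensor_coset N2 (proj z)) \<in> H" if "d \<in> carrier K" "z \<in> Hz" for d a z
    using H ring_elt[OF that(1)] that(2) by (auto simp: Hz_def)
  have Hz_diff: "y - z \<in> Hz" if "y \<in> Hz" "z \<in> Hz" for y z
    using that T2.subgroup_diff[of H "proj y" "proj z"] sub proj_keys[of y] proj_keys[of z]
    by (simp add: Hz_def Zc_diff proj_simps BM_quotient N2_null)
  have Hz_NZ: "NZ \<subseteq> Hz"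
  proof
    fix z assume z: "z \<in> NZ"
    then have "tensor_coset N2 (proj z) = \<one>\<^bsub>BM\<^esub>" using NZ_iff[OF NZ_Zc] by blast
    then show "z \<in> Hz" using subgroup.one_closed[OF sub] NZ_Zc[OF z] by (simp add: Hz_def)
  qed
  have Hz_lmul: "lmul a z \<in> Hz" if z: "z \<in> Hz" for a z
  proof -
    have zC: "z \<in> Zc" using z by (simp add: Hz_def)
    have "proj (lmul a z) = frag_extend (\<lambda>(d', m). frag_of (\<one> \<otimes> d', act (cls a) m)) (proj z)"
      using zC by (induction rule: Zc_induct) (simp_all add: lmul_simps proj_simps act_iota frag_extend_diff)
    then have "tensor_coset N2 (proj (lmul a z)) = mact (tensor_coset N3 (frag_of (\<one>, cls a))) (tensor_coset N2 (proj z))"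
      using mact_frag_of[OF K.one_closed proj_keys[OF zC], of a] by simp
    then show ?thesis using act_Hz[OF K.one_closed z, of a] zC by (simp add: Hz_def lmul_Zc)
  qed
  show "H = {\<one>\<^bsub>BM\<^esub>} \<or> H = carrier BM"
  proof (cases "H \<subseteq> {\<one>\<^bsub>BM\<^esub>}")
    case True
    then show ?thesis using subgroup.one_closed[OF sub] by blast
  next
    case False
    then obtain y where y: "y \<in> H" "y \<noteq> \<one>\<^bsub>BM\<^esub>" by blast
    then obtain z where z: "z \<in> Zc" "y = tensor_coset N2 (proj z)"
      using subgroup.subset[OF sub] unfolding carrier by blast
    with y have zH: "z \<in> Hz" "z \<notin> NZ" by (auto simp: Hz_def NZ_iff)
    obtain d p x where ds: "dual_system f d p x" by (rule dual_system_exists[OF nondegenerate_f])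
    interpret E: character_module scale bracket P "\<lambda>u. lmul (letter u)" "\<lambda>c. lmul (scalar c)" Zc NZ VZ f d p x
      by (rule word_tensor_module[OF ds])
    obtain n where "fil (\<lambda>u. lmul (letter u)) VZ n z" using tensor_fil_exists[OF z(1)] by blast
    from E.submodule_meets_V[OF Hz_diff Hz_lmul Hz_lmul zH this]
    obtain v where v: "v \<in> Hz" "v \<in> VZ" "v \<notin> NZ" by blast
    then obtain e where e: "e \<in> carrier K" "v - frag_of (e, 1) \<in> NZ" by (auto simp: VZ_def)
    \<comment> \<open>A pair with first entry 0 is null, so \<open>e = \<zero>\<close> would make
      \<open>v\<close> null as well.\<close>
    have "e \<noteq> \<zero>" using NZ_add[OF e(2) NZ_zero_left[of 1]] v(3) by auto
    then have eU: "e \<in> Units K" using e(1) K.field_Units by simp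
    from Hz_diff[OF v(1) subsetD[OF Hz_NZ e(2)]] have e1: "frag_of (e, 1) \<in> Hz" by simp
    \<comment> \<open>Acting by d times the inverse of e tensor w moves e tensor the generator to d
      tensor w, and such tensors generate the base change additively.\<close>
    have gen: "frag_of (d, w) \<in> Hz" if d: "d \<in> carrier K" for d w
    proof -
      have c: "d \<otimes> inv\<^bsub>K\<^esub> e \<in> carrier K" using d eU by simp
      have "mact (tensor_coset N3 (frag_of (d \<otimes> inv\<^bsub>K\<^esub> e, cls w))) (tensor_coset N2 (proj (frag_of (e, 1))))
          = tensor_coset N2 (frag_of (d, iota w))"
        using d e(1) eU by (subst mact_frag_of[OF c]) (auto simp: proj_simps act_iota carrier_M K.m_assoc)
      then show ?thesis using act_Hz[OF c e1, of w] d by (simp add: Hz_def proj_simps)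
    qed
    have "z \<in> Hz" if "z \<in> Zc" for z
      using that
    proof (induction rule: Zc_induct)
      case zero
      then show ?case using Hz_NZ NZ_zero by blast
    qed (auto intro: gen Hz_diff)
    then show ?thesis using subgroup.subset[OF sub] unfolding carrier by (auto simp: Hz_def)
  qed
qed

end

section \<open>Absolute simplicity and the Vergne polarization\<close>

context abelian_ideal
begin

lemma absolutely_simple_induced:
  assumes "nondegenerate f"
  shows "absolutely_simple TYPE('c) U (env_scalar scale bracket) (ind_module scale bracket f P) (ind_action scale bracket f P)"
  unfolding absolutely_simple_def Let_def
proof (intro allI impI, elim conjE)
  fix K :: "'c ring" and h :: "'k \<Rightarrow> 'c" assume K: "field K" and h: "h \<in> ring_hom ring_of_type_algebra K"
  interpret K: field K by (rule K)
  interpret B: base_changed_module scale bracket P f K h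
    by unfold_locales (use assms h in auto)
  show "simple_module B.BR B.BM B.mact" by (rule B.simple_base_change)
qed

text \<open>Members of the flag inside \<open>P\<close> are abelian; for those containing \<open>P\<close>, nondegeneracy puts the
  radical into \<open>P\<close>.\<close>

lemma vergne:
  assumes f: "nondegenerate f" and F: "flag_of_ideals scale bracket F" and FP: "F (dim P) = P"
  shows "P = vergne_polarization scale bracket f F"
proof -
  define n where "n = dim (UNIV :: 'a set)"
  have F': "F 0 = {0}" "F n = UNIV" "\<And>j. j < n \<Longrightarrow> F j \<subseteq> F (Suc j)"
    "\<And>j. j \<le> n \<Longrightarrow> lie_ideal scale bracket (F j)"
    using F by (auto simp: flag_of_ideals_def n_def Let_def)
  have lin: "f 0 = 0" using linear_dual[of f] f by (simp add: nondegenerate_def)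
  have mono: "F i \<subseteq> F j" if "i \<le> j" "j \<le> n" for i j
    using that
  proof (induction j)
    case (Suc j)
    then show ?case using F'(3)[of j] by (cases "i = Suc j") auto
  qed simp
  have pn: "dim P \<le> n"
  proof -
    obtain B0 where B0: "finite B0" "independent B0" "span B0 = UNIV" by (rule finite_basis)
    interpret fd: finite_dimensional_vector_space scale B0
      by unfold_locales (use B0 in auto)
    show ?thesis unfolding n_def by (rule fd.dim_subset) simp
  qed
  have sub: "radical bracket f (F i) \<subseteq> P" if i: "i \<le> n" for i
  proof (cases "i \<le> dim P")
    case True
    then show ?thesis using mono[OF True pn] FP by (auto simp: radical_def)
  next
    case False
    then have "P \<subseteq> F i" using mono[of "dim P" i] i FP by simp
    show ?thesis
    proof
      fix x assume x: "x \<in> radical bracket f (F i)"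
      have "f (bracket p x) = 0" if "p \<in> P" for p
      proof -
        have "f (bracket x p) = 0" using x that \<open>P \<subseteq> F i\<close> by (auto simp: radical_def)
        then show ?thesis using linear_dual[of f] f bracket_skew[of p x]
          by (metis diff_0 diff_self lin nondegenerate_def)
      qed
      then show "x \<in> P" using f by (simp add: nondegenerate_def)
    qed
  qed
  show ?thesis
    unfolding vergne_polarization_def n_def[symmetric]
  proof
    show "P \<subseteq> span (\<Union>i\<in>{1..n}. radical bracket f (F i))"
    \<comment> \<open>The union starts at index 1, so P occurs as a member of the flag only when
      \<open>dim P > 0\<close>; otherwise P is zero and lies in every span.\<close>
    proof (cases "dim P = 0")
      case True
      then have "P = {0}" using FP F'(1) by simp
      then show ?thesis by (simp add: span_zero)
    next
      case False
      have "P \<subseteq> radical bracket f (F (dim P))" unfolding FP using abelian_P lin by (auto simp: radical_def)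
      then have "P \<subseteq> (\<Union>i\<in>{1..n}. radical bracket f (F i))" using False pn by force
      then show ?thesis using span_superset by blast
    qed
    show "span (\<Union>i\<in>{1..n}. radical bracket f (F i)) \<subseteq> P"
      by (intro span_minimal subspace_P UN_least sub) simp
  qed
qed

end

theorem corollary4p4:
  fixes s :: "'k::field_char_0 \<Rightarrow> 'a::ab_group_add \<Rightarrow> 'a"
    and b :: "'a \<Rightarrow> 'a \<Rightarrow> 'a"
    and P :: "'a set"
    and f :: "'a \<Rightarrow> 'k"
  assumes "lie_algebra s b"
    and "CP_ideal s b P"
    and "f \<in> regular s b"
  shows
    "((\<forall>p :: 'k poly. degree p > 0 \<longrightarrow> (\<exists>x. poly p x = 0)) \<longrightarrow>
        simple_module (env s b UNIV) (ind_module s b f P) (ind_action s b f P)) \<and>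
     (completely_solvable s b \<longrightarrow>
        (\<forall>F. flag_of_ideals s b F \<and> F (vector_space.dim s P) = P \<longrightarrow>
           P = vergne_polarization s b f F) \<and>
        absolutely_simple TYPE('c) (env s b UNIV) (env_scalar s b)
          (ind_module s b f P) (ind_action s b f P)) \<and>
     semicenter s (env s b UNIV) (env_gen s b) (env_scalar s b) \<subseteq> env_sub s b P \<and>
     (\<forall>(D :: 'd ring) j. quotient_division_ring (env s b UNIV) D j \<longrightarrow>
        semicenter s D (j \<circ> env_gen s b) (j \<circ> env_scalar s b)
          \<subseteq> fractions_of (env s b UNIV) D j (env_sub s b P)) \<and>
     P \<subseteq> weights_kernel s b"
proof -
  interpret L: lie_algebra s b by fact
  have CP: "CP s b P" and ideal: "lie_ideal s b P" using assms(2) by (simp_all add: CP_ideal_def)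
  interpret A: abelian_ideal s b P
    by unfold_locales (use CP ideal in \<open>auto simp: CP_def lie_ideal_def\<close>)
  have f: "A.nondegenerate f" using CP assms(3) by (rule A.nondegenerate_regular)
  interpret ind: induced_module s b P f by unfold_locales (rule f)
  show ?thesis
    using ind.simple_induced A.vergne[OF f] A.absolutely_simple_induced[OF f]
      A.semicenter_U_subset[OF f] A.semicenter_D_subset[OF f] A.P_subset_weights_kernel
    by blast
qed

end
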